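(* In the standing setting of the context, assume (A1) and (A3), let $\bar\lambda_1$ be the generalized principal Lyapunov exponent of $\Phi$ described in the context, and assume $\bar\lambda_1>-\infty$. Then there is an invariant set $\widetilde\Omega_0\subset\Omega$ with $\mathbb P(\widetilde\Omega_0)=1$, on which $w(\omega)$, $w^*(\omega)$ of the context are defined and $X=E_1(\omega)\oplus F_1(\omega)$, where $E_1(\omega)=\mathrm{span}\{w(\omega)\}$ and $F_1(\omega)=\{u\in X:\langle u,w^*(\omega)\rangle=0\}$, such that: (1) the family $\{P(\omega)\}_{\omega\in\widetilde\Omega_0}$ of projections associated with the invariant decomposition $E_1(\omega)\oplus F_1(\omega)=X$ is strongly measurable and tempered; (2) $F_1(\omega)\cap X^+=\{u\in X^+: U_\omega(1)\,u=0\}$ for any $\omega\in\widetilde\Omega_0$; (3) for any $\omega\in\widetilde\Omega_0$ and $u\in X\setminus F_1(\omega)$ with $U_\omega(1)\,u\ne0$, $$\lim_{t\to\infty}\frac1t\ln\|U_\omega(t)\|=\lim_{t\to\infty}\frac1t\ln\|U_\omega(t)\,u\|=\bar\lambda_1;$$ (4) there exist $\widetilde\sigma\in(0,\infty]$ and $\bar\lambda_2=\bar\lambda_1-\widetilde\sigma$ such that $$\lim_{t\to\infty}\frac1t\ln\frac{\|U_\omega(t)|_{F_1(\omega)}\|}{\|U_\omega(t)\,w(\omega)\|}=-\widetilde\sigma\quad\text{and}\quad\lim_{t\to\infty}\frac1t\ln\|U_\omega(t)|_{F_1(\omega)}\|=\bar\lambda_2\qquad\text{for each }\omega\in\widetilde\Omega_0,$$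 that is, $\Phi$ admits a generalized exponential separation of type II.
   Context: Standing setting. $(\Omega,\mathfrak F,\mathbb P)$ is a complete probability space; $\theta\colon\mathbb R\times\Omega\to\Omega$, $(t,\omega)\mapsto\theta_t\omega$, is $(\mathfrak B(\mathbb R)\otimes\mathfrak F,\mathfrak F)$-measurable with $\theta_0=\mathrm{Id}$, $\theta_{t_1+t_2}=\theta_{t_2}\circ\theta_{t_1}$, each $\theta_t$ preserves $\mathbb P$, and $(\theta_t)$ is ergodic. A set $\Omega_0\in\mathfrak F$ is invariant if $\theta_t\Omega_0=\Omega_0$ for all $t\in\mathbb R$. $X$ is a real separable Banach space with $\dim X\ge 2$ and separable dual $X^*$, ordered by a closed convex cone $X^+$ ($X^++X^+\subset X^+$, $\mathbb R^+X^+\subset X^+$, $X^+\cap(-X^+)=\{0\}$; $u\le v$ iff $v-u\in X^+$) that is normal and reproducing ($X^+-X^+=X$). The dual cone is $(X^* )^+=\{u^*\in X^*:\langle u,u^*\rangle\ge0\ \forall u\in X^+\}$. The norms on $X$ and $X^*$ are monotone: $0\le u\le v$ implies $\|u\|\le\|v\|$. $\Phi=((U_\omega(t))_{\omega\in\Omega,t\ge0},(\theta_t)_{t\in\mathbb R})$ is a measurable linear skew-product semidynamical system on $X$: $(t,\omega,u)\mapsto U_\omega(t)u$ is $(\mathfrak B(\mathbb R^+)\otimes\mathfrak F\otimes\mathfrak B(X),\mathfrak B(X))$-measurable, $U_\omega(0)=\mathrm{Id}_X$, $U_{\theta_s\omega}(t)\circ U_\omega(s)=U_\omega(t+s)$ for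 $s,t\ge0$, and each $U_\omega(t)$ is a bounded linear operator on $X$. Its dual is given by $\langle u,U^*_\omega(t)u^*\rangle=\langle U_{\theta_{-t}\omega}(t)u,u^*\rangle$ for $u\in X$, $u^*\in X^*$, $t\ge0$. $\ln^+x=\max\{\ln x,0\}$, with $\ln^+0=0$; $\ln 0=-\infty$. (A1) The functions $\omega\mapsto\sup_{0\le s\le1}\ln^+\|U_\omega(s)\|$ and $\omega\mapsto\sup_{0\le s\le1}\ln^+\|U_{\theta_s\omega}(1-s)\|$ belong to $L_1(\Omega,\mathfrak F,\mathbb P)$. (A2) $U_\omega(t)u_1\le U_\omega(t)u_2$ for all $\omega\in\Omega$, $t\ge0$, $u_1\le u_2$ in $X$. (A3) (A2) holds, and there are $\mathbf e\in X^+$ with $\|\mathbf e\|=1$ and $U_\omega(1)\mathbf e\ne0$ for all $\omega\in\Omega$, and a measurable $\varkappa\colon\Omega\to[1,\infty)$ with $\ln^+\ln\varkappa\in L_1(\Omega,\mathfrak F,\mathbb P)$, such that for any $\omega\in\Omega$ and nonzero $u\in X^+$ either $U_\omega(1)u=0$, or $U_\omega(1)u\ne0$ and there is $\beta(\omega,u)>0$ with $\beta(\omega,u)\mathbf e\le U_\omega(1)u\le\varkappa(\omega)\beta(\omega,u)\mathbf e$. Fix $\mathbf e^*\in(X^* )^+$ with $\langle\mathbf e,\mathbf e^*\rangle=1$ and $\|\mathbf e^*\|=1$ (such $\mathbf e^*$ exists). For $\omega$ in a suitable invariant set of full measure the norm limits $$w(\omega)=\lim_{s\to\infty}\frac{U_{\theta_{-s}\omega}(s)\mathbf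 e}{\|U_{\theta_{-s}\omega}(s)\mathbf e\|},\qquad w^*(\omega)=\lim_{s\to\infty}\frac{U^*_{\theta_s\omega}(s)\mathbf e^*}{\|U^*_{\theta_s\omega}(s)\mathbf e^*\|}$$ exist and depend measurably on $\omega$. The exponent $\bar\lambda_1\in[-\infty,\infty)$ is $\bar\lambda_1=\int_\Omega\ln\|U_\omega(1)w(\omega)\|\,d\mathbb P(\omega)$, which equals $\lim_{t\to\infty}\frac1t\ln\|U_\omega(t)w(\omega)\|$ for $\mathbb P$-a.e. $\omega$. Decompositions. For a decomposition $E(\omega)\oplus F(\omega)=X$, $\omega\in\Omega_0$ ($E(\omega)$ of finite dimension $l$, $F(\omega)$ closed of codimension $l$), the associated projection $P(\omega)$ is the projection onto $F(\omega)$ along $E(\omega)$. It is invariant if $\Omega_0$ is invariant, $U_\omega(t)E(\omega)=E(\theta_t\omega)$ and $U_\omega(t)F(\omega)\subset F(\theta_t\omega)$ for $t\ge0$. The family $\{P(\omega)\}$ is strongly measurable if $\omega\mapsto P(\omega)u$ is $(\mathfrak F,\mathfrak B(X))$-measurable for each $u\in X$, and tempered if $\lim_{t\to\pm\infty}\frac1t\ln\|P(\theta_t\omega)\|=0$ for $\mathbb P$-a.e. $\omega\in\Omega_0$. A family of one-dimensional subspaces $\{\widetilde E(\omega)\}_{\omega\in\widetilde\Omega}$ is a family of generalized principal Floquet subspaces of $\Phi$ if $\widetilde\Omega$ is invariant, $\mathbb P(\widetilde\Omega)=1$, and (i) $\widetilde E(\omega)=\mathrm{span}\{w(\omega)\}$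 with $w\colon\widetilde\Omega\to X^+\setminus\{0\}$ measurable; (ii) $U_\omega(t)\widetilde E(\omega)=\widetilde E(\theta_t\omega)$ for $\omega\in\widetilde\Omega$, $t>0$; (iii) there is $\widetilde\lambda\in[-\infty,\infty)$ with $\widetilde\lambda=\lim_{t\to\infty}\frac1t\ln\|U_\omega(t)w(\omega)\|$ for each $\omega\in\widetilde\Omega$; (iv) $\limsup_{t\to\infty}\frac1t\ln\|U_\omega(t)u\|\le\widetilde\lambda$ for each $\omega\in\widetilde\Omega$ and $u\in X$ with $U_\omega(1)u\ne0$. $\Phi$ admits a generalized exponential separation of type II if there are a family of generalized principal Floquet subspaces $\{\widetilde E(\omega)\}_{\omega\in\widetilde\Omega}$ and a family of one-codimensional closed subspaces $\{\widetilde F(\omega)\}_{\omega\in\widetilde\Omega}$ with (i) $\widetilde F(\omega)\cap X^+=\{u\in X^+:U_\omega(1)u=0\}$; (ii) $X=\widetilde E(\omega)\oplus\widetilde F(\omega)$ for any $\omega\in\widetilde\Omega$, the decomposition being invariant with strongly measurable and tempered family of projections; (iii) there is $\widetilde\sigma\in(0,\infty]$ with $\lim_{t\to\infty}\frac1t\ln\frac{\|U_\omega(t)|_{\widetilde F(\omega)}\|}{\|U_\omega(t)w(\omega)\|}=-\widetilde\sigma$ for each $\omega\in\widetilde\Omega$. *)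

theory Defs
  imports "HOL-Probability.Probability"
begin

text \<open>
  Separability of \<open>X\<close> is the class \<open>second_countable_topology\<close>; the dual space is the type
  \<open>'a \<Rightarrow>\<^sub>L real\<close> with the operator norm. The sample space \<open>\<Omega>\<close> is \<open>space M\<close>, a possibly proper subset of
  its type, and all statements about sample points are relativised to it.
\<close>

section \<open>Ordered Banach spaces\<close>

definition cone_le :: "'a::real_normed_vector set \<Rightarrow> 'a \<Rightarrow> 'a \<Rightarrow> bool"
  where "cone_le C u v \<longleftrightarrow> v - u \<in> C"

definition dual_cone :: "'a::real_normed_vector set \<Rightarrow> ('a \<Rightarrow>\<^sub>L real) set"
  where "dual_cone C = {f. \<forall>u\<in>C. 0 \<le> blinfun_apply f u}"

definition monotone_norm :: "'a::real_normed_vector set \<Rightarrow> bool"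
  where "monotone_norm C \<longleftrightarrow> (\<forall>u v. cone_le C 0 u \<longrightarrow> cone_le C u v \<longrightarrow> norm u \<le> norm v)"

definition normal_cone :: "'a::real_normed_vector set \<Rightarrow> bool"
  where "normal_cone C \<longleftrightarrow>
    (\<exists>K>0. \<forall>u v. cone_le C 0 u \<longrightarrow> cone_le C u v \<longrightarrow> norm u \<le> K * norm v)"

definition reproducing_cone :: "'a::real_normed_vector set \<Rightarrow> bool"
  where "reproducing_cone C \<longleftrightarrow> (\<forall>x. \<exists>u\<in>C. \<exists>v\<in>C. x = u - v)"

text \<open>The second assumption says \<open>dim X \<ge> 2\<close>; the library's \<open>dim\<close> is \<open>0\<close> on infinite-dimensional
  spaces and cannot be used here.\<close>

locale ordered_banach_setting =
  fixes C :: "'a::{banach, second_countable_topology} set"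
  assumes separable_dual: "separable_space (euclidean :: ('a \<Rightarrow>\<^sub>L real) topology)"
    and dim_ge_2: "\<exists>u v :: 'a. u \<noteq> v \<and> independent {u, v}"
    and closed_cone: "closed C"
    and convex_cone: "convex_cone C"
    and pointed_cone: "C \<inter> uminus ` C = {0}"
    and normal_cone: "normal_cone C"
    and reproducing_cone: "reproducing_cone C"
    and monotone_norm: "monotone_norm C"
    and monotone_dual_norm: "monotone_norm (dual_cone C)"

section \<open>Metric dynamical systems and linear skew-product semidynamical systems\<close>

definition invariant_set :: "'w measure \<Rightarrow> (real \<Rightarrow> 'w \<Rightarrow> 'w) \<Rightarrow> 'w set \<Rightarrow> bool"
  where "invariant_set M \<theta> A \<longleftrightarrow> A \<in> sets M \<and> (\<forall>t. \<theta> t ` A = A)"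

locale ergodic_flow = prob_space M + complete_measure M
  for M :: "'w measure" +
  fixes \<theta> :: "real \<Rightarrow> 'w \<Rightarrow> 'w"
  assumes flow_measurable: "(\<lambda>(t, \<omega>). \<theta> t \<omega>) \<in> borel \<Otimes>\<^sub>M M \<rightarrow>\<^sub>M M"
    and flow_zero: "\<omega> \<in> space M \<Longrightarrow> \<theta> 0 \<omega> = \<omega>"
    and flow_add: "\<omega> \<in> space M \<Longrightarrow> \<theta> (t1 + t2) \<omega> = \<theta> t2 (\<theta> t1 \<omega>)"
    and flow_preserving: "distr M M (\<theta> t) = M"
    and flow_ergodic: "invariant_set M \<theta> A \<Longrightarrow> prob A = 0 \<or> prob A = 1"

locale linear_skew_product = ergodic_flow M \<theta>
  for M :: "'w measure" and \<theta> :: "real \<Rightarrow> 'w \<Rightarrow> 'w" +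
  fixes U :: "'w \<Rightarrow> real \<Rightarrow> ('a::{banach, second_countable_topology} \<Rightarrow>\<^sub>L 'a)"
  assumes cocycle_measurable:
      "(\<lambda>(t, \<omega>, u). blinfun_apply (U \<omega> t) u)
         \<in> restrict_space borel {0..} \<Otimes>\<^sub>M (M \<Otimes>\<^sub>M borel) \<rightarrow>\<^sub>M borel"
    and cocycle_zero: "\<omega> \<in> space M \<Longrightarrow> U \<omega> 0 = id_blinfun"
    and cocycle_add: "\<omega> \<in> space M \<Longrightarrow> 0 \<le> s \<Longrightarrow> 0 \<le> t \<Longrightarrow>
      U (\<theta> s \<omega>) t o\<^sub>L U \<omega> s = U \<omega> (t + s)"

text \<open>\<open>\<langle>u, U\<^sup>*\<^sub>\<omega>(t) u\<^sup>*\<rangle> = \<langle>U\<^bsub>\<theta>(-t)\<omega>\<^esub>(t) u, u\<^sup>*\<rangle>\<close>.\<close>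

definition dual_cocycle ::
    "(real \<Rightarrow> 'w \<Rightarrow> 'w) \<Rightarrow> ('w \<Rightarrow> real \<Rightarrow> ('a::real_normed_vector \<Rightarrow>\<^sub>L 'a)) \<Rightarrow>
      'w \<Rightarrow> real \<Rightarrow> ('a \<Rightarrow>\<^sub>L real) \<Rightarrow> ('a \<Rightarrow>\<^sub>L real)"
  where "dual_cocycle \<theta> U \<omega> t f = f o\<^sub>L U (\<theta> (- t) \<omega>) t"

section \<open>Assumptions (A1)--(A3)\<close>

definition ln_plus :: "real \<Rightarrow> real"
  where "ln_plus x = (if x \<le> 0 then 0 else max (ln x) 0)"

text \<open>The extended logarithm, with value \<open>-\<infinity>\<close> at \<open>0\<close>; it is only applied to nonnegative numbers.\<close>

definition eln :: "real \<Rightarrow> ereal"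
  where "eln x = (if x \<le> 0 then - \<infinity> else ereal (ln x))"

text \<open>The suprema in (A1) are taken in \<open>[0, \<infinity>]\<close>, since a real-valued \<open>SUP\<close> of an unbounded set carries
  no information. A nonnegative function is in \<open>L\<^sub>1\<close> iff it is measurable with finite integral.\<close>

definition assumption_A1 ::
    "'w measure \<Rightarrow> (real \<Rightarrow> 'w \<Rightarrow> 'w) \<Rightarrow> ('w \<Rightarrow> real \<Rightarrow> ('a::real_normed_vector \<Rightarrow>\<^sub>L 'a)) \<Rightarrow> bool"
  where "assumption_A1 M \<theta> U \<longleftrightarrow>
    (let f = (\<lambda>\<omega>. SUP s\<in>{0..1}. ennreal (ln_plus (norm (U \<omega> s))));
         g = (\<lambda>\<omega>. SUP s\<in>{0..1}. ennreal (ln_plus (norm (U (\<theta> s \<omega>) (1 - s)))))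
     in f \<in> borel_measurable M \<and> (\<integral>\<^sup>+\<omega>. f \<omega> \<partial>M) < \<infinity> \<and>
        g \<in> borel_measurable M \<and> (\<integral>\<^sup>+\<omega>. g \<omega> \<partial>M) < \<infinity>)"

definition assumption_A2 ::
    "'w measure \<Rightarrow> ('w \<Rightarrow> real \<Rightarrow> ('a::real_normed_vector \<Rightarrow>\<^sub>L 'a)) \<Rightarrow> 'a set \<Rightarrow> bool"
  where "assumption_A2 M U C \<longleftrightarrow>
    (\<forall>\<omega>\<in>space M. \<forall>t\<ge>0. \<forall>u v. cone_le C u v \<longrightarrow>
       cone_le C (blinfun_apply (U \<omega> t) u) (blinfun_apply (U \<omega> t) v))"

text \<open>The vector \<open>e\<close> is a parameter because \<open>w\<close> and \<open>w\<^sup>*\<close> below are built from it.\<close>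

definition assumption_A3 ::
    "'w measure \<Rightarrow> ('w \<Rightarrow> real \<Rightarrow> ('a::real_normed_vector \<Rightarrow>\<^sub>L 'a)) \<Rightarrow> 'a set \<Rightarrow> 'a \<Rightarrow> bool"
  where "assumption_A3 M U C e \<longleftrightarrow>
    assumption_A2 M U C \<and>
    e \<in> C \<and> norm e = 1 \<and> (\<forall>\<omega>\<in>space M. blinfun_apply (U \<omega> 1) e \<noteq> 0) \<and>
    (\<exists>\<kappa> :: 'w \<Rightarrow> real.
       \<kappa> \<in> borel_measurable M \<and> (\<forall>\<omega>\<in>space M. 1 \<le> \<kappa> \<omega>) \<and>
       integrable M (\<lambda>\<omega>. ln_plus (ln (\<kappa> \<omega>))) \<and>
       (\<forall>\<omega>\<in>space M. \<forall>u\<in>C. u \<noteq> 0 \<longrightarrow>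
          blinfun_apply (U \<omega> 1) u = 0 \<or>
          (blinfun_apply (U \<omega> 1) u \<noteq> 0 \<and>
           (\<exists>\<beta>>0. cone_le C (\<beta> *\<^sub>R e) (blinfun_apply (U \<omega> 1) u) \<and>
                  cone_le C (blinfun_apply (U \<omega> 1) u) ((\<kappa> \<omega> * \<beta>) *\<^sub>R e)))))"

section \<open>Principal directions and the generalized principal Lyapunov exponent\<close>

definition pullback_direction ::
    "(real \<Rightarrow> 'w \<Rightarrow> 'w) \<Rightarrow> ('w \<Rightarrow> real \<Rightarrow> ('a::real_normed_vector \<Rightarrow>\<^sub>L 'a)) \<Rightarrow> 'a \<Rightarrow>
      'w \<Rightarrow> real \<Rightarrow> 'a"
  where "pullback_direction \<theta> U e \<omega> s =
    (let v = blinfun_apply (U (\<theta> (- s) \<omega>) s) e in v /\<^sub>R norm v)"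

definition dual_pullback_direction ::
    "(real \<Rightarrow> 'w \<Rightarrow> 'w) \<Rightarrow> ('w \<Rightarrow> real \<Rightarrow> ('a::real_normed_vector \<Rightarrow>\<^sub>L 'a)) \<Rightarrow> ('a \<Rightarrow>\<^sub>L real) \<Rightarrow>
      'w \<Rightarrow> real \<Rightarrow> ('a \<Rightarrow>\<^sub>L real)"
  where "dual_pullback_direction \<theta> U f \<omega> s =
    (let g = dual_cocycle \<theta> U (\<theta> s \<omega>) s f in g /\<^sub>R norm g)"

text \<open>\<open>Lim\<close> is arbitrary at sample points where the limit does not exist.\<close>

definition principal_w ::
    "(real \<Rightarrow> 'w \<Rightarrow> 'w) \<Rightarrow> ('w \<Rightarrow> real \<Rightarrow> ('a::real_normed_vector \<Rightarrow>\<^sub>L 'a)) \<Rightarrow> 'a \<Rightarrow> 'w \<Rightarrow> 'a"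
  where "principal_w \<theta> U e \<omega> = Lim at_top (pullback_direction \<theta> U e \<omega>)"

definition principal_w_dual ::
    "(real \<Rightarrow> 'w \<Rightarrow> 'w) \<Rightarrow> ('w \<Rightarrow> real \<Rightarrow> ('a::real_normed_vector \<Rightarrow>\<^sub>L 'a)) \<Rightarrow> ('a \<Rightarrow>\<^sub>L real) \<Rightarrow>
      'w \<Rightarrow> ('a \<Rightarrow>\<^sub>L real)"
  where "principal_w_dual \<theta> U f \<omega> = Lim at_top (dual_pullback_direction \<theta> U f \<omega>)"

text \<open>The integral of an extended-real function, positive part minus negative part. The Bochner
  integral would give \<open>0\<close> where the value is \<open>-\<infinity>\<close>.\<close>

definition ext_integral :: "'w measure \<Rightarrow> ('w \<Rightarrow> ereal) \<Rightarrow> ereal"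
  where "ext_integral M h =
    enn2ereal (\<integral>\<^sup>+\<omega>. e2ennreal (h \<omega>) \<partial>M) - enn2ereal (\<integral>\<^sup>+\<omega>. e2ennreal (- h \<omega>) \<partial>M)"

definition principal_exponent ::
    "'w measure \<Rightarrow> (real \<Rightarrow> 'w \<Rightarrow> 'w) \<Rightarrow> ('w \<Rightarrow> real \<Rightarrow> ('a::real_normed_vector \<Rightarrow>\<^sub>L 'a)) \<Rightarrow> 'a \<Rightarrow> ereal"
  where "principal_exponent M \<theta> U e =
    ext_integral M (\<lambda>\<omega>. eln (norm (blinfun_apply (U \<omega> 1) (principal_w \<theta> U e \<omega>))))"

section \<open>Invariant decompositions and exponential separation\<close>

text \<open>A decomposition \<open>X = E(\<omega>) \<oplus> F(\<omega>)\<close> with \<open>E(\<omega>)\<close> one-dimensional and \<open>F(\<omega>)\<close> closed; \<open>F(\<omega>)\<close> then has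
  codimension one.\<close>

definition decomposition1 ::
    "'w set \<Rightarrow> ('w \<Rightarrow> 'a::real_normed_vector set) \<Rightarrow> ('w \<Rightarrow> 'a set) \<Rightarrow> bool"
  where "decomposition1 \<Omega>\<^sub>0 E F \<longleftrightarrow>
    (\<forall>\<omega>\<in>\<Omega>\<^sub>0. subspace (E \<omega>) \<and> dim (E \<omega>) = 1 \<and> subspace (F \<omega>) \<and> closed (F \<omega>) \<and>
       E \<omega> \<inter> F \<omega> = {0} \<and> (\<forall>x. \<exists>y\<in>E \<omega>. \<exists>z\<in>F \<omega>. x = y + z))"

definition invariant_decomposition1 ::
    "'w measure \<Rightarrow> (real \<Rightarrow> 'w \<Rightarrow> 'w) \<Rightarrow> ('w \<Rightarrow> real \<Rightarrow> ('a::real_normed_vector \<Rightarrow>\<^sub>L 'a)) \<Rightarrow>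
      'w set \<Rightarrow> ('w \<Rightarrow> 'a set) \<Rightarrow> ('w \<Rightarrow> 'a set) \<Rightarrow> bool"
  where "invariant_decomposition1 M \<theta> U \<Omega>\<^sub>0 E F \<longleftrightarrow>
    invariant_set M \<theta> \<Omega>\<^sub>0 \<and> decomposition1 \<Omega>\<^sub>0 E F \<and>
    (\<forall>\<omega>\<in>\<Omega>\<^sub>0. \<forall>t\<ge>0. blinfun_apply (U \<omega> t) ` E \<omega> = E (\<theta> t \<omega>) \<and>
                     blinfun_apply (U \<omega> t) ` F \<omega> \<subseteq> F (\<theta> t \<omega>))"

text \<open>The projection onto the second summand \<open>F\<close> along \<open>E\<close>.\<close>

definition proj_onto_along :: "'a::real_normed_vector set \<Rightarrow> 'a set \<Rightarrow> 'a \<Rightarrow> 'a"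
  where "proj_onto_along F E u = (THE v. v \<in> F \<and> u - v \<in> E)"

definition strongly_measurable_family ::
    "'w measure \<Rightarrow> 'w set \<Rightarrow> ('w \<Rightarrow> 'a::real_normed_vector \<Rightarrow> 'a) \<Rightarrow> bool"
  where "strongly_measurable_family M \<Omega>\<^sub>0 P \<longleftrightarrow>
    (\<forall>u. (\<lambda>\<omega>. P \<omega> u) \<in> restrict_space M \<Omega>\<^sub>0 \<rightarrow>\<^sub>M borel)"

text \<open>Boundedness is required explicitly because \<open>onorm\<close> is meaningless on unbounded maps.\<close>

definition tempered_family ::
    "'w measure \<Rightarrow> (real \<Rightarrow> 'w \<Rightarrow> 'w) \<Rightarrow> 'w set \<Rightarrow> ('w \<Rightarrow> 'a::real_normed_vector \<Rightarrow> 'a) \<Rightarrow> bool"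
  where "tempered_family M \<theta> \<Omega>\<^sub>0 P \<longleftrightarrow>
    (\<forall>\<omega>\<in>\<Omega>\<^sub>0. bounded_linear (P \<omega>)) \<and>
    (AE \<omega> in M. \<omega> \<in> \<Omega>\<^sub>0 \<longrightarrow>
       ((\<lambda>t. ereal (1 / t) * eln (onorm (P (\<theta> t \<omega>)))) \<longlongrightarrow> 0) at_top \<and>
       ((\<lambda>t. ereal (1 / t) * eln (onorm (P (\<theta> t \<omega>)))) \<longlongrightarrow> 0) at_bot)"

definition restricted_norm :: "('a::real_normed_vector \<Rightarrow>\<^sub>L 'a) \<Rightarrow> 'a set \<Rightarrow> real"
  where "restricted_norm A F = (SUP u\<in>{u\<in>F. norm u \<le> 1}. norm (blinfun_apply A u))"

definition principal_Floquet ::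
    "'w measure \<Rightarrow> (real \<Rightarrow> 'w \<Rightarrow> 'w) \<Rightarrow> ('w \<Rightarrow> real \<Rightarrow> ('a::real_normed_vector \<Rightarrow>\<^sub>L 'a)) \<Rightarrow>
      'a set \<Rightarrow> 'w set \<Rightarrow> ('w \<Rightarrow> 'a set) \<Rightarrow> ('w \<Rightarrow> 'a) \<Rightarrow> bool"
  where "principal_Floquet M \<theta> U C \<Omega>\<^sub>0 E w \<longleftrightarrow>
    invariant_set M \<theta> \<Omega>\<^sub>0 \<and> measure M \<Omega>\<^sub>0 = 1 \<and>
    w \<in> restrict_space M \<Omega>\<^sub>0 \<rightarrow>\<^sub>M borel \<and>
    (\<forall>\<omega>\<in>\<Omega>\<^sub>0. w \<omega> \<in> C - {0} \<and> E \<omega> = span {w \<omega>}) \<and>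
    (\<forall>\<omega>\<in>\<Omega>\<^sub>0. \<forall>t>0. blinfun_apply (U \<omega> t) ` E \<omega> = E (\<theta> t \<omega>)) \<and>
    (\<exists>r::ereal. r < \<infinity> \<and>
       (\<forall>\<omega>\<in>\<Omega>\<^sub>0.
          ((\<lambda>t. ereal (1 / t) * eln (norm (blinfun_apply (U \<omega> t) (w \<omega>)))) \<longlongrightarrow> r) at_top) \<and>
       (\<forall>\<omega>\<in>\<Omega>\<^sub>0. \<forall>u. blinfun_apply (U \<omega> 1) u \<noteq> 0 \<longrightarrow>
          Limsup at_top (\<lambda>t. ereal (1 / t) * eln (norm (blinfun_apply (U \<omega> t) u))) \<le> r))"

text \<open>The separation with its data: the set, the two families and the generator \<open>w\<close> of \<open>E\<close>.\<close>

definition exponential_separation_II ::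
    "'w measure \<Rightarrow> (real \<Rightarrow> 'w \<Rightarrow> 'w) \<Rightarrow> ('w \<Rightarrow> real \<Rightarrow> ('a::real_normed_vector \<Rightarrow>\<^sub>L 'a)) \<Rightarrow>
      'a set \<Rightarrow> 'w set \<Rightarrow> ('w \<Rightarrow> 'a set) \<Rightarrow> ('w \<Rightarrow> 'a set) \<Rightarrow> ('w \<Rightarrow> 'a) \<Rightarrow> bool"
  where "exponential_separation_II M \<theta> U C \<Omega>\<^sub>0 E F w \<longleftrightarrow>
    principal_Floquet M \<theta> U C \<Omega>\<^sub>0 E w \<and>
    (\<forall>\<omega>\<in>\<Omega>\<^sub>0. F \<omega> \<inter> C = {u\<in>C. blinfun_apply (U \<omega> 1) u = 0}) \<and>
    invariant_decomposition1 M \<theta> U \<Omega>\<^sub>0 E F \<and>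
    strongly_measurable_family M \<Omega>\<^sub>0 (\<lambda>\<omega>. proj_onto_along (F \<omega>) (E \<omega>)) \<and>
    tempered_family M \<theta> \<Omega>\<^sub>0 (\<lambda>\<omega>. proj_onto_along (F \<omega>) (E \<omega>)) \<and>
    (\<exists>\<sigma>::ereal. 0 < \<sigma> \<and>
       (\<forall>\<omega>\<in>\<Omega>\<^sub>0.
          ((\<lambda>t. ereal (1 / t) *
              eln (restricted_norm (U \<omega> t) (F \<omega>) / norm (blinfun_apply (U \<omega> t) (w \<omega>))))
             \<longlongrightarrow> - \<sigma>) at_top))"

end

theory Submission
  imports Defs
begin

text \<open>
  One step of the cocycle contracts the oscillation of a vector relative to a positive one by the factor
  \<open>1 - 1 / \<kappa>\<^sup>2\<close>. By the maximal ergodic inequality, along almost every orbit \<open>\<kappa>\<close> stays below some constant at least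
  half of the time, in both time directions, so these factors multiply up exponentially. This gives the two limits
  \<open>w\<close> and \<open>w\<^sup>*\<close> together with an exponential decay of the cocycle on \<open>F\<^sub>1\<close> relative to \<open>w\<close>.
  The growth rates on \<open>E\<^sub>1\<close> and \<open>F\<^sub>1\<close> exist and are constant by Kingman's theorem,
  and the decay at one typical point separates them. The norm of the projection is comparable to \<open>1 / \<langle>w, w\<^sup>*\<rangle>\<close>, whose
  logarithm has increments with an integrable one-sided bound and hence grows sublinearly.
\<close>

section \<open>Measure-preserving transformations\<close>

text \<open>The conclusion is demanded at every point of an invariant set, for real times and in
  norm, whereas the ergodic estimates give almost sure information at integer times. Two devices
  bridge the gap. The suprema in (A1) control the cocycle inside a unit interval by functions that
  grow sublinearly along orbits. And what holds on almost every orbit at arbitrarily early and late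
  times is carried to the whole orbit by equivariance or submultiplicativity.

  A second obstacle is that \<open>ln \<kappa>\<close> may fail to be integrable. Along orbits
  \<open>\<kappa>\<close> therefore enters only through the frequency of the times at which it lies
  below a constant, and temperedness must come from (A1) and the finiteness of the exponent instead.

  A third is that the cocycle may vanish on the complementary subspace, where the rate is then
  \<open>- \<infinity>\<close>. Rates are expressed by comparison with exponentials, and logarithms
  are taken only after a truncation from below.

  The maximal inequality carries the pointwise estimates, Kingman's theorem included; Fatou's lemma
  identifies Kingman's constant for \<open>w\<close> with the integral that defines the
  exponent.\<close>

locale mp_transformation = prob_space M for M :: "'w measure" +
  fixes T :: "'w \<Rightarrow> 'w"
  assumes T_measurable [measurable]: "T \<in> M \<rightarrow>\<^sub>M M"
    and T_preserves: "distr M M T = M"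
begin

lemma iter_measurable [measurable]: "(T ^^ n) \<in> M \<rightarrow>\<^sub>M M"
proof (induction n)
  case (Suc n)
  have "(\<lambda>\<omega>. T ((T ^^ n) \<omega>)) \<in> M \<rightarrow>\<^sub>M M"
    by (rule measurable_compose[OF Suc T_measurable])
  then show ?case by (simp add: comp_def)
qed (simp add: id_def)

lemma iter_distr: "distr M M (T ^^ n) = M"
proof (induction n)
  case (Suc n)
  have "distr M M (T ^^ Suc n) = distr (distr M M (T ^^ n)) M T"
    by (subst distr_distr) auto
  then show ?case using Suc T_preserves by (simp only:)
qed (simp add: distr_id2)

lemma iter_space: "\<omega> \<in> space M \<Longrightarrow> (T ^^ n) \<omega> \<in> space M"
  using measurable_space[OF iter_measurable] by blast

lemma T_space: "\<omega> \<in> space M \<Longrightarrow> T \<omega> \<in> space M"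
  using measurable_space[OF T_measurable] by blast

lemma integrable_comp_T: "integrable M f \<Longrightarrow> integrable M (\<lambda>\<omega>. f (T \<omega>))"
  for f :: "'w \<Rightarrow> real"
  using integrable_distr_eq[of T M M f] T_preserves by auto

lemma integral_comp_T: "f \<in> borel_measurable M \<Longrightarrow> (\<integral>\<omega>. f (T \<omega>) \<partial>M) = (\<integral>\<omega>. f \<omega> \<partial>M)"
  for f :: "'w \<Rightarrow> real"
  using integral_distr[of T M M f] T_preserves by auto

lemma integrable_comp_iter: "integrable M f \<Longrightarrow> integrable M (\<lambda>\<omega>. f ((T ^^ n) \<omega>))"
  for f :: "'w \<Rightarrow> real"
  using integrable_distr_eq[of "T ^^ n" M M f] iter_distr by auto

lemma integral_comp_iter: "f \<in> borel_measurable M \<Longrightarrow> (\<integral>\<omega>. f ((T ^^ n) \<omega>) \<partial>M) = (\<integral>\<omega>. f \<omega> \<partial>M)"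
  for f :: "'w \<Rightarrow> real"
  using integral_distr[of "T ^^ n" M M f] iter_distr by auto

lemma AE_iter:
  assumes "AE \<omega> in M. Q \<omega>"
  shows "AE \<omega> in M. \<forall>n. Q ((T ^^ n) \<omega>)"
proof -
  have "AE \<omega> in M. Q ((T ^^ n) \<omega>)" for n
    by (rule AE_distrD[OF iter_measurable]) (unfold iter_distr, rule assms)
  then show ?thesis by (simp add: AE_all_countable)
qed

section \<open>Birkhoff sums and the maximal ergodic inequality\<close>

definition orbit_sum :: "('w \<Rightarrow> real) \<Rightarrow> nat \<Rightarrow> 'w \<Rightarrow> real"
  where "orbit_sum g n \<omega> = (\<Sum>i<n. g ((T ^^ i) \<omega>))"

lemma orbit_sum_0 [simp]: "orbit_sum g 0 \<omega> = 0"
  by (simp add: orbit_sum_def)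

lemma orbit_sum_Suc: "orbit_sum g (Suc n) \<omega> = g \<omega> + orbit_sum g n (T \<omega>)"
  unfolding orbit_sum_def
  by (subst sum.lessThan_Suc_shift) (simp add: funpow_swap1)

lemma orbit_sum_measurable [measurable]:
  "g \<in> borel_measurable M \<Longrightarrow> orbit_sum g n \<in> borel_measurable M"
  unfolding orbit_sum_def[abs_def]
  by (intro borel_measurable_sum measurable_compose[OF iter_measurable])

lemma orbit_sum_add:
  "orbit_sum g (n + k) \<omega> = orbit_sum g n \<omega> + orbit_sum g k ((T ^^ n) \<omega>)"
proof (induction n arbitrary: \<omega>)
  case (Suc n)
  then show ?case by (simp add: orbit_sum_Suc funpow_swap1)
qed simp

lemma orbit_sum_nonneg: "(\<And>\<omega>. 0 \<le> g \<omega>) \<Longrightarrow> 0 \<le> orbit_sum g n \<omega>"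
  unfolding orbit_sum_def by (intro sum_nonneg) auto

text \<open>The recursion computes \<open>max(0, S\<^sub>1, \<dots>, S\<^sub>n)\<close> for the orbit sums \<open>S\<^sub>k\<close> of \<open>h\<close> and makes Garsia's
  inequality \<open>h \<ge> m\<^sub>n - m\<^sub>n \<circ> T\<close> on \<open>{m\<^sub>n > 0}\<close> immediate.\<close>

primrec orbit_max :: "('w \<Rightarrow> real) \<Rightarrow> nat \<Rightarrow> 'w \<Rightarrow> real" where
  "orbit_max h 0 \<omega> = 0"
| "orbit_max h (Suc n) \<omega> = max 0 (h \<omega> + orbit_max h n (T \<omega>))"

lemma orbit_max_nonneg: "0 \<le> orbit_max h n \<omega>"
  by (cases n) auto

lemma orbit_max_mono: "orbit_max h n \<omega> \<le> orbit_max h (Suc n) \<omega>"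
proof (induction n arbitrary: \<omega>)
  case (Suc n)
  from Suc[of "T \<omega>"] show ?case by (auto simp: max_def)
qed simp

lemma orbit_sum_le_max: "orbit_sum h n \<omega> \<le> orbit_max h n \<omega>"
proof (induction n arbitrary: \<omega>)
  case (Suc n)
  from Suc[of "T \<omega>"] show ?case by (auto simp: orbit_sum_Suc)
qed simp

lemma orbit_max_integrable:
  assumes "integrable M h"
  shows "integrable M (orbit_max h n)"
proof (induction n)
  case (Suc n)
  have "integrable M (\<lambda>\<omega>. max 0 (h \<omega> + orbit_max h n (T \<omega>)))"
    using assms integrable_comp_T[OF Suc] by (intro integrable_max) auto
  then show ?case by (simp cong: integrable_cong)
qed simp

text \<open>Integrate Garsia's inequality over \<open>{?m > 0}\<close>: the integral of
  \<open>?m - ?m \<circ> T\<close> vanishes because \<open>T\<close> preserves the measure. Since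
  \<open>g\<close> is nonnegative, the indicator may be dropped from \<open>g\<close> while it is
  kept on \<open>\<delta>\<close>.\<close>

lemma maximal_inequality_finite:
  assumes g: "integrable M g" and g0: "\<And>\<omega>. 0 \<le> g \<omega>" and \<delta>: "\<delta> > 0"
  defines "h \<equiv> \<lambda>\<omega>. g \<omega> - \<delta>"
  shows "\<delta> * prob {\<omega>\<in>space M. 0 < orbit_max h n \<omega>} \<le> (\<integral>\<omega>. g \<omega> \<partial>M)"
proof -
  let ?m = "orbit_max h n"
  let ?E = "{\<omega>\<in>space M. 0 < ?m \<omega>}"
  have h: "integrable M h" unfolding h_def using g by auto
  note m = orbit_max_integrable[OF h, of n]
  have [measurable]: "?m \<in> borel_measurable M" "h \<in> borel_measurable M" using m h by auto
  have E: "?E \<in> sets M" by measurable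
  have key: "?m \<omega> - ?m (T \<omega>) \<le> indicator ?E \<omega> * h \<omega>" if "\<omega> \<in> space M" for \<omega>
  proof (cases "0 < ?m \<omega>")
    case True
    then obtain k where k: "n = Suc k" by (cases n) auto
    with True have "?m \<omega> = h \<omega> + orbit_max h k (T \<omega>)" by (auto simp: max_def split: if_splits)
    also have "\<dots> \<le> h \<omega> + ?m (T \<omega>)" using orbit_max_mono[of h k "T \<omega>"] k by auto
    finally show ?thesis using True that by simp
  next
    case False
    then show ?thesis using orbit_max_nonneg[of h n "T \<omega>"] by simp
  qed
  have iE: "integrable M (\<lambda>\<omega>. indicator ?E \<omega> * h \<omega>)"
    using integrable_mult_indicator[OF E h] by simp
  have "0 = (\<integral>\<omega>. ?m \<omega> - ?m (T \<omega>) \<partial>M)"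
    using m integrable_comp_T[OF m] integral_comp_T[of ?m] by (subst Bochner_Integration.integral_diff) auto
  also have "\<dots> \<le> (\<integral>\<omega>. indicator ?E \<omega> * h \<omega> \<partial>M)"
    using m integrable_comp_T[OF m] iE key by (intro integral_mono) auto
  also have "\<dots> \<le> (\<integral>\<omega>. g \<omega> - \<delta> * indicator ?E \<omega> \<partial>M)"
    using iE g E g0 unfolding h_def
    by (intro integral_mono Bochner_Integration.integrable_diff integrable_mult_right integrable_real_indicator)
       (auto simp: indicator_def less_top[symmetric])
  also have "\<dots> = (\<integral>\<omega>. g \<omega> \<partial>M) - \<delta> * prob ?E"
    using g E by (subst Bochner_Integration.integral_diff) (auto simp: less_top[symmetric])
  finally show ?thesis by simp
qed

lemma maximal_inequality:
  assumes g: "integrable M g" and g0: "\<And>\<omega>. 0 \<le> g \<omega>" and \<delta>: "\<delta> > 0"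
  shows "prob {\<omega>\<in>space M. \<exists>n. orbit_sum g n \<omega> > \<delta> * real n} \<le> (\<integral>\<omega>. g \<omega> \<partial>M) / \<delta>"
proof -
  define h where "h = (\<lambda>\<omega>. g \<omega> - \<delta>)"
  let ?E = "\<lambda>n. {\<omega>\<in>space M. 0 < orbit_max h n \<omega>}"
  have h: "integrable M h" unfolding h_def using g by auto
  have [measurable]: "g \<in> borel_measurable M" "\<And>n. orbit_max h n \<in> borel_measurable M" "h \<in> borel_measurable M"
    using g h orbit_max_integrable[OF h] by auto
  have sum_h: "orbit_sum h n \<omega> = orbit_sum g n \<omega> - \<delta> * real n" for n \<omega>
    by (simp add: orbit_sum_def h_def sum_subtractf)
  have sub: "{\<omega>\<in>space M. \<exists>n. orbit_sum g n \<omega> > \<delta> * real n} \<subseteq> (\<Union>n. ?E n)"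
  proof safe
    fix \<omega> n assume "\<omega> \<in> space M" "\<delta> * real n < orbit_sum g n \<omega>"
    then show "\<omega> \<in> (\<Union>n. ?E n)" using orbit_sum_le_max[of h n \<omega>] sum_h[of n \<omega>] by (auto intro!: exI[of _ n])
  qed
  have inc: "incseq ?E"
    by (rule incseq_SucI) (use orbit_max_mono in \<open>auto intro: less_le_trans\<close>)
  have "(\<lambda>n. prob (?E n)) \<longlonglongrightarrow> prob (\<Union>n. ?E n)"
    by (rule finite_Lim_measure_incseq[OF _ inc]) auto
  moreover have "prob (?E n) \<le> (\<integral>\<omega>. g \<omega> \<partial>M) / \<delta>" for n
    using maximal_inequality_finite[OF g g0 \<delta>, of n] \<delta> unfolding h_def[symmetric]
    by (simp add: field_simps)
  ultimately have "prob (\<Union>n. ?E n) \<le> (\<integral>\<omega>. g \<omega> \<partial>M) / \<delta>"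
    by (intro LIMSEQ_le_const2[where X = "\<lambda>n. prob (?E n)"] exI[of _ 0]) auto
  moreover have "prob {\<omega>\<in>space M. \<exists>n. orbit_sum g n \<omega> > \<delta> * real n} \<le> prob (\<Union>n. ?E n)"
    by (rule finite_measure_mono[OF sub]) measurable
  ultimately show ?thesis by linarith
qed

text \<open>By dominated convergence the integral of \<open>q\<close> over \<open>B L\<close> tends
  to 0. The maximal inequality bounds by this integral, divided by \<open>\<delta>\<close>, the
  probability that the sums restricted to \<open>B L\<close> ever exceed slope
  \<open>\<delta>\<close>. Hence failure for all \<open>L\<close> at once is a null event. This is
  the truncation device behind every pointwise estimate below; the level \<open>L\<close> depends on
  the point.\<close>

lemma AE_ex_small_orbit_sum:
  assumes q: "integrable M q" and q0: "\<And>\<omega>. 0 \<le> q \<omega>"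
    and B: "\<And>L. B L \<in> sets M" and null: "AE \<omega> in M. \<exists>L0. \<forall>L\<ge>L0. \<omega> \<notin> B L" and \<delta>: "\<delta> > 0"
  shows "AE \<omega> in M. \<exists>L::nat. \<forall>n. orbit_sum (\<lambda>\<omega>. indicator (B L) \<omega> * q \<omega>) n \<omega> \<le> \<delta> * real n"
proof -
  let ?g = "\<lambda>L \<omega>. indicator (B L) \<omega> * q \<omega>"
  let ?F = "\<lambda>L. {\<omega>\<in>space M. \<exists>n. orbit_sum (?g L) n \<omega> > \<delta> * real n}"
  have g: "integrable M (?g L)" for L
    using integrable_mult_indicator[OF B q] by simp
  have [measurable]: "?g L \<in> borel_measurable M" for L using g by auto
  have "(\<lambda>L. \<integral>\<omega>. ?g L \<omega> \<partial>M) \<longlonglongrightarrow> (\<integral>\<omega>. 0 \<partial>M)"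
  proof (rule integral_dominated_convergence[where w = q])
    show "AE \<omega> in M. (\<lambda>L. ?g L \<omega>) \<longlonglongrightarrow> 0"
      using null
    proof eventually_elim
      case (elim \<omega>)
      then obtain L0 where "\<forall>L\<ge>L0. \<omega> \<notin> B L" by blast
      then have "\<forall>\<^sub>F L in sequentially. ?g L \<omega> = 0"
        by (auto simp: eventually_sequentially intro!: exI[of _ L0])
      then show ?case by (rule tendsto_eventually)
    qed
    show "AE \<omega> in M. norm (?g L \<omega>) \<le> q \<omega>" for L
      using q0 by (auto simp: indicator_def)
  qed (use q in auto)
  then have lim: "(\<lambda>L. (\<integral>\<omega>. ?g L \<omega> \<partial>M) / \<delta>) \<longlonglongrightarrow> 0"
    using \<delta> by (auto intro: tendsto_eq_intros)
  have F: "?F L \<in> sets M" for L by measurable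
  have "prob (\<Inter>L. ?F L) \<le> (\<integral>\<omega>. ?g L \<omega> \<partial>M) / \<delta>" for L
  proof -
    have "prob (\<Inter>L. ?F L) \<le> prob (?F L)" by (rule finite_measure_mono) (use F in auto)
    also have "\<dots> \<le> (\<integral>\<omega>. ?g L \<omega> \<partial>M) / \<delta>"
      by (rule maximal_inequality[OF g _ \<delta>]) (use q0 in auto)
    finally show ?thesis .
  qed
  then have "prob (\<Inter>L. ?F L) \<le> 0"
    by (intro LIMSEQ_le_const[OF lim] exI[of _ 0]) auto
  then have "prob (\<Inter>L. ?F L) = 0" by (simp add: measure_le_0_iff)
  then have "(\<Inter>L. ?F L) \<in> null_sets M" 
    using F by (auto simp: null_sets_def emeasure_eq_measure)
  then show ?thesis
    by (rule AE_I') (auto simp: not_le)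
qed

text \<open>The case \<open>q = 1\<close>, where the orbit sum counts visits to
  \<open>{k > K}\<close>. The bound holds for all \<open>n\<close> and not only eventually, so that
  later products of contraction factors decay from the first step on.\<close>

lemma AE_bounded_half_of_orbit:
  assumes [measurable]: "k \<in> borel_measurable M"
  shows "AE \<omega> in M. \<exists>K::nat. \<forall>n. real (card {i. i < n \<and> real K < k ((T ^^ i) \<omega>)}) \<le> real n / 2"
proof -
  let ?B = "\<lambda>K::nat. {\<omega>\<in>space M. real K < k \<omega>}"
  have "AE \<omega> in M. \<exists>K. \<forall>n. orbit_sum (\<lambda>\<omega>. indicator (?B K) \<omega> * 1) n \<omega> \<le> 1/2 * real n"
  proof (rule AE_ex_small_orbit_sum)
    show "AE \<omega> in M. \<exists>L0. \<forall>L\<ge>L0. \<omega> \<notin> ?B L"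
    proof (rule AE_I2)
      fix \<omega>
      obtain L0 :: nat where "k \<omega> \<le> real L0" using real_arch_simple by blast
      then show "\<exists>L0. \<forall>L\<ge>L0. \<omega> \<notin> ?B L" by (auto intro!: exI[of _ L0])
    qed
  qed auto
  then show ?thesis
  proof (rule AE_mp, intro AE_I2 impI)
    fix \<omega> assume \<omega>: "\<omega> \<in> space M"
      and "\<exists>K. \<forall>n. orbit_sum (\<lambda>\<omega>. indicator (?B K) \<omega> * 1) n \<omega> \<le> 1/2 * real n"
    then obtain K where K: "\<forall>n. orbit_sum (\<lambda>\<omega>. indicator (?B K) \<omega> * 1) n \<omega> \<le> 1/2 * real n"
      by blast
    have "orbit_sum (\<lambda>\<omega>. indicator (?B K) \<omega> * 1) n \<omega> = real (card {i. i < n \<and> real K < k ((T ^^ i) \<omega>)})" for n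
    proof -
      have "orbit_sum (\<lambda>\<omega>. indicator (?B K) \<omega> * 1) n \<omega> = (\<Sum>i<n. if real K < k ((T ^^ i) \<omega>) then 1 else 0)"
        unfolding orbit_sum_def using iter_space[OF \<omega>] by (intro sum.cong) (auto simp: indicator_def)
      also have "\<dots> = real (card {i. i < n \<and> real K < k ((T ^^ i) \<omega>)})"
        by (simp add: sum.If_cases Int_def)
      finally show ?thesis .
    qed
    then show "\<exists>K::nat. \<forall>n. real (card {i. i < n \<and> real K < k ((T ^^ i) \<omega>)}) \<le> real n / 2"
      using K by (auto intro!: exI[of _ K])
  qed
qed

text \<open>The excess of the value at time \<open>n\<close> over the level \<open>L\<close> is one
  summand of a nonnegative orbit sum with \<open>n + 1\<close> terms, and this sum has slope at most
  \<open>\<delta>/2\<close> once \<open>L\<close> is large enough. The constant \<open>L\<close>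
  itself is absorbed by the other half of \<open>\<delta>\<close>.\<close>

lemma AE_sublinear:
  assumes q: "integrable M q"
  shows "AE \<omega> in M. \<forall>\<delta>>0. \<forall>\<^sub>F n in sequentially. \<bar>q ((T ^^ n) \<omega>)\<bar> \<le> \<delta> * real n"
proof -
  have [measurable]: "q \<in> borel_measurable M" using q by auto
  let ?B = "\<lambda>L::nat. {\<omega>\<in>space M. real L < \<bar>q \<omega>\<bar>}"
  have *: "AE \<omega> in M. \<forall>\<^sub>F n in sequentially. \<bar>q ((T ^^ n) \<omega>)\<bar> \<le> \<delta> * real n" if \<delta>: "\<delta> > 0" for \<delta>
  proof -
    have "AE \<omega> in M. \<exists>L. \<forall>n. orbit_sum (\<lambda>\<omega>. indicator (?B L) \<omega> * \<bar>q \<omega>\<bar>) n \<omega> \<le> \<delta>/2 * real n"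
    proof (rule AE_ex_small_orbit_sum)
      show "AE \<omega> in M. \<exists>L0. \<forall>L\<ge>L0. \<omega> \<notin> ?B L"
      proof (rule AE_I2)
        fix \<omega>
        obtain L0 :: nat where "\<bar>q \<omega>\<bar> \<le> real L0" using real_arch_simple by blast
        then show "\<exists>L0. \<forall>L\<ge>L0. \<omega> \<notin> ?B L" by (auto intro!: exI[of _ L0])
      qed
    qed (use q \<delta> in auto)
    then show ?thesis
    proof (rule AE_mp, intro AE_I2 impI)
      fix \<omega> assume \<omega>: "\<omega> \<in> space M"
        and "\<exists>L. \<forall>n. orbit_sum (\<lambda>\<omega>. indicator (?B L) \<omega> * \<bar>q \<omega>\<bar>) n \<omega> \<le> \<delta>/2 * real n"
      then obtain L where L: "\<And>n. orbit_sum (\<lambda>\<omega>. indicator (?B L) \<omega> * \<bar>q \<omega>\<bar>) n \<omega> \<le> \<delta>/2 * real n"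
        by blast
      have 1: "\<bar>q ((T ^^ n) \<omega>)\<bar> \<le> real L + \<delta>/2 * real (Suc n)" for n
      proof -
        have "\<bar>q ((T ^^ n) \<omega>)\<bar> \<le> real L + indicator (?B L) ((T ^^ n) \<omega>) * \<bar>q ((T ^^ n) \<omega>)\<bar>"
          using iter_space[OF \<omega>, of n] by (auto simp: indicator_def)
        also have "indicator (?B L) ((T ^^ n) \<omega>) * \<bar>q ((T ^^ n) \<omega>)\<bar>
          \<le> orbit_sum (\<lambda>\<omega>. indicator (?B L) \<omega> * \<bar>q \<omega>\<bar>) (Suc n) \<omega>"
          unfolding orbit_sum_def by (simp add: sum_nonneg)
        finally show ?thesis using L[of "Suc n"] by simp
      qed
      obtain N :: nat where N: "real L + \<delta>/2 \<le> \<delta>/2 * real N"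
        using real_arch_simple[of "(real L + \<delta>/2) / (\<delta>/2)"] \<delta> by (auto simp: field_simps)
      have "\<bar>q ((T ^^ n) \<omega>)\<bar> \<le> \<delta> * real n" if "n \<ge> N" for n
      proof -
        have "\<delta>/2 * real N \<le> \<delta>/2 * real n" using that \<delta> by (intro mult_left_mono) auto
        moreover have "\<delta>/2 * real (Suc n) = \<delta>/2 + \<delta>/2 * real n" "\<delta> * real n = \<delta>/2 * real n + \<delta>/2 * real n"
          by (simp_all add: algebra_simps)
        ultimately show ?thesis using 1[of n] N by linarith
      qed
      then show "\<forall>\<^sub>F n in sequentially. \<bar>q ((T ^^ n) \<omega>)\<bar> \<le> \<delta> * real n"
        by (auto simp: eventually_sequentially)
    qed
  qed
  \<comment> \<open>Countably many tolerances \<open>1 / Suc j\<close> leave one null set that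
    serves all \<open>\<delta>\<close>. The same reduction recurs below.\<close>
  have "AE \<omega> in M. \<forall>j. \<forall>\<^sub>F n in sequentially. \<bar>q ((T ^^ n) \<omega>)\<bar> \<le> (1 / real (Suc j)) * real n"
    unfolding AE_all_countable by (intro allI *) simp
  then show ?thesis
  proof eventually_elim
    case (elim \<omega>)
    show ?case
    proof (intro allI impI)
      fix \<delta> :: real assume "\<delta> > 0"
      then obtain j where j: "1 / real (Suc j) < \<delta>" by (metis nat_approx_posE)
      from elim have "\<forall>\<^sub>F n in sequentially. \<bar>q ((T ^^ n) \<omega>)\<bar> \<le> (1 / real (Suc j)) * real n" by blast
      then show "\<forall>\<^sub>F n in sequentially. \<bar>q ((T ^^ n) \<omega>)\<bar> \<le> \<delta> * real n"
      proof eventually_elim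
        case (elim n)
        have "(1 / real (Suc j)) * real n \<le> \<delta> * real n" using j by (intro mult_right_mono) auto
        with elim show ?case by linarith
      qed
    qed
  qed
qed

section \<open>Subadditive processes along orbits\<close>

text \<open>Greedy covering: from a point outside the bad set jump to the end of a block on which \<open>a\<close> is at most
  \<open>c\<close> per step, from a bad point advance by one step.\<close>

lemma subadditive_greedy_bound:
  assumes D: "\<And>\<omega>. \<omega> \<in> D \<Longrightarrow> T \<omega> \<in> D"
    and sub: "\<And>\<omega> n k. \<omega> \<in> D \<Longrightarrow> a (n + k) \<omega> \<le> a n \<omega> + a k ((T ^^ n) \<omega>)"
    and a1: "\<And>\<omega>. \<omega> \<in> D \<Longrightarrow> a 1 \<omega> \<le> q \<omega>" and q0: "\<And>\<omega>. 0 \<le> q \<omega>"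
    and good: "\<And>\<omega>. \<omega> \<in> D \<Longrightarrow> \<omega> \<notin> B \<Longrightarrow> \<exists>k\<in>{1..L}. a k \<omega> \<le> c * real k"
    and "\<omega> \<in> D" and "1 \<le> n"
  shows "a (n::nat) \<omega> \<le> c * real n + orbit_sum (\<lambda>\<omega>. indicator B \<omega> * (q \<omega> + \<bar>c\<bar>)) n \<omega>
    + (\<Sum>j\<in>{n - L..<n}. q ((T ^^ j) \<omega>) + \<bar>c\<bar>)"
  using \<open>\<omega> \<in> D\<close> \<open>1 \<le> n\<close>
proof (induction n arbitrary: \<omega> rule: less_induct)
  case (less n)
  \<comment> \<open>A bad step costs up to \<open>q\<close> while the budget grants it only
    \<open>c\<close>, which may be negative. The summand \<open>\<bar>c\<bar>\<close> makes up for
    the difference.\<close>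
  let ?g = "\<lambda>\<omega>. indicator B \<omega> * (q \<omega> + \<bar>c\<bar>)"
  \<comment> \<open>A good block may end beyond \<open>n\<close>. As its length is at most
    \<open>L\<close>, it then starts within the last \<open>L\<close> times, and there the one-step
    bound \<open>q\<close> is paid instead.\<close>
  let ?R = "\<lambda>n \<omega>. (\<Sum>j\<in>{n - L..<n}. q ((T ^^ j) \<omega>) + \<bar>c\<bar>)"
  have g0: "0 \<le> orbit_sum ?g n \<omega>" for n \<omega>
    by (rule orbit_sum_nonneg) (use q0 in auto)
  have R0: "0 \<le> ?R n \<omega>" for n \<omega>
    by (rule sum_nonneg) (use q0 in \<open>auto intro: add_nonneg_nonneg\<close>)
  have R_shift: "?R (n - k) ((T ^^ k) \<omega>) \<le> ?R n \<omega>" if "k \<le> n" for k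
  proof -
    have "?R (n - k) ((T ^^ k) \<omega>) = (\<Sum>j\<in>{n - k - L..<n - k}. q ((T ^^ (j + k)) \<omega>) + \<bar>c\<bar>)"
      by (simp add: funpow_add)
    also have "\<dots> = (\<Sum>j\<in>{n - k - L + k..<n - k + k}. q ((T ^^ j) \<omega>) + \<bar>c\<bar>)"
      by (rule sum.shift_bounds_nat_ivl[symmetric])
    also have "\<dots> \<le> ?R n \<omega>"
      using that q0 by (intro sum_mono2) (auto intro: add_nonneg_nonneg)
    finally show ?thesis .
  qed
  show ?case
  proof (cases "\<omega> \<in> B")
    case True
    show ?thesis
    proof (cases "n = 1")
      case True
      then have "a n \<omega> \<le> q \<omega>" using a1 less.prems by simp
      also have "\<dots> \<le> c * real n + orbit_sum ?g n \<omega>"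
        using True \<open>\<omega> \<in> B\<close> by (simp add: orbit_sum_Suc)
      finally show ?thesis using R0[of \<omega> n] by linarith
    next
      case False
      have "a n \<omega> \<le> a 1 \<omega> + a (n - 1) ((T ^^ 1) \<omega>)"
        using sub[of \<omega> 1 "n - 1"] less.prems by simp
      also have "(T ^^ 1) \<omega> = T \<omega>" by simp
      also have "a 1 \<omega> + a (n - 1) (T \<omega>)
          \<le> q \<omega> + (c * real (n - 1) + orbit_sum ?g (n - 1) (T \<omega>) + ?R (n - 1) (T \<omega>))"
        using less.prems False
        by (intro add_mono a1[OF less.prems(1)] less.IH[of "n - 1" "T \<omega>"] D) auto
      also have "\<dots> \<le> c * real n + (q \<omega> + \<bar>c\<bar> + orbit_sum ?g (n - 1) (T \<omega>)) + ?R n \<omega>"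
      proof -
        have "c * real (n - 1) \<le> c * real n + \<bar>c\<bar>" using less.prems by (simp add: of_nat_diff algebra_simps)
        moreover have "?R (n - 1) (T \<omega>) \<le> ?R n \<omega>" using R_shift[of 1] less.prems by simp
        ultimately show ?thesis by linarith
      qed
      also have "q \<omega> + \<bar>c\<bar> + orbit_sum ?g (n - 1) (T \<omega>) = orbit_sum ?g n \<omega>"
        using orbit_sum_Suc[of ?g "n - 1" \<omega>] less.prems True by simp
      finally show ?thesis .
    qed
  next
    case False
    then obtain k where k: "1 \<le> k" "k \<le> L" "a k \<omega> \<le> c * real k" using good less.prems by force
    have D': "(T ^^ k) \<omega> \<in> D" for k using less.prems(1) D by (induction k) auto
    consider "k = n" | "k < n" | "n < k" by linarith
    then show ?thesis
    proof cases
      case 1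
      then show ?thesis using k g0[of n \<omega>] R0[of \<omega> n] by auto
    next
      case 2
      have "a n \<omega> \<le> a k \<omega> + a (n - k) ((T ^^ k) \<omega>)"
        using sub[of \<omega> k "n - k"] less.prems 2 by simp
      also have "\<dots> \<le> c * real k + (c * real (n - k) + orbit_sum ?g (n - k) ((T ^^ k) \<omega>) + ?R (n - k) ((T ^^ k) \<omega>))"
        using 2 k by (intro add_mono less.IH D') auto
      also have "\<dots> \<le> c * real n + orbit_sum ?g (n - k) ((T ^^ k) \<omega>) + ?R n \<omega>"
      proof -
        have "c * real k + c * real (n - k) = c * real n" using 2 by (simp add: of_nat_diff algebra_simps)
        then show ?thesis using R_shift[of k] 2 by linarith
      qed
      also have "orbit_sum ?g (n - k) ((T ^^ k) \<omega>) \<le> orbit_sum ?g n \<omega>"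
        using orbit_sum_add[of ?g k "n - k" \<omega>] g0[of k \<omega>] 2 by simp
      finally show ?thesis by simp
    next
      case 3
      \<comment> \<open>Now \<open>n < k \<le> L\<close>, so the window \<open>{n - L..<n}\<close>
        is all of \<open>{0..<n}\<close> and bounding every single step by \<open>q\<close> is
        affordable.\<close>
      have "a n \<omega> \<le> orbit_sum q n \<omega>" if "\<omega> \<in> D" "1 \<le> n" for n \<omega>
        using that(2,1)
      proof (induction n arbitrary: \<omega> rule: nat_induct_at_least)
        case (Suc n)
        have "a (Suc n) \<omega> \<le> a 1 \<omega> + a n (T \<omega>)" using sub[of \<omega> 1 n] Suc.prems by simp
        also have "\<dots> \<le> q \<omega> + orbit_sum q n (T \<omega>)"
          using a1[OF Suc.prems] Suc.IH[OF D[OF Suc.prems]] by linarith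
        finally show ?case by (simp add: orbit_sum_Suc)
      qed (use a1 in \<open>simp add: orbit_sum_Suc\<close>)
      from this[OF less.prems] have "a n \<omega> \<le> orbit_sum q n \<omega>" .
      also have "\<dots> = ?R n \<omega> - \<bar>c\<bar> * real n"
        using 3 k by (simp add: orbit_sum_def sum.distrib atLeast0LessThan)
      finally have "a n \<omega> \<le> ?R n \<omega> - \<bar>c\<bar> * real n" .
      moreover have "- \<bar>c\<bar> * real n \<le> c * real n" by (intro mult_right_mono) auto
      ultimately show ?thesis using g0[of n \<omega>] by linarith
    qed
  qed
qed

text \<open>The bad set consists of the points at which no block of length up to \<open>L\<close>
  achieves slope \<open>c\<close>. These sets shrink to a null set as \<open>L\<close> grows, so
  visits to them cost at most \<open>\<epsilon>/2\<close> per step. The final window has only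
  \<open>L\<close> terms, each of them sublinear, and costs the other half.\<close>

lemma subadditive_limsup_le_aux:
  assumes Ds: "D \<in> sets M" and D: "\<And>\<omega>. \<omega> \<in> D \<Longrightarrow> T \<omega> \<in> D"
    and a [measurable]: "\<And>n. a n \<in> borel_measurable M"
    and sub: "\<And>\<omega> n k. \<omega> \<in> D \<Longrightarrow> a (n + k) \<omega> \<le> a n \<omega> + a k ((T ^^ n) \<omega>)"
    and a1: "\<And>\<omega>. \<omega> \<in> D \<Longrightarrow> a 1 \<omega> \<le> q \<omega>"
    and q: "integrable M q" and q0: "\<And>\<omega>. 0 \<le> q \<omega>"
    and ex: "AE \<omega> in M. \<omega> \<in> D \<longrightarrow> (\<exists>n\<ge>1. a n \<omega> \<le> c * real n)" and \<epsilon>: "\<epsilon> > 0"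
  shows "AE \<omega> in M. \<omega> \<in> D \<longrightarrow> (\<forall>\<^sub>F n in sequentially. a n \<omega> \<le> (c + \<epsilon>) * real n)"
proof -
  note [measurable] = Ds
  let ?B = "\<lambda>L::nat. {\<omega>\<in>space M. \<omega> \<in> D \<and> (\<forall>k\<in>{1..L}. c * real k < a k \<omega>)}"
  let ?q = "\<lambda>\<omega>. q \<omega> + \<bar>c\<bar>"
  have iq: "integrable M ?q" using q by auto
  have "AE \<omega> in M. \<exists>L. \<forall>n. orbit_sum (\<lambda>\<omega>. indicator (?B L) \<omega> * ?q \<omega>) n \<omega> \<le> \<epsilon>/2 * real n"
  proof (rule AE_ex_small_orbit_sum[OF iq])
    show "AE \<omega> in M. \<exists>L0. \<forall>L\<ge>L0. \<omega> \<notin> ?B L"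
      using ex
    proof eventually_elim
      case (elim \<omega>)
      show ?case
      proof (cases "\<omega> \<in> D")
        case True
        with elim obtain n where "n \<ge> 1" "a n \<omega> \<le> c * real n" by blast
        then show ?thesis by (intro exI[of _ n]) force
      qed auto
    qed
  qed (use q0 \<epsilon> in \<open>auto intro: add_nonneg_nonneg\<close>)
  moreover note AE_sublinear[OF iq]
  ultimately show ?thesis
  proof eventually_elim
    case (elim \<omega>)
    have "\<forall>\<^sub>F n in sequentially. a n \<omega> \<le> (c + \<epsilon>) * real n" if \<omega>: "\<omega> \<in> D"
    proof -
      obtain L where L: "\<And>n. orbit_sum (\<lambda>\<omega>. indicator (?B L) \<omega> * ?q \<omega>) n \<omega> \<le> \<epsilon>/2 * real n"
        using elim(1) by blast
      \<comment> \<open>Chosen so that \<open>L\<close> terms of size \<open>\<delta> n\<close>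
        amount to at most \<open>\<epsilon>/2 * n\<close>; the \<open>+ 1\<close> covers
        \<open>L = 0\<close>.\<close>
      define \<delta> where "\<delta> = \<epsilon> / (2 * (real L + 1))"
      have \<delta>: "\<delta> > 0" "\<delta> * real L \<le> \<epsilon>/2" using \<epsilon> by (auto simp: \<delta>_def field_simps)
      from elim(2) \<delta> obtain N where N: "\<And>n. n \<ge> N \<Longrightarrow> ?q ((T ^^ n) \<omega>) \<le> \<delta> * real n"
        by (force simp: eventually_sequentially)
      have "a n \<omega> \<le> (c + \<epsilon>) * real n" if n: "n \<ge> N + L + 1" for n
      proof -
        have "a n \<omega> \<le> c * real n + orbit_sum (\<lambda>\<omega>. indicator (?B L) \<omega> * ?q \<omega>) n \<omega>
            + (\<Sum>j\<in>{n - L..<n}. ?q ((T ^^ j) \<omega>))"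
          by (rule subadditive_greedy_bound[where D = D])
            (use D sub a1 q0 n \<omega> sets.sets_into_space[OF Ds] in \<open>auto simp: not_less\<close>)
        also have "(\<Sum>j\<in>{n - L..<n}. ?q ((T ^^ j) \<omega>)) \<le> (\<Sum>j\<in>{n - L..<n}. \<delta> * real n)"
        proof (rule sum_mono)
          fix j assume j: "j \<in> {n - L..<n}"
          then have "?q ((T ^^ j) \<omega>) \<le> \<delta> * real j" using N n by auto
          also have "\<dots> \<le> \<delta> * real n" using j \<delta> by auto
          finally show "?q ((T ^^ j) \<omega>) \<le> \<delta> * real n" .
        qed
        also have "(\<Sum>j\<in>{n - L..<n}. \<delta> * real n) = (\<delta> * real L) * real n" using n by simp
        also have "\<dots> \<le> \<epsilon>/2 * real n" using \<delta> by (intro mult_right_mono) auto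
        finally show ?thesis using L[of n] by (simp add: algebra_simps)
      qed
      then show ?thesis by (auto simp: eventually_sequentially)
    qed
    then show ?case by blast
  qed
qed

text \<open>The hard half of Kingman's theorem.\<close>

lemma subadditive_limsup_le:
  assumes Ds: "D \<in> sets M" and D: "\<And>\<omega>. \<omega> \<in> D \<Longrightarrow> T \<omega> \<in> D"
    and a [measurable]: "\<And>n. a n \<in> borel_measurable M"
    and sub: "\<And>\<omega> n k. \<omega> \<in> D \<Longrightarrow> a (n + k) \<omega> \<le> a n \<omega> + a k ((T ^^ n) \<omega>)"
    and a1: "AE \<omega> in M. \<omega> \<in> D \<longrightarrow> a 1 \<omega> \<le> q \<omega>"
    and q: "integrable M q" and q0: "\<And>\<omega>. 0 \<le> q \<omega>"
    and ex: "AE \<omega> in M. \<omega> \<in> D \<longrightarrow> (\<exists>n\<ge>1. a n \<omega> \<le> c * real n)"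
  shows "AE \<omega> in M. \<omega> \<in> D \<longrightarrow> (\<forall>\<epsilon>>0. \<forall>\<^sub>F n in sequentially. a n \<omega> \<le> (c + \<epsilon>) * real n)"
proof -
  have [measurable]: "D \<in> sets M" "q \<in> borel_measurable M" using Ds q by auto
  \<comment> \<open>The covering argument needs the one-step bound at every point that it visits.
    \<open>D'\<close> is the forward invariant part of \<open>D\<close> where the bound holds along
    the whole orbit.\<close>
  define D' where "D' = {\<omega>\<in>space M. \<omega> \<in> D \<and> (\<forall>n. a 1 ((T ^^ n) \<omega>) \<le> q ((T ^^ n) \<omega>))}"
  have D'_sets: "D' \<in> sets M" unfolding D'_def by measurable
  have D'_T: "T \<omega> \<in> D'" if "\<omega> \<in> D'" for \<omega>
  proof -
    have "a 1 ((T ^^ Suc n) \<omega>) \<le> q ((T ^^ Suc n) \<omega>)" for n using that unfolding D'_def by blast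
    then show ?thesis using that D T_space by (auto simp: D'_def funpow_swap1)
  qed
  have "AE \<omega> in M. \<forall>j. \<omega> \<in> D' \<longrightarrow> (\<forall>\<^sub>F n in sequentially. a n \<omega> \<le> (c + 1 / real (Suc j)) * real n)"
    unfolding AE_all_countable
  proof (intro allI)
    fix j
    show "AE \<omega> in M. \<omega> \<in> D' \<longrightarrow> (\<forall>\<^sub>F n in sequentially. a n \<omega> \<le> (c + 1 / real (Suc j)) * real n)"
    proof (rule subadditive_limsup_le_aux[OF D'_sets D'_T a _ _ q q0])
      show "a (n + k) \<omega> \<le> a n \<omega> + a k ((T ^^ n) \<omega>)" if "\<omega> \<in> D'" for \<omega> n k
        using that sub by (auto simp: D'_def)
      show "a 1 \<omega> \<le> q \<omega>" if "\<omega> \<in> D'" for \<omega>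
        using that by (auto simp: D'_def dest: spec[of _ 0])
      show "AE \<omega> in M. \<omega> \<in> D' \<longrightarrow> (\<exists>n\<ge>1. a n \<omega> \<le> c * real n)"
        using ex by eventually_elim (auto simp: D'_def)
    qed auto
  qed
  moreover have "AE \<omega> in M. \<omega> \<in> D \<longrightarrow> \<omega> \<in> D'"
    using AE_iter[OF a1] AE_space
  proof eventually_elim
    case (elim \<omega>)
    have "(T ^^ n) \<omega> \<in> D" if "\<omega> \<in> D" for n using that D by (induction n) auto
    with elim show ?case by (auto simp: D'_def)
  qed
  ultimately show ?thesis
  proof eventually_elim
    case (elim \<omega>)
    have "\<forall>\<^sub>F n in sequentially. a n \<omega> \<le> (c + \<epsilon>) * real n" if "\<omega> \<in> D" "\<epsilon> > 0" for \<epsilon>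
    proof -
      obtain j where j: "1 / real (Suc j) < \<epsilon>" using \<open>\<epsilon> > 0\<close> by (metis nat_approx_posE)
      from elim that have "\<forall>\<^sub>F n in sequentially. a n \<omega> \<le> (c + 1 / real (Suc j)) * real n" by blast
      then show ?thesis
      proof eventually_elim
        case (elim n)
        have "(c + 1 / real (Suc j)) * real n \<le> (c + \<epsilon>) * real n" using j by (intro mult_right_mono) auto
        with elim show ?case by linarith
      qed
    qed
    then show ?case by blast
  qed
qed

section \<open>Recurrence, and sublinear growth under one-sided increment bounds\<close>

lemma AE_bounded_frequently:
  assumes [measurable]: "k \<in> borel_measurable M"
  shows "AE \<omega> in M. \<exists>K::nat. \<exists>\<^sub>F n in sequentially. k ((T ^^ n) \<omega>) \<le> real K"
  using AE_bounded_half_of_orbit[OF assms]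
proof eventually_elim
  case (elim \<omega>)
  then obtain K where K: "\<And>n. real (card {i. i < n \<and> real K < k ((T ^^ i) \<omega>)}) \<le> real n / 2" by blast
  have "\<exists>n\<ge>N. k ((T ^^ n) \<omega>) \<le> real K" for N
  proof (rule ccontr)
    assume "\<not> ?thesis"
    then have *: "real K < k ((T ^^ n) \<omega>)" if "N \<le> n" for n using that by (meson not_le)
    \<comment> \<open>If \<open>k\<close> stayed above \<open>K\<close> from time \<open>N\<close>
      on, \<open>N + 1\<close> of the first \<open>2 N + 1\<close> times would be bad, which is more
      than half.\<close>
    have "card {N..<2 * N + 1} \<le> card {i. i < 2 * N + 1 \<and> real K < k ((T ^^ i) \<omega>)}"
      by (rule card_mono) (use * in auto)
    with K[of "2 * N + 1"] show False by simp
  qed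
  then show ?case by (auto simp: frequently_sequentially)
qed

text \<open>The differences \<open>G \<circ> T^n - G\<close> form an additive process with one-step
  bound \<open>q\<close>. Recurrence of the sublevel sets of \<open>G\<close> keeps this process
  bounded along a subsequence, hence below any positive slope at some time; the hard half of
  Kingman's theorem turns this into an eventual bound. Integrability of \<open>G\<close> is never
  assumed.\<close>

lemma AE_sublinear_if_increment_le:
  assumes G [measurable]: "G \<in> borel_measurable M" and D: "D \<in> sets M" "\<And>\<omega>. \<omega> \<in> D \<Longrightarrow> T \<omega> \<in> D"
    and G0: "\<And>\<omega>. 0 \<le> G \<omega>" and q: "integrable M q" and q0: "\<And>\<omega>. 0 \<le> q \<omega>"
    and inc: "AE \<omega> in M. \<omega> \<in> D \<longrightarrow> G (T \<omega>) \<le> G \<omega> + q \<omega>"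
  shows "AE \<omega> in M. \<omega> \<in> D \<longrightarrow> (\<forall>\<epsilon>>0. \<forall>\<^sub>F n in sequentially. G ((T ^^ n) \<omega>) \<le> \<epsilon> * real n)"
proof -
  let ?a = "\<lambda>n \<omega>. G ((T ^^ n) \<omega>) - G \<omega>"
  have *: "AE \<omega> in M. \<omega> \<in> D \<longrightarrow> (\<forall>\<epsilon>>0. \<forall>\<^sub>F n in sequentially. ?a n \<omega> \<le> (1 / real (Suc j) + \<epsilon>) * real n)" for j
  proof (rule subadditive_limsup_le[OF D _ _ _ q q0])
    show "AE \<omega> in M. \<omega> \<in> D \<longrightarrow> (\<exists>n\<ge>1. ?a n \<omega> \<le> 1 / real (Suc j) * real n)"
      using AE_bounded_frequently[OF G]
    proof eventually_elim
      case (elim \<omega>)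
      then obtain K where K: "\<exists>\<^sub>F n in sequentially. G ((T ^^ n) \<omega>) \<le> real K" by blast
      then obtain n where n: "n \<ge> Suc (K * Suc j)" "G ((T ^^ n) \<omega>) \<le> real K"
        by (auto simp: frequently_sequentially)
      have "real K * real (Suc j) \<le> real n" using n(1) by (metis Suc_leD of_nat_le_iff of_nat_mult)
      then have "real K \<le> 1 / real (Suc j) * real n" by (simp add: field_simps)
      then show ?case using n G0[of \<omega>] by (intro impI exI[of _ n]) auto
    qed
    show "?a (n + k) \<omega> \<le> ?a n \<omega> + ?a k ((T ^^ n) \<omega>)" for \<omega> n k
      by (simp add: funpow_add add.commute[of n k])
    show "AE \<omega> in M. \<omega> \<in> D \<longrightarrow> ?a 1 \<omega> \<le> q \<omega>"
      using inc by eventually_elim auto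
  qed auto
  have "AE \<omega> in M. \<forall>j. \<omega> \<in> D \<longrightarrow> (\<forall>\<epsilon>>0. \<forall>\<^sub>F n in sequentially. ?a n \<omega> \<le> (1 / real (Suc j) + \<epsilon>) * real n)"
    unfolding AE_all_countable by (intro allI *)
  then show ?thesis
  proof eventually_elim
    case (elim \<omega>)
    have "\<forall>\<^sub>F n in sequentially. G ((T ^^ n) \<omega>) \<le> \<epsilon> * real n" if \<omega>: "\<omega> \<in> D" and "\<epsilon> > 0" for \<epsilon>
    proof -
      obtain j where j: "1 / real (Suc j) < \<epsilon>/3" using \<open>\<epsilon> > 0\<close> by (metis nat_approx_posE divide_pos_pos zero_less_numeral)
      have "\<forall>\<^sub>F n in sequentially. ?a n \<omega> \<le> (1 / real (Suc j) + \<epsilon>/3) * real n"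
        using elim that by auto
      moreover have "\<forall>\<^sub>F n in sequentially. G \<omega> / (\<epsilon>/3) \<le> real n"
        using eventually_ge_at_top[of "nat \<lceil>G \<omega> / (\<epsilon>/3)\<rceil>"] by eventually_elim linarith
      ultimately show ?thesis
      proof eventually_elim
        case (elim n)
        have "(1 / real (Suc j) + \<epsilon>/3) * real n \<le> (\<epsilon>/3 + \<epsilon>/3) * real n" using j by (intro mult_right_mono) auto
        moreover have "G \<omega> \<le> \<epsilon>/3 * real n" using elim(2) \<open>\<epsilon> > 0\<close> by (simp add: field_simps)
        moreover have "\<epsilon> * real n = (\<epsilon>/3 + \<epsilon>/3) * real n + \<epsilon>/3 * real n" by (simp add: algebra_simps)
        ultimately show ?case using elim(1) by linarith
      qed
    qed
    then show ?case by blast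
  qed
qed

text \<open>On the forward invariant set where \<open>G \<circ> T\<^sup>n\<close> grows linearly along a subsequence the additive process
  \<open>G - G \<circ> T\<^sup>n\<close> would drop linearly along the whole sequence, which recurrence of the sublevel sets of \<open>G\<close>
  forbids.\<close>

lemma AE_sublinear_if_decrement_le:
  assumes G [measurable]: "G \<in> borel_measurable M" and D [measurable]: "D \<in> sets M"
    and DT: "\<And>\<omega>. \<omega> \<in> space M \<Longrightarrow> T \<omega> \<in> D \<longleftrightarrow> \<omega> \<in> D"
    and G0: "\<And>\<omega>. 0 \<le> G \<omega>" and q: "integrable M q" and q0: "\<And>\<omega>. 0 \<le> q \<omega>"
    and inc: "AE \<omega> in M. \<omega> \<in> D \<longrightarrow> G \<omega> \<le> G (T \<omega>) + q \<omega>"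
  shows "AE \<omega> in M. \<omega> \<in> D \<longrightarrow> (\<forall>\<epsilon>>0. \<forall>\<^sub>F n in sequentially. G ((T ^^ n) \<omega>) \<le> \<epsilon> * real n)"
proof -
  let ?a = "\<lambda>n \<omega>. G \<omega> - G ((T ^^ n) \<omega>)"
  let ?E = "\<lambda>c. {\<omega>\<in>space M. \<omega> \<in> D \<and> (\<exists>\<^sub>F n in sequentially. c * real n < G ((T ^^ n) \<omega>))}"
  have meas_E: "?E c \<in> sets M" for c
    unfolding frequently_sequentially by measurable
  have shift: "(\<exists>\<^sub>F n in sequentially. c * real n < G ((T ^^ n) (T \<omega>))) \<longleftrightarrow>
      (\<exists>\<^sub>F n in sequentially. c * (real n - 1) < G ((T ^^ n) \<omega>))" for c \<omega>
  proof -
    have "(\<exists>\<^sub>F n in sequentially. c * real n < G ((T ^^ n) (T \<omega>))) \<longleftrightarrow>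
      (\<exists>\<^sub>F n in sequentially. c * (real (Suc n) - 1) < G ((T ^^ (Suc n)) \<omega>))"
      by (simp add: funpow_swap1)
    also have "\<dots> \<longleftrightarrow> (\<exists>\<^sub>F n in sequentially. c * (real n - 1) < G ((T ^^ n) \<omega>))"
      unfolding frequently_def using eventually_sequentially_Suc by (subst eventually_sequentially_Suc) simp
    finally show ?thesis .
  qed
  have null: "AE \<omega> in M. \<omega> \<in> D \<longrightarrow> (\<forall>\<^sub>F n in sequentially. G ((T ^^ n) \<omega>) \<le> \<epsilon> * real n)" if \<epsilon>: "\<epsilon> > 0" for \<epsilon>
  proof -
    \<comment> \<open>Membership says that the limsup of \<open>G ((T ^^ n) \<omega>) / n\<close> is
      at least \<open>\<epsilon>\<close>. Asking for every \<open>c < \<epsilon>\<close> absorbs the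
      index shift caused by \<open>T\<close>, which makes the set forward invariant.\<close>
    define F where "F = {\<omega>\<in>space M. \<omega> \<in> D \<and> (\<forall>c<\<epsilon>. \<exists>\<^sub>F n in sequentially. c * real n < G ((T ^^ n) \<omega>))}"
    have F_eq: "F = {\<omega>\<in>space M. \<omega> \<in> D \<and> (\<forall>j::nat. \<exists>\<^sub>F n in sequentially. (\<epsilon> - 1 / real (Suc j)) * real n < G ((T ^^ n) \<omega>))}"
    proof -
      have "\<exists>\<^sub>F n in sequentially. c * real n < G ((T ^^ n) \<omega>)"
        if "\<forall>j. \<exists>\<^sub>F n in sequentially. (\<epsilon> - 1 / real (Suc j)) * real n < G ((T ^^ n) \<omega>)" and c: "c < \<epsilon>" for c \<omega>
      proof -
        obtain j where j: "1 / real (Suc j) < \<epsilon> - c" using c by (metis nat_approx_posE diff_gt_0_iff_gt)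
        show ?thesis
        proof (rule frequently_elim1[OF spec[OF that(1), of j]])
          fix n assume "(\<epsilon> - 1 / real (Suc j)) * real n < G ((T ^^ n) \<omega>)"
          moreover have "c * real n \<le> (\<epsilon> - 1 / real (Suc j)) * real n" using j by (intro mult_right_mono) auto
          ultimately show "c * real n < G ((T ^^ n) \<omega>)" by linarith
        qed
      qed
      then show ?thesis unfolding F_def by (auto simp del: of_nat_Suc)
    qed
    have F_sets: "F \<in> sets M" unfolding F_eq frequently_sequentially by measurable
    have F_T: "T \<omega> \<in> F" if "\<omega> \<in> F" for \<omega>
    proof -
      have "\<exists>\<^sub>F n in sequentially. c * real n < G ((T ^^ n) (T \<omega>))" if c: "c < \<epsilon>" for c
      proof -
        \<comment> \<open>\<open>d\<close> lies strictly between \<open>c\<close> and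
          \<open>\<epsilon>\<close>; for large \<open>n\<close> the gap \<open>(d - c) n\<close>
          covers the loss of one step in the index.\<close>
        define d where "d = max ((c + \<epsilon>)/2) 0"
        have d: "c < d" "d < \<epsilon>" using c \<epsilon> by (auto simp: d_def max_def)
        have fr: "\<exists>\<^sub>F n in sequentially. d * real n < G ((T ^^ n) \<omega>)" using \<open>\<omega> \<in> F\<close> d by (auto simp: F_def)
        have "\<forall>\<^sub>F n in sequentially. \<bar>c\<bar> / (d - c) \<le> real n"
          using eventually_ge_at_top[of "nat \<lceil>\<bar>c\<bar> / (d - c)\<rceil>"] by eventually_elim linarith
        then have ev: "\<forall>\<^sub>F n in sequentially. c * (real n - 1) \<le> d * real n"
        proof eventually_elim
          case (elim n)
          then have "\<bar>c\<bar> \<le> (d - c) * real n" using d by (simp add: field_simps)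
          then show ?case by (simp add: algebra_simps)
        qed
        show ?thesis unfolding shift
          using frequently_eventually_frequently[OF fr ev] by (rule frequently_elim1) auto
      qed
      then show ?thesis using \<open>\<omega> \<in> F\<close> DT T_space by (auto simp: F_def)
    qed
    have "AE \<omega> in M. \<omega> \<in> F \<longrightarrow> (\<forall>\<eta>>0. \<forall>\<^sub>F n in sequentially. ?a n \<omega> \<le> (- \<epsilon>/2 + \<eta>) * real n)"
    proof (rule subadditive_limsup_le[OF F_sets F_T _ _ _ q q0])
      show "AE \<omega> in M. \<omega> \<in> F \<longrightarrow> (\<exists>n\<ge>1. ?a n \<omega> \<le> - \<epsilon>/2 * real n)"
      proof (rule AE_I2, intro impI)
        fix \<omega> assume "\<omega> \<in> F"
        \<comment> \<open>The slope \<open>3\<epsilon>/4\<close> of \<open>G \<circ> T^n\<close>,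
          less \<open>\<epsilon>/4\<close> for the fixed term \<open>G \<omega>\<close>, leaves the
          required drop \<open>\<epsilon>/2\<close>.\<close>
        then have fr: "\<exists>\<^sub>F n in sequentially. (3 * \<epsilon> / 4) * real n < G ((T ^^ n) \<omega>)" using \<epsilon> by (simp add: F_def del: times_divide_eq_left)
        have ev: "\<forall>\<^sub>F n in sequentially. n \<ge> 1 \<and> G \<omega> / (\<epsilon>/4) \<le> real n"
          using eventually_ge_at_top[of "nat \<lceil>G \<omega> / (\<epsilon>/4)\<rceil>"] eventually_ge_at_top[of 1] by eventually_elim linarith
        have "\<exists>\<^sub>F n in sequentially. n \<ge> 1 \<and> ?a n \<omega> \<le> - \<epsilon>/2 * real n"
          using frequently_eventually_frequently[OF fr ev]
          by (rule frequently_elim1) (use \<epsilon> in \<open>auto simp: field_simps\<close>)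
        then show "\<exists>n\<ge>1. ?a n \<omega> \<le> - \<epsilon>/2 * real n" using frequently_ex by blast
      qed
      show "?a (n + k) \<omega> \<le> ?a n \<omega> + ?a k ((T ^^ n) \<omega>)" for \<omega> n k
        by (simp add: funpow_add add.commute[of n k])
      show "AE \<omega> in M. \<omega> \<in> F \<longrightarrow> ?a 1 \<omega> \<le> q \<omega>"
        using inc by eventually_elim (auto simp: F_def)
    qed auto
    then have "AE \<omega> in M. \<omega> \<notin> F"
      using AE_bounded_frequently[OF G]
    proof eventually_elim
      case (elim \<omega>)
      have False if "\<omega> \<in> F"
      proof -
        obtain K where K: "\<exists>\<^sub>F n in sequentially. G ((T ^^ n) \<omega>) \<le> real K" using elim(2) by blast
        \<comment> \<open>The process drops at least at slope \<open>\<epsilon>/4\<close>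
          eventually, so \<open>G\<close> tends to infinity along the orbit. This contradicts the
          bound \<open>K\<close> attained infinitely often.\<close>
        have "\<forall>\<^sub>F n in sequentially. ?a n \<omega> \<le> (- \<epsilon>/2 + \<epsilon>/4) * real n"
          using elim(1) that \<epsilon> by (auto dest!: spec[of _ "\<epsilon>/4"])
        moreover have "\<forall>\<^sub>F n in sequentially. (real K + 1) / (\<epsilon>/4) \<le> real n"
          using eventually_ge_at_top[of "nat \<lceil>(real K + 1) / (\<epsilon>/4)\<rceil>"] by eventually_elim linarith
        ultimately have "\<forall>\<^sub>F n in sequentially. ?a n \<omega> \<le> (- \<epsilon>/2 + \<epsilon>/4) * real n \<and> (real K + 1) / (\<epsilon>/4) \<le> real n"
          by eventually_elim auto
        from frequently_eventually_frequently[OF K this]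
        obtain n where n: "G ((T ^^ n) \<omega>) \<le> real K" "?a n \<omega> \<le> (- \<epsilon>/2 + \<epsilon>/4) * real n" "(real K + 1) / (\<epsilon>/4) \<le> real n"
          using frequently_ex by blast
        from n(3) \<epsilon> have "real K + 1 \<le> \<epsilon>/4 * real n" by (simp add: field_simps)
        with n G0[of \<omega>] show False by (simp add: algebra_simps)
      qed
      then show ?case by blast
    qed
    then show ?thesis using AE_space
    proof eventually_elim
      case (elim \<omega>)
      have "\<forall>\<^sub>F n in sequentially. G ((T ^^ n) \<omega>) \<le> \<epsilon> * real n" if \<omega>: "\<omega> \<in> D"
      proof -
        obtain c where c: "c < \<epsilon>" "\<not> (\<exists>\<^sub>F n in sequentially. c * real n < G ((T ^^ n) \<omega>))"
          using elim \<omega> by (auto simp: F_def)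
        then have "\<forall>\<^sub>F n in sequentially. G ((T ^^ n) \<omega>) \<le> c * real n" by (simp add: not_frequently not_less)
        then show ?thesis
        proof eventually_elim
          case (elim n)
          have "c * real n \<le> \<epsilon> * real n" using c by (intro mult_right_mono) auto
          with elim show ?case by linarith
        qed
      qed
      then show ?case by blast
    qed
  qed
  have "AE \<omega> in M. \<forall>j. \<omega> \<in> D \<longrightarrow> (\<forall>\<^sub>F n in sequentially. G ((T ^^ n) \<omega>) \<le> 1 / real (Suc j) * real n)"
    unfolding AE_all_countable by (intro allI null) simp
  then show ?thesis
  proof eventually_elim
    case (elim \<omega>)
    have "\<forall>\<^sub>F n in sequentially. G ((T ^^ n) \<omega>) \<le> \<epsilon> * real n" if "\<omega> \<in> D" "\<epsilon> > 0" for \<epsilon>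
    proof -
      obtain j where j: "1 / real (Suc j) < \<epsilon>" using \<open>\<epsilon> > 0\<close> by (metis nat_approx_posE)
      from elim that have "\<forall>\<^sub>F n in sequentially. G ((T ^^ n) \<omega>) \<le> 1 / real (Suc j) * real n" by blast
      then show ?thesis
      proof eventually_elim
        case (elim n)
        have "1 / real (Suc j) * real n \<le> \<epsilon> * real n" using j by (intro mult_right_mono) auto
        with elim show ?case by linarith
      qed
    qed
    then show ?case by blast
  qed
qed

end

section \<open>Exponential growth rates\<close>

text \<open>This says that the limsup of \<open>ln (F t) / t\<close> is at most \<open>l\<close>,
  and \<open>rate_ge\<close> bounds the liminf from below. The exponential form makes sense where
  \<open>F\<close> vanishes and for \<open>l = - \<infinity>\<close>, in which case
  \<open>rate_ge\<close> is vacuous.\<close>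

definition rate_le :: "(real \<Rightarrow> real) \<Rightarrow> ereal \<Rightarrow> bool"
  where "rate_le F l \<longleftrightarrow> (\<forall>c::real. l < ereal c \<longrightarrow> (\<forall>\<^sub>F t in at_top. F t \<le> exp (c * t)))"

definition rate_ge :: "(real \<Rightarrow> real) \<Rightarrow> ereal \<Rightarrow> bool"
  where "rate_ge F l \<longleftrightarrow> (\<forall>c::real. ereal c < l \<longrightarrow> (\<forall>\<^sub>F t in at_top. exp (c * t) \<le> F t))"

lemma eventually_const_le_exp:
  fixes K d :: real
  assumes "0 < d"
  shows "\<forall>\<^sub>F t in at_top. K \<le> exp (d * t)"
proof -
  have "\<forall>\<^sub>F t in at_top. K / d \<le> t" by (rule eventually_ge_at_top)
  then show ?thesis
  proof eventually_elim
    case (elim t)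
    then have "K \<le> d * t" using assms by (simp add: field_simps)
    also have "\<dots> \<le> exp (d * t)" using exp_ge_add_one_self[of "d * t"] by linarith
    finally show ?case .
  qed
qed

lemma eventually_at_top_shift:
  fixes s :: real
  assumes "\<forall>\<^sub>F t in at_top. P t"
  shows "\<forall>\<^sub>F t in at_top. P (t + s)"
proof -
  from assms obtain N where N: "\<And>t. t \<ge> N \<Longrightarrow> P t" by (auto simp: eventually_at_top_linorder)
  show ?thesis unfolding eventually_at_top_linorder
    by (rule exI[of _ "N - s"]) (auto intro!: N)
qed

text \<open>The factor \<open>K\<close> and the time shift \<open>s\<close> disappear in the gap
  between \<open>d\<close> and \<open>c\<close>. With \<open>s \<noteq> 0\<close> this moves a rate
  along an orbit; with \<open>s = 0\<close> it compares two functions at the same point.\<close>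

lemma rate_le_shift:
  assumes F: "rate_le F l" and G: "\<forall>\<^sub>F t in at_top. G (s + t) \<le> K * F t"
    and F0: "\<forall>\<^sub>F t in at_top. 0 \<le> F t"
  shows "rate_le G l"
  unfolding rate_le_def
proof (intro allI impI)
  fix c :: real assume "l < ereal c"
  then obtain d where d: "l < ereal d" "d < c"
    by (metis ereal_dense2 ereal_less_eq(3) less_ereal.simps(1) not_le)
  have "\<forall>\<^sub>F t in at_top. F t \<le> exp (d * t)" using F d by (auto simp: rate_le_def)
  moreover have "\<forall>\<^sub>F t in at_top. max K 0 * exp (- c * s) \<le> exp ((c - d) * t)"
    by (rule eventually_const_le_exp) (use d in auto)
  ultimately have "\<forall>\<^sub>F t in at_top. G (s + t) \<le> exp (c * (s + t))"
    using G F0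
  proof eventually_elim
    case (elim t)
    have "G (s + t) \<le> K * F t" by (rule elim)
    also have "\<dots> \<le> max K 0 * F t" using elim by (intro mult_right_mono) auto
    also have "\<dots> \<le> max K 0 * exp (d * t)" using elim by (intro mult_left_mono) auto
    also have "\<dots> = (max K 0 * exp (- c * s)) * exp (d * t + c * s)" by (simp add: exp_add exp_minus)
    also have "\<dots> \<le> exp ((c - d) * t) * exp (d * t + c * s)" using elim by (intro mult_right_mono) auto
    also have "\<dots> = exp (c * (s + t))" by (simp add: exp_add[symmetric] algebra_simps)
    finally show ?case .
  qed
  from eventually_at_top_shift[OF this, of "- s"]
  show "\<forall>\<^sub>F t in at_top. G t \<le> exp (c * t)" by simp
qed

lemma rate_ge_shift:
  assumes F: "rate_ge F l" and G: "\<forall>\<^sub>F t in at_top. F t \<le> K * G (s + t)"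
    and G0: "\<forall>\<^sub>F t in at_top. 0 \<le> G t"
  shows "rate_ge G l"
  unfolding rate_ge_def
proof (intro allI impI)
  fix c :: real assume "ereal c < l"
  then obtain d where d: "ereal d < l" "c < d"
    by (metis ereal_dense2 less_ereal.simps(1))
  have "\<forall>\<^sub>F t in at_top. 0 \<le> G (s + t)" using eventually_at_top_shift[OF G0, of s] by (simp add: add.commute)
  moreover have "\<forall>\<^sub>F t in at_top. exp (d * t) \<le> F t" using F d by (auto simp: rate_ge_def)
  moreover have "\<forall>\<^sub>F t in at_top. max K 1 * exp (c * s) \<le> exp ((d - c) * t)"
    by (rule eventually_const_le_exp) (use d in auto)
  ultimately have "\<forall>\<^sub>F t in at_top. exp (c * (s + t)) \<le> G (s + t)"
    using G
  proof eventually_elim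
    case (elim t)
    have "max K 1 * exp (c * (s + t)) = (max K 1 * exp (c * s)) * exp (c * t)"
      by (simp add: exp_add algebra_simps)
    also have "\<dots> \<le> exp ((d - c) * t) * exp (c * t)" using elim by (intro mult_right_mono) auto
    also have "\<dots> = exp (d * t)" by (simp add: exp_add[symmetric] algebra_simps)
    also have "\<dots> \<le> K * G (s + t)" using elim by linarith
    also have "\<dots> \<le> max K 1 * G (s + t)" using elim by (intro mult_right_mono) auto
    finally show ?case by (rule mult_left_le_imp_le) auto
  qed
  from eventually_at_top_shift[OF this, of "- s"]
  show "\<forall>\<^sub>F t in at_top. exp (c * t) \<le> G t" by simp
qed

lemma rate_limit:
  assumes le: "rate_le F l" and ge: "rate_ge F l"
  shows "((\<lambda>t. ereal (1 / t) * eln (F t)) \<longlongrightarrow> l) at_top"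
proof (rule order_tendstoI)
  fix a assume "a < l"
  then obtain c where c: "a < ereal c" "ereal c < l" by (metis ereal_dense2)
  have "\<forall>\<^sub>F t in at_top. exp (c * t) \<le> F t" using ge c by (auto simp: rate_ge_def)
  then show "\<forall>\<^sub>F t in at_top. a < ereal (1 / t) * eln (F t)"
    using eventually_gt_at_top[of 0]
  proof eventually_elim
    case (elim t)
    then have F: "F t > 0" using exp_gt_zero less_le_trans by blast
    have "c * t \<le> ln (F t)" using elim F by (simp add: ln_ge_iff)
    then have "c \<le> 1 / t * ln (F t)" using elim by (simp add: field_simps)
    then have "ereal c \<le> ereal (1 / t) * eln (F t)" using F by (simp add: eln_def)
    with c show ?case by (meson less_le_trans)
  qed
next
  fix a assume "l < a"
  then obtain c where c: "ereal c < a" "l < ereal c" by (metis ereal_dense2)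
  have "\<forall>\<^sub>F t in at_top. F t \<le> exp (c * t)" using le c by (auto simp: rate_le_def)
  then show "\<forall>\<^sub>F t in at_top. ereal (1 / t) * eln (F t) < a"
    using eventually_gt_at_top[of 0]
  proof eventually_elim
    case (elim t)
    have "ereal (1 / t) * eln (F t) \<le> ereal c"
    proof (cases "F t \<le> 0")
      case True
      then show ?thesis using elim by (simp add: eln_def)
    next
      case False
      then have "ln (F t) \<le> ln (exp (c * t))" using elim by (subst ln_le_cancel_iff) auto
      then have "1 / t * ln (F t) \<le> c" using elim by (simp add: field_simps)
      then show ?thesis using False by (simp add: eln_def)
    qed
    with c show ?case by (meson le_less_trans)
  qed
qed

lemma rate_le_divide:
  assumes F: "rate_le F l" and G: "rate_ge G (ereal m)" and F0: "\<forall>\<^sub>F t in at_top. 0 \<le> F t"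
  shows "rate_le (\<lambda>t. F t / G t) (l - ereal m)"
  unfolding rate_le_def
proof (intro allI impI)
  fix c :: real assume "l - ereal m < ereal c"
  then have "l < ereal (c + m)" by (cases l) auto
  then obtain d where d: "l < ereal d" "d < c + m"
    by (metis ereal_dense2 less_ereal.simps(1))
  have "\<forall>\<^sub>F t in at_top. F t \<le> exp (d * t)" "\<forall>\<^sub>F t in at_top. exp ((d - c) * t) \<le> G t"
    using F G d by (auto simp: rate_le_def rate_ge_def)
  then show "\<forall>\<^sub>F t in at_top. F t / G t \<le> exp (c * t)"
    using F0
  proof eventually_elim
    case (elim t)
    have G: "0 < G t" using elim(2) exp_gt_zero less_le_trans by blast
    have "F t \<le> exp (c * t) * exp ((d - c) * t)" using elim by (simp add: exp_add[symmetric] algebra_simps)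
    also have "\<dots> \<le> exp (c * t) * G t" using elim by (intro mult_left_mono) auto
    finally show ?case using G by (simp add: field_simps)
  qed
qed

lemma rate_ge_divide:
  assumes F: "rate_ge F l" and G: "rate_le G (ereal m)" and G0: "\<forall>\<^sub>F t in at_top. 0 < G t"
  shows "rate_ge (\<lambda>t. F t / G t) (l - ereal m)"
  unfolding rate_ge_def
proof (intro allI impI)
  fix c :: real assume "ereal c < l - ereal m"
  then have "ereal (c + m) < l" by (cases l) auto
  then obtain d where d: "ereal d < l" "c + m < d"
    by (metis ereal_dense2 less_ereal.simps(1))
  have "\<forall>\<^sub>F t in at_top. exp (d * t) \<le> F t" "\<forall>\<^sub>F t in at_top. G t \<le> exp ((d - c) * t)"
    using F G d by (auto simp: rate_le_def rate_ge_def)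
  then show "\<forall>\<^sub>F t in at_top. exp (c * t) \<le> F t / G t"
    using G0
  proof eventually_elim
    case (elim t)
    have "exp (c * t) * G t \<le> exp (c * t) * exp ((d - c) * t)" using elim by (intro mult_left_mono) auto
    also have "\<dots> = exp (d * t)" by (simp add: exp_add[symmetric] algebra_simps)
    also have "\<dots> \<le> F t" by (rule elim)
    finally show ?case using elim by (simp add: field_simps)
  qed
qed

section \<open>The ergodic flow\<close>

context mp_transformation begin

text \<open>Truncating \<open>r\<close> at \<open>- m\<close> and adding \<open>m\<close> makes the
  averages nonnegative, so Fatou's lemma applies, and by invariance of the measure all these
  averages have the same integral. Dominated convergence then removes the truncation. Applied to
  \<open>r\<close> and to \<open>- r\<close>, this pins an almost surely constant growth rate to the
  integral.\<close>

lemma ergodic_average_le_integral: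
  assumes r: "integrable M r"
    and c: "AE \<omega> in M. \<forall>\<^sub>F n in sequentially. c * real n \<le> orbit_sum r n \<omega>"
  shows "c \<le> (\<integral>\<omega>. r \<omega> \<partial>M)"
proof -
  have [measurable]: "r \<in> borel_measurable M" using r by auto
  have bound: "c \<le> (\<integral>\<omega>. max (r \<omega>) (- real m) \<partial>M)" for m :: nat
  proof -
    let ?s = "\<lambda>\<omega>. max (r \<omega>) (- real m)"
    have s: "integrable M ?s" using r by (intro integrable_max) auto
    have s0: "0 \<le> ?s \<omega> + real m" for \<omega> by auto
    have s1: "integrable M (\<lambda>\<omega>. ?s \<omega> + real m)" using s by auto
    have int_s: "0 \<le> (\<integral>\<omega>. ?s \<omega> \<partial>M) + real m"
    proof -
      have "0 \<le> (\<integral>\<omega>. ?s \<omega> + real m \<partial>M)" using s0 by (intro integral_nonneg_AE) auto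
      also have "\<dots> = (\<integral>\<omega>. ?s \<omega> \<partial>M) + real m" using s by (simp add: prob_space)
      finally show ?thesis .
    qed
    let ?X = "\<lambda>n \<omega>. ennreal (orbit_sum (\<lambda>\<omega>. ?s \<omega> + real m) n \<omega> / real n)"
    have int_X: "(\<integral>\<^sup>+\<omega>. ?X n \<omega> \<partial>M) = ennreal ((\<integral>\<omega>. ?s \<omega> \<partial>M) + real m)" if "n > 0" for n
    proof -
      have i: "integrable M (\<lambda>\<omega>. orbit_sum (\<lambda>\<omega>. ?s \<omega> + real m) n \<omega> / real n)"
        unfolding orbit_sum_def
        by (intro integrable_divide Bochner_Integration.integrable_sum integrable_comp_iter[OF s1])
      have "(\<integral>\<^sup>+\<omega>. ?X n \<omega> \<partial>M) = ennreal (\<integral>\<omega>. orbit_sum (\<lambda>\<omega>. ?s \<omega> + real m) n \<omega> / real n \<partial>M)"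
        by (rule nn_integral_eq_integral[OF i]) (auto intro!: AE_I2 divide_nonneg_nonneg orbit_sum_nonneg s0)
      also have "(\<integral>\<omega>. orbit_sum (\<lambda>\<omega>. ?s \<omega> + real m) n \<omega> / real n \<partial>M)
          = (\<Sum>i<n. \<integral>\<omega>. ?s ((T ^^ i) \<omega>) + real m \<partial>M) / real n"
        unfolding orbit_sum_def
        by (simp only: integral_divide_zero, subst Bochner_Integration.integral_sum)
           (use integrable_comp_iter[OF s1] in auto)
      also have "\<dots> = (\<integral>\<omega>. ?s \<omega> + real m \<partial>M)"
        using integral_comp_iter[of "\<lambda>\<omega>. ?s \<omega> + real m"] that by simp
      also have "\<dots> = (\<integral>\<omega>. ?s \<omega> \<partial>M) + real m" using s by (simp add: prob_space)
      finally show ?thesis .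
    qed
    have "ennreal (c + real m) = (\<integral>\<^sup>+\<omega>. ennreal (c + real m) \<partial>M)"
      by (simp add: emeasure_space_1)
    also have "\<dots> \<le> (\<integral>\<^sup>+\<omega>. liminf (\<lambda>n. ?X n \<omega>) \<partial>M)"
    proof (rule nn_integral_mono_AE)
      show "AE \<omega> in M. ennreal (c + real m) \<le> liminf (\<lambda>n. ?X n \<omega>)"
        using c
      proof eventually_elim
        case (elim \<omega>)
        have "\<forall>\<^sub>F n in sequentially. ennreal (c + real m) \<le> ?X n \<omega>"
          using elim eventually_gt_at_top[of 0]
        proof eventually_elim
          case (elim n)
          have "orbit_sum r n \<omega> + real m * real n \<le> orbit_sum (\<lambda>\<omega>. ?s \<omega> + real m) n \<omega>"
            unfolding orbit_sum_def by (auto simp: sum.distrib intro!: sum_mono)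
          with elim have "(c + real m) * real n \<le> orbit_sum (\<lambda>\<omega>. ?s \<omega> + real m) n \<omega>"
            by (simp add: algebra_simps)
          then show ?case using elim by (intro ennreal_leI) (simp add: field_simps)
        qed
        then show ?case by (rule Liminf_bounded)
      qed
    qed
    also have "\<dots> \<le> liminf (\<lambda>n. \<integral>\<^sup>+\<omega>. ?X n \<omega> \<partial>M)"
      by (rule nn_integral_liminf) measurable
    also have "\<dots> = liminf (\<lambda>n::nat. ennreal ((\<integral>\<omega>. ?s \<omega> \<partial>M) + real m))"
      by (rule Liminf_eq, rule eventually_mono[OF eventually_gt_at_top[of 0]], rule int_X)
    also have "\<dots> = ennreal ((\<integral>\<omega>. ?s \<omega> \<partial>M) + real m)" by (simp add: Liminf_const)
    finally have "c + real m \<le> (\<integral>\<omega>. ?s \<omega> \<partial>M) + real m"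
      using int_s by (subst (asm) ennreal_le_iff) auto
    then show ?thesis by simp
  qed
  have "(\<lambda>m::nat. \<integral>\<omega>. max (r \<omega>) (- real m) \<partial>M) \<longlonglongrightarrow> (\<integral>\<omega>. r \<omega> \<partial>M)"
  proof (rule integral_dominated_convergence[where w = "\<lambda>\<omega>. \<bar>r \<omega>\<bar>"])
    show "AE \<omega> in M. (\<lambda>m. max (r \<omega>) (- real m)) \<longlonglongrightarrow> r \<omega>"
    proof (rule AE_I2)
      fix \<omega>
      obtain N :: nat where "\<bar>r \<omega>\<bar> \<le> real N" using real_arch_simple by blast
      then have "\<forall>\<^sub>F m in sequentially. max (r \<omega>) (- real m) = r \<omega>"
        by (auto simp: eventually_sequentially intro!: exI[of _ N])
      then show "(\<lambda>m. max (r \<omega>) (- real m)) \<longlonglongrightarrow> r \<omega>" by (rule tendsto_eventually)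
    qed
  qed (use r in auto)
  then show ?thesis by (rule LIMSEQ_le_const) (use bound in auto)
qed

end

context ergodic_flow begin

lemma flow_measurable_at [measurable]: "\<theta> t \<in> M \<rightarrow>\<^sub>M M"
proof -
  have "(\<lambda>\<omega>. (\<lambda>(t, \<omega>). \<theta> t \<omega>) (t, \<omega>)) \<in> M \<rightarrow>\<^sub>M M"
    by (rule measurable_compose[OF _ flow_measurable]) measurable
  then show ?thesis by simp
qed

lemma flow_space: "\<omega> \<in> space M \<Longrightarrow> \<theta> t \<omega> \<in> space M"
  using measurable_space[OF flow_measurable_at] by blast

lemma flow_flow: "\<omega> \<in> space M \<Longrightarrow> \<theta> s (\<theta> t \<omega>) = \<theta> (t + s) \<omega>"
  by (simp add: flow_add)

lemma mp_flow: "mp_transformation M (\<theta> t)"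
  by unfold_locales (auto simp: flow_preserving)

lemma flow_iter: "\<omega> \<in> space M \<Longrightarrow> (\<theta> t ^^ n) \<omega> = \<theta> (real n * t) \<omega>"
proof (induction n)
  case (Suc n)
  then show ?case by (simp add: flow_flow algebra_simps)
qed (simp add: flow_zero)

lemma AE_flow: "AE \<omega> in M. Q \<omega> \<Longrightarrow> AE \<omega> in M. Q (\<theta> t \<omega>)"
  by (rule AE_distrD[OF flow_measurable_at]) (unfold flow_preserving)

lemma invariant_setD: "invariant_set M \<theta> D \<Longrightarrow> \<omega> \<in> D \<Longrightarrow> \<theta> t \<omega> \<in> D"
  unfolding invariant_set_def by blast

lemma invariant_set_space: "invariant_set M \<theta> D \<Longrightarrow> \<omega> \<in> D \<Longrightarrow> \<omega> \<in> space M"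
  unfolding invariant_set_def using sets.sets_into_space by blast

lemma invariant_set_iff:
  assumes "invariant_set M \<theta> D" "\<omega> \<in> space M"
  shows "\<theta> t \<omega> \<in> D \<longleftrightarrow> \<omega> \<in> D"
proof
  assume "\<theta> t \<omega> \<in> D"
  then have "\<theta> (- t) (\<theta> t \<omega>) \<in> D" by (rule invariant_setD[OF assms(1)])
  then show "\<omega> \<in> D" using assms by (simp add: flow_flow flow_zero)
qed (rule invariant_setD[OF assms(1)])

lemma invariant_setI:
  assumes A: "A \<in> sets M" and inv: "\<And>\<omega> t. \<omega> \<in> A \<Longrightarrow> \<theta> t \<omega> \<in> A"
  shows "invariant_set M \<theta> A"
proof -
  have "\<omega> \<in> \<theta> t ` A" if "\<omega> \<in> A" for \<omega> t
  proof
    have "\<omega> \<in> space M" using that sets.sets_into_space[OF A] by blast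
    then show "\<omega> = \<theta> t (\<theta> (- t) \<omega>)" by (simp add: flow_flow flow_zero)
    show "\<theta> (- t) \<omega> \<in> A" using inv that by blast
  qed
  with A inv show ?thesis unfolding invariant_set_def by blast
qed

text \<open>Saturating a set of full measure under the flow costs no measurability because \<open>M\<close> is complete.\<close>

lemma AE_invariant_set:
  assumes "AE \<omega> in M. Q \<omega>"
  obtains D where "invariant_set M \<theta> D" "prob D = 1" "\<And>\<omega> r. \<omega> \<in> D \<Longrightarrow> \<exists>t\<ge>r. Q (\<theta> t \<omega>)"
    "\<And>\<omega> r. \<omega> \<in> D \<Longrightarrow> \<exists>t\<le>r. Q (\<theta> t \<omega>)"
proof -
  \<comment> \<open>Only countably many times can be required almost surely at once, whence the
    integer translates. The free offset \<open>t\<close> makes the set invariant under all real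
    times, and the integers of both signs supply the early and late good times.\<close>
  define D where "D = {\<omega>\<in>space M. \<exists>t. \<forall>n::int. Q (\<theta> (t + real_of_int n) \<omega>)}"
  have "AE \<omega> in M. \<forall>n::int. Q (\<theta> (real_of_int n) \<omega>)"
    using AE_flow[OF assms] by (simp add: AE_all_countable)
  then have AE_D: "AE \<omega> in M. \<omega> \<in> D"
    using AE_space by eventually_elim (auto simp: D_def intro!: exI[of _ 0])
  then obtain N where N: "{\<omega>\<in>space M. \<omega> \<notin> D} \<subseteq> N" "N \<in> null_sets M"
    by (auto simp: eventually_ae_filter)
  then have "{\<omega>\<in>space M. \<omega> \<notin> D} \<in> sets M" using complete by blast
  then have "space M - {\<omega>\<in>space M. \<omega> \<notin> D} \<in> sets M" by blast
  also have "space M - {\<omega>\<in>space M. \<omega> \<notin> D} = D" by (auto simp: D_def)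
  finally have D_sets: "D \<in> sets M" .
  have "invariant_set M \<theta> D"
  proof (rule invariant_setI[OF D_sets])
    fix \<omega> s assume \<omega>: "\<omega> \<in> D"
    then obtain t where "\<forall>n::int. Q (\<theta> (t + real_of_int n) \<omega>)" by (auto simp: D_def)
    then have "\<forall>n::int. Q (\<theta> (t - s + real_of_int n) (\<theta> s \<omega>))"
      using \<omega> by (simp add: D_def flow_flow algebra_simps)
    then show "\<theta> s \<omega> \<in> D" using \<omega> flow_space by (auto simp: D_def)
  qed
  moreover have "prob D = 1" using AE_D D_sets by (simp add: prob_eq_1)
  moreover have "\<exists>t\<ge>r. Q (\<theta> t \<omega>)" "\<exists>t\<le>r. Q (\<theta> t \<omega>)" if \<omega>: "\<omega> \<in> D" for \<omega> r
  proof -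
    from \<omega> obtain t where t: "\<And>n::int. Q (\<theta> (t + real_of_int n) \<omega>)" by (auto simp: D_def)
    show "\<exists>t\<ge>r. Q (\<theta> t \<omega>)" using t[of "\<lceil>r - t\<rceil>"] by (intro exI[of _ "t + \<lceil>r - t\<rceil>"]) linarith
    show "\<exists>t\<le>r. Q (\<theta> t \<omega>)" using t[of "\<lfloor>r - t\<rfloor>"] by (intro exI[of _ "t + \<lfloor>r - t\<rfloor>"]) linarith
  qed
  ultimately show ?thesis using that by blast
qed

text \<open>The preimages of \<open>A\<close> under the times \<open>n\<close> decrease and all have
  the probability of \<open>A\<close>, hence so does their intersection. The intersection is fully
  invariant, and ergodicity applies to it.\<close>

lemma backward_invariant_0_1:
  assumes A [measurable]: "A \<in> sets M"
    and inv: "\<And>\<omega> s. \<omega> \<in> space M \<Longrightarrow> 0 \<le> s \<Longrightarrow> \<theta> s \<omega> \<in> A \<Longrightarrow> \<omega> \<in> A"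
  shows "prob A = 0 \<or> prob A = 1"
proof -
  let ?A = "\<lambda>n::nat. {\<omega>\<in>space M. \<theta> (real n) \<omega> \<in> A}"
  define B where "B = (\<Inter>n. ?A n)"
  have B_sets: "B \<in> sets M" unfolding B_def by measurable
  have down: "\<theta> s \<omega> \<in> A" if "\<omega> \<in> space M" "s \<le> t" "\<theta> t \<omega> \<in> A" for \<omega> s t
    using inv[of "\<theta> s \<omega>" "t - s"] that by (simp add: flow_flow flow_space)
  have "prob (?A n) = prob A" for n
  proof -
    have "measure (distr M M (\<theta> (real n))) A = prob (\<theta> (real n) -` A \<inter> space M)"
      by (rule measure_distr) auto
    then show ?thesis by (simp add: flow_preserving vimage_def Int_def conj_commute)
  qed
  moreover have "(\<lambda>n. prob (?A n)) \<longlonglongrightarrow> prob B" unfolding B_def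
  proof (rule finite_Lim_measure_decseq)
    show "decseq ?A"
    proof (rule decseq_SucI, safe)
      fix n \<omega> assume "\<omega> \<in> space M" "\<theta> (real (Suc n)) \<omega> \<in> A"
      then show "\<theta> (real n) \<omega> \<in> A" by (intro down[of \<omega> "real n" "real (Suc n)"]) auto
    qed
  qed auto
  ultimately have "prob B = prob A" using LIMSEQ_unique by (simp add: LIMSEQ_const_iff)
  moreover have "invariant_set M \<theta> B"
  proof (rule invariant_setI[OF B_sets])
    fix \<omega> t assume \<omega>: "\<omega> \<in> B"
    then have sp: "\<omega> \<in> space M" by (auto simp: B_def)
    have "\<theta> (real n) (\<theta> t \<omega>) \<in> A" for n
    proof -
      obtain k :: nat where "t + real n \<le> real k" using real_arch_simple by blast
      moreover have "\<theta> (real k) \<omega> \<in> A" using \<omega> by (auto simp: B_def)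
      ultimately show ?thesis using down[OF sp] sp by (simp add: flow_flow)
    qed
    then show "\<theta> t \<omega> \<in> B" using sp flow_space by (auto simp: B_def)
  qed
  ultimately show ?thesis using flow_ergodic by metis
qed

end

section \<open>Passing between integer and real times\<close>

lemma eventually_le_exp_interpolate:
  fixes F :: "real \<Rightarrow> real" and \<phi> :: "nat \<Rightarrow> real"
  assumes F: "\<And>n t. real n \<le> t \<Longrightarrow> t \<le> real n + 1 \<Longrightarrow> F t \<le> exp (\<phi> n) * F (real n)"
    and \<phi>: "\<And>\<delta>. 0 < \<delta> \<Longrightarrow> \<forall>\<^sub>F n in sequentially. \<phi> n \<le> \<delta> * real n"
    and ev: "\<forall>\<^sub>F n in sequentially. F (real n) \<le> exp (c * real n)" and "c < c'"
  shows "\<forall>\<^sub>F t in at_top. F t \<le> exp (c' * t)"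
proof -
  \<comment> \<open>One half of the gap \<open>c' - c\<close> pays for \<open>\<phi>\<close>, the
    other for the error of at most \<open>\<bar>c\<bar>\<close> made in replacing \<open>c n\<close>
    by \<open>c t\<close>.\<close>
  define \<delta> where "\<delta> = (c' - c) / 2"
  have \<delta>: "\<delta> > 0" using \<open>c < c'\<close> by (simp add: \<delta>_def)
  have fl: "filterlim (\<lambda>t::real. nat \<lfloor>t\<rfloor>) at_top at_top"
    by (rule filterlim_compose[OF filterlim_nat_sequentially filterlim_floor_sequentially])
  have "\<forall>\<^sub>F n in sequentially. F (real n) \<le> exp (c * real n) \<and> \<phi> n \<le> \<delta> * real n"
    using ev \<phi>[OF \<delta>] by eventually_elim auto
  then have "\<forall>\<^sub>F t::real in at_top. F (real (nat \<lfloor>t\<rfloor>)) \<le> exp (c * real (nat \<lfloor>t\<rfloor>)) \<and> \<phi> (nat \<lfloor>t\<rfloor>) \<le> \<delta> * real (nat \<lfloor>t\<rfloor>)"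
    using fl unfolding filterlim_iff by blast
  then show ?thesis using eventually_ge_at_top[of "\<bar>c\<bar> / \<delta>"] eventually_ge_at_top[of 0]
  proof eventually_elim
    case (elim t)
    define n where "n = nat \<lfloor>t\<rfloor>"
    have n: "real n \<le> t" "t \<le> real n + 1" using elim unfolding n_def by linarith+
    have "F t \<le> exp (\<phi> n) * F (real n)" by (rule F[OF n])
    also have "\<dots> \<le> exp (\<delta> * real n) * exp (c * real n)"
    proof (cases "F (real n) \<ge> 0")
      case True
      then show ?thesis using elim by (intro mult_mono) (auto simp: n_def)
    next
      case False
      then have "exp (\<phi> n) * F (real n) \<le> 0" by (simp add: mult_le_0_iff)
      then show ?thesis by (meson exp_ge_zero mult_nonneg_nonneg order_trans)
    qed
    also have "\<dots> = exp (\<delta> * real n + c * real n)" by (simp add: exp_add)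
    also have "\<dots> \<le> exp (c' * t)"
    proof -
      have "\<delta> * real n \<le> \<delta> * t" using n \<delta> by simp
      moreover have "\<bar>c * (real n - t)\<bar> \<le> \<bar>c\<bar> * 1" unfolding abs_mult using n by (intro mult_left_mono) auto
      then have "c * real n \<le> c * t + \<bar>c\<bar>" by (simp add: algebra_simps)
      moreover have "\<bar>c\<bar> \<le> \<delta> * t" using elim \<delta> by (simp add: field_simps)
      moreover have "c' * t = c * t + \<delta> * t + \<delta> * t" by (simp add: \<delta>_def field_simps)
      ultimately show ?thesis by simp
    qed
    finally show ?case .
  qed
qed

text \<open>Here the rounding goes up: a good real time \<open>t\<close> must yield a good integer
  time after it, so the rest of the unit interval following \<open>t\<close> has to be controlled.
  The second supremum in (A1) provides exactly this control.\<close>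

lemma frequently_le_exp_interpolate:
  fixes F :: "real \<Rightarrow> real" and \<phi> :: "nat \<Rightarrow> real"
  assumes F: "\<And>n t. real n \<le> t \<Longrightarrow> t \<le> real n + 1 \<Longrightarrow> F (real (Suc n)) \<le> exp (\<phi> n) * F t"
    and \<phi>: "\<And>\<delta>. 0 < \<delta> \<Longrightarrow> \<forall>\<^sub>F n in sequentially. \<phi> n \<le> \<delta> * real n"
    and fr: "\<exists>\<^sub>F t in at_top. F t \<le> exp (c * t)" and "c < c'"
  shows "\<exists>\<^sub>F n in sequentially. F (real n) \<le> exp (c' * real n)"
proof -
  define \<delta> where "\<delta> = (c' - c) / 2"
  have \<delta>: "\<delta> > 0" using \<open>c < c'\<close> by (simp add: \<delta>_def)
  obtain N0 where N0: "\<And>n. n \<ge> N0 \<Longrightarrow> \<phi> n \<le> \<delta> * real n"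
    using \<phi>[OF \<delta>] by (auto simp: eventually_sequentially)
  have "\<exists>n\<ge>N. F (real n) \<le> exp (c' * real n)" for N
  proof -
    have "\<exists>\<^sub>F t in at_top. F t \<le> exp (c * t) \<and> (real N + real N0 + 1 + \<bar>c\<bar> / \<delta> \<le> t)"
      by (rule frequently_eventually_frequently[OF fr eventually_ge_at_top])
    then obtain t where t: "F t \<le> exp (c * t)" "real N + real N0 + 1 + \<bar>c\<bar> / \<delta> \<le> t"
      using frequently_ex by blast
    have pos: "0 \<le> \<bar>c\<bar> / \<delta>" using \<delta> by simp
    define n where "n = nat \<lfloor>t\<rfloor>"
    have "0 \<le> t" using t pos by linarith
    then have n: "real n \<le> t" "t \<le> real n + 1" unfolding n_def by linarith+
    have nN: "n \<ge> N0" "Suc n \<ge> N" using n t pos by linarith+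
    have "F (real (Suc n)) \<le> exp (\<phi> n) * F t" by (rule F[OF n])
    also have "\<dots> \<le> exp (\<phi> n) * exp (c * t)" using t by (intro mult_left_mono) auto
    also have "\<dots> = exp (\<phi> n + c * t)" by (simp add: exp_add)
    also have "\<dots> \<le> exp (c' * real (Suc n))"
    proof -
      have "\<phi> n \<le> \<delta> * real n" using N0 nN by blast
      moreover have "\<delta> * real n \<le> \<delta> * real (Suc n)" using \<delta> by simp
      moreover have "\<bar>c * (t - real (Suc n))\<bar> \<le> \<bar>c\<bar> * 1" unfolding abs_mult using n by (intro mult_left_mono) auto
      then have "c * t \<le> c * real (Suc n) + \<bar>c\<bar>" by (simp add: algebra_simps)
      moreover have "\<bar>c\<bar> / \<delta> \<le> real (Suc n)" using t n by linarith
      then have "\<bar>c\<bar> \<le> \<delta> * real (Suc n)" using \<delta> by (simp add: field_simps)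
      moreover have "c' * real (Suc n) = c * real (Suc n) + \<delta> * real (Suc n) + \<delta> * real (Suc n)"
        by (simp add: \<delta>_def field_simps)
      ultimately show ?thesis by simp
    qed
    finally show ?thesis using nN by blast
  qed
  then show ?thesis by (auto simp: frequently_sequentially)
qed

context ergodic_flow begin

text \<open>Kingman's theorem. The rate is the infimum of all \<open>c\<close> for which the process almost surely returns below
  \<open>exp (c' t)\<close> for each \<open>c' > c\<close>; this event is backward invariant, hence trivial by ergodicity.\<close>

theorem subadditive_flow_rate:
  fixes R :: "real \<Rightarrow> 'w \<Rightarrow> real"
  assumes D: "invariant_set M \<theta> D" "prob D = 1"
    and R0: "\<And>t \<omega>. \<omega> \<in> D \<Longrightarrow> 0 \<le> t \<Longrightarrow> 0 \<le> R t \<omega>"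
    and sub: "\<And>s t \<omega>. \<omega> \<in> D \<Longrightarrow> 0 \<le> s \<Longrightarrow> 0 \<le> t \<Longrightarrow> R (s + t) \<omega> \<le> R t (\<theta> s \<omega>) * R s \<omega>"
    and meas: "\<And>n::nat. (\<lambda>\<omega>. indicator D \<omega> * R (real n) \<omega>) \<in> borel_measurable M"
    and f: "integrable M f" "\<And>\<omega>. 0 \<le> f \<omega>"
      "AE \<omega> in M. \<omega> \<in> D \<longrightarrow> (\<forall>s\<in>{0..1}. R s \<omega> \<le> exp (f \<omega>))"
    and g: "integrable M g"
      "AE \<omega> in M. \<omega> \<in> D \<longrightarrow> (\<forall>s\<in>{0..1}. R (1 - s) (\<theta> s \<omega>) \<le> exp (g \<omega>))"
  shows "\<exists>l. AE \<omega> in M. rate_le (\<lambda>t. R t \<omega>) l \<and> rate_ge (\<lambda>t. R t \<omega>) l"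
proof -
  interpret T: mp_transformation M "\<theta> 1" by (rule mp_flow)
  have iter: "(\<theta> 1 ^^ n) \<omega> = \<theta> (real n) \<omega>" if "\<omega> \<in> space M" for n \<omega>
    using flow_iter[OF that, where t = 1 and n = n] by simp
  have Ds [measurable]: "D \<in> sets M" using D by (simp add: invariant_set_def)
  have D_sp: "\<omega> \<in> space M" if "\<omega> \<in> D" for \<omega> using invariant_set_space[OF D(1) that] .
  have D_fl: "\<theta> t \<omega> \<in> D" if "\<omega> \<in> D" for \<omega> t using invariant_setD[OF D(1) that] .
  have AE_D: "AE \<omega> in M. \<omega> \<in> D" using D by (simp add: prob_eq_1)
  have meas2: "{\<omega>\<in>space M. \<omega> \<in> D \<and> R (real n) \<omega> \<le> c} \<in> sets M" for n c
  proof -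
    have "{\<omega>\<in>space M. \<omega> \<in> D \<and> indicator D \<omega> * R (real n) \<omega> \<le> c} \<in> sets M"
      using meas[of n] by measurable
    also have "{\<omega>\<in>space M. \<omega> \<in> D \<and> indicator D \<omega> * R (real n) \<omega> \<le> c} = {\<omega>\<in>space M. \<omega> \<in> D \<and> R (real n) \<omega> \<le> c}"
      by auto
    finally show ?thesis .
  qed
  \<comment> \<open>The typical points. \<open>f\<close> bounds the growth from an integer time to a
    later time in the unit interval, \<open>g\<close> the growth from there to the next integer, and
    both are sublinear along the orbit.\<close>
  define H where "H \<omega> \<longleftrightarrow> \<omega> \<in> D \<and>
     (\<forall>n. \<forall>s\<in>{0..1}. R s (\<theta> (real n) \<omega>) \<le> exp (f (\<theta> (real n) \<omega>))) \<and>
     (\<forall>n. \<forall>s\<in>{0..1}. R (1 - s) (\<theta> s (\<theta> (real n) \<omega>)) \<le> exp (g (\<theta> (real n) \<omega>))) \<and>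
     (\<forall>\<delta>>0. \<forall>\<^sub>F n in sequentially. f (\<theta> (real n) \<omega>) \<le> \<delta> * real n) \<and>
     (\<forall>\<delta>>0. \<forall>\<^sub>F n in sequentially. g (\<theta> (real n) \<omega>) \<le> \<delta> * real n)" for \<omega>
  have AE_H: "AE \<omega> in M. H \<omega>"
    using AE_D T.AE_iter[OF f(3)] T.AE_iter[OF g(2)] T.AE_sublinear[OF f(1)] T.AE_sublinear[OF g(1)]
  proof eventually_elim
    case (elim \<omega>)
    note it = iter[OF D_sp[OF elim(1)]]
    have "\<forall>\<^sub>F n in sequentially. f (\<theta> (real n) \<omega>) \<le> \<delta> * real n" "\<forall>\<^sub>F n in sequentially. g (\<theta> (real n) \<omega>) \<le> \<delta> * real n"
      if "\<delta> > 0" for \<delta>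
    proof -
      from elim(4) that have "\<forall>\<^sub>F n in sequentially. \<bar>f (\<theta> (real n) \<omega>)\<bar> \<le> \<delta> * real n" unfolding it by blast
      then show "\<forall>\<^sub>F n in sequentially. f (\<theta> (real n) \<omega>) \<le> \<delta> * real n" by eventually_elim auto
      from elim(5) that have "\<forall>\<^sub>F n in sequentially. \<bar>g (\<theta> (real n) \<omega>)\<bar> \<le> \<delta> * real n" unfolding it by blast
      then show "\<forall>\<^sub>F n in sequentially. g (\<theta> (real n) \<omega>) \<le> \<delta> * real n" by eventually_elim auto
    qed
    moreover note elim(1) elim(2)[unfolded it] elim(3)[unfolded it] D_fl[OF elim(1)]
    ultimately show ?case unfolding H_def by blast
  qed
  have up: "\<forall>\<^sub>F t in at_top. R t \<omega> \<le> exp (c' * t)"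
    if H: "H \<omega>" and ev: "\<forall>\<^sub>F n in sequentially. R (real n) \<omega> \<le> exp (c * real n)" and "c < c'" for \<omega> c c'
  proof (rule eventually_le_exp_interpolate[OF _ _ ev \<open>c < c'\<close>])
    fix n t assume t: "real n \<le> t" "t \<le> real n + 1"
    have \<omega>: "\<omega> \<in> D" using H by (simp add: H_def)
    have "R t \<omega> \<le> R (t - real n) (\<theta> (real n) \<omega>) * R (real n) \<omega>"
      using sub[OF \<omega>, of "real n" "t - real n"] t by simp
    also have "\<dots> \<le> exp (f (\<theta> (real n) \<omega>)) * R (real n) \<omega>"
      using H t R0[OF \<omega>, of "real n"] unfolding H_def by (intro mult_right_mono) auto
    finally show "R t \<omega> \<le> exp (f (\<theta> (real n) \<omega>)) * R (real n) \<omega>" .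
  qed (use H in \<open>auto simp: H_def\<close>)
  have low: "\<exists>\<^sub>F n in sequentially. R (real n) \<omega> \<le> exp (c' * real n)"
    if H: "H \<omega>" and fr: "\<exists>\<^sub>F t in at_top. R t \<omega> \<le> exp (c * t)" and "c < c'" for \<omega> c c'
  proof (rule frequently_le_exp_interpolate[OF _ _ fr \<open>c < c'\<close>])
    fix n t assume t: "real n \<le> t" "t \<le> real n + 1"
    have \<omega>: "\<omega> \<in> D" using H by (simp add: H_def)
    have "0 \<le> t" using t by linarith
    have "R (real (Suc n)) \<omega> \<le> R (real n + 1 - t) (\<theta> t \<omega>) * R t \<omega>"
      using sub[OF \<omega>, of t "real n + 1 - t"] t \<open>0 \<le> t\<close> by (simp add: algebra_simps)
    also have "\<theta> t \<omega> = \<theta> (t - real n) (\<theta> (real n) \<omega>)" using D_sp[OF \<omega>] by (simp add: flow_flow)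
    also have "real n + 1 - t = 1 - (t - real n)" by simp
    also have "R (1 - (t - real n)) (\<theta> (t - real n) (\<theta> (real n) \<omega>)) * R t \<omega> \<le> exp (g (\<theta> (real n) \<omega>)) * R t \<omega>"
    proof (rule mult_right_mono)
      show "R (1 - (t - real n)) (\<theta> (t - real n) (\<theta> (real n) \<omega>)) \<le> exp (g (\<theta> (real n) \<omega>))"
        using H t unfolding H_def by simp
    qed (use R0 \<omega> \<open>0 \<le> t\<close> in auto)
    finally show "R (real (Suc n)) \<omega> \<le> exp (g (\<theta> (real n) \<omega>)) * R t \<omega>" .
  qed (use H in \<open>auto simp: H_def\<close>)
  \<comment> \<open>The event that the lower growth rate is at most \<open>c\<close>. The slack
    \<open>c' > c\<close> makes it insensitive to constant factors and to time shifts.\<close>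
  define A where "A c = {\<omega>\<in>D. \<forall>c'>c. \<exists>\<^sub>F t in at_top. R t \<omega> \<le> exp (c' * t)}" for c
  have A_iff: "\<omega> \<in> A c \<longleftrightarrow> (\<forall>j::nat. \<exists>\<^sub>F n in sequentially. R (real n) \<omega> \<le> exp ((c + 1 / real (Suc j)) * real n))"
    if H: "H \<omega>" for \<omega> c
  proof
    assume \<omega>: "\<omega> \<in> A c"
    show "\<forall>j::nat. \<exists>\<^sub>F n in sequentially. R (real n) \<omega> \<le> exp ((c + 1 / real (Suc j)) * real n)"
    proof
      fix j
      have "\<exists>\<^sub>F t in at_top. R t \<omega> \<le> exp ((c + 1 / real (Suc j) / 2) * t)"
        using \<omega> unfolding A_def by (auto simp: add_pos_pos)
      then show "\<exists>\<^sub>F n in sequentially. R (real n) \<omega> \<le> exp ((c + 1 / real (Suc j)) * real n)"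
      proof (rule low[OF H])
        have "1 / real (Suc j) / 2 < 1 / real (Suc j)" by (simp add: field_simps)
        then show "c + 1 / real (Suc j) / 2 < c + 1 / real (Suc j)" by (rule add_strict_left_mono)
      qed
    qed
  next
    assume *: "\<forall>j::nat. \<exists>\<^sub>F n in sequentially. R (real n) \<omega> \<le> exp ((c + 1 / real (Suc j)) * real n)"
    have "\<exists>\<^sub>F t in at_top. R t \<omega> \<le> exp (c' * t)" if c': "c < c'" for c'
    proof -
      obtain j where j: "1 / real (Suc j) < c' - c" using c' by (metis nat_approx_posE diff_gt_0_iff_gt)
      have "\<exists>\<^sub>F n in sequentially. R (real n) \<omega> \<le> exp (c' * real n)"
      proof (rule frequently_elim1[OF spec[OF *, of j]])
        fix n assume "R (real n) \<omega> \<le> exp ((c + 1 / real (Suc j)) * real n)"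
        moreover have "(c + 1 / real (Suc j)) * real n \<le> c' * real n" using j by (intro mult_right_mono) auto
        ultimately show "R (real n) \<omega> \<le> exp (c' * real n)" by (meson exp_le_cancel_iff order_trans)
      qed
      then have "\<exists>t\<ge>N. R t \<omega> \<le> exp (c' * t)" for N
        unfolding frequently_sequentially
        by (metis (no_types) real_arch_simple order_trans of_nat_le_iff)
      then show ?thesis by (auto simp: frequently_def eventually_at_top_linorder)
    qed
    then show "\<omega> \<in> A c" using H by (auto simp: A_def H_def)
  qed
  \<comment> \<open>The definition quantifies over real times. At typical points the event agrees
    with a countable condition on integer times, and completeness of \<open>M\<close> disposes of
    the other points.\<close>
  have A_sets: "A c \<in> sets M" for c
  proof -
    let ?B = "{\<omega>\<in>space M. \<forall>j::nat. \<forall>N. \<exists>n\<ge>N. \<omega> \<in> D \<and> R (real n) \<omega> \<le> exp ((c + 1 / real (Suc j)) * real n)}"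
    have B: "?B \<in> sets M" 
      by (intro sets.sets_Collect_countable_All sets.sets_Collect_countable_Ex sets.sets_Collect_conj sets.sets_Collect_const meas2)
    have "AE \<omega> in M. \<omega> \<in> A c \<longleftrightarrow> \<omega> \<in> ?B"
      using AE_H AE_space
    proof eventually_elim
      case (elim \<omega>)
      then show ?case unfolding A_iff[OF elim(1)] frequently_sequentially using elim(1) by (auto simp: H_def)
    qed
    then have "AE \<omega> in M. \<omega> \<in> ?B \<longleftrightarrow> \<omega> \<in> A c" by eventually_elim blast
    then show ?thesis using B
      by (rule in_sets_AE) (use D_sp in \<open>auto simp: A_def\<close>)
  qed
  \<comment> \<open>Submultiplicativity bounds \<open>R\<close> at \<open>\<omega>\<close> by
    \<open>R\<close> at \<open>\<theta> s \<omega>\<close> and not conversely, so backward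
    invariance is what it yields.\<close>
  have A_01: "prob (A c) = 0 \<or> prob (A c) = 1" for c
  proof (rule backward_invariant_0_1[OF A_sets])
    fix \<omega> s assume \<omega>: "\<omega> \<in> space M" "0 \<le> s" "\<theta> s \<omega> \<in> A c"
    then have \<omega>D: "\<omega> \<in> D" using invariant_set_iff[OF D(1) \<omega>(1)] by (auto simp: A_def)
    have "\<exists>\<^sub>F t in at_top. R t \<omega> \<le> exp (c' * t)" if c': "c < c'" for c'
    proof (rule ccontr)
      assume "\<not> ?thesis"
      then have ev: "\<forall>\<^sub>F t in at_top. exp (c' * t) \<le> R t \<omega>"
        unfolding not_frequently by (rule eventually_mono) auto
      have "rate_ge (\<lambda>t. R t (\<theta> s \<omega>)) (ereal c')"
      proof (rule rate_ge_shift[where s = "- s" and K = "R s \<omega>" and F = "\<lambda>t. R t \<omega>"])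
        show "rate_ge (\<lambda>t. R t \<omega>) (ereal c')"
          unfolding rate_ge_def
        proof (intro allI impI)
          fix d assume "ereal d < ereal c'"
          show "\<forall>\<^sub>F t in at_top. exp (d * t) \<le> R t \<omega>"
            using ev eventually_ge_at_top[of 0]
          proof eventually_elim
            case (elim t)
            have "exp (d * t) \<le> exp (c' * t)" using elim \<open>ereal d < ereal c'\<close> by (auto intro: mult_right_mono)
            then show ?case using elim by linarith
          qed
        qed
        show "\<forall>\<^sub>F t in at_top. R t \<omega> \<le> R s \<omega> * R (- s + t) (\<theta> s \<omega>)"
          using eventually_ge_at_top[of s]
        proof eventually_elim
          case (elim t)
          then show ?case using sub[OF \<omega>D \<open>0 \<le> s\<close>, of "t - s"] by (simp add: mult.commute)
        qed
        show "\<forall>\<^sub>F t in at_top. 0 \<le> R t (\<theta> s \<omega>)"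
          using eventually_ge_at_top[of 0] by eventually_elim (use R0 D_fl \<omega>D in auto)
      qed
      moreover obtain d where d: "c < d" "d < c'" using c' dense by blast
      moreover obtain d' where d': "d < d'" "d' < c'" using d dense by blast
      ultimately have ev': "\<forall>\<^sub>F t in at_top. exp (d' * t) \<le> R t (\<theta> s \<omega>)"
        and fr: "\<exists>\<^sub>F t in at_top. R t (\<theta> s \<omega>) \<le> exp (d * t)"
        using \<omega>(3) by (auto simp: rate_ge_def A_def)
      have "\<forall>\<^sub>F t in at_top. \<not> R t (\<theta> s \<omega>) \<le> exp (d * t)"
        using ev' eventually_gt_at_top[of 0]
      proof eventually_elim
        case (elim t)
        have "exp (d * t) < exp (d' * t)"
          unfolding exp_less_cancel_iff using elim d' by (intro mult_strict_right_mono) auto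
        then show ?case using elim by linarith
      qed
      with fr show False by (simp add: frequently_def)
    qed
    then show "\<omega> \<in> A c" using \<omega>D by (auto simp: A_def)
  qed
  have A_upper: "AE \<omega> in M. rate_le (\<lambda>t. R t \<omega>) (ereal c)" if "prob (A c) = 1" for c
  proof -
    have AE_A: "AE \<omega> in M. \<omega> \<in> A c" using that A_sets by (simp add: prob_eq_1)
    have step: "AE \<omega> in M. \<forall>\<epsilon>>0. \<forall>\<^sub>F n in sequentially. R (real n) \<omega> \<le> exp ((c + 1 / real (Suc j) + \<epsilon>) * real n)" for j
    proof -
      \<comment> \<open>\<open>R\<close> may vanish, so its logarithm is truncated from below at
        \<open>- m n\<close>. The truncated process is still subadditive, and this \<open>m\<close>
        keeps the truncation level below the target \<open>(c + 1 / Suc j) n\<close>.\<close>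
      define m where "m = \<bar>c + 1 / real (Suc j)\<bar>"
      define a where "a n \<omega> = ln (max (indicator D \<omega> * R (real n) \<omega>) (exp (- m * real n)))" for n \<omega>
      have aD: "exp (a n \<omega>) = max (R (real n) \<omega>) (exp (- m * real n))" if "\<omega> \<in> D" for n \<omega>
        using that by (simp add: a_def less_max_iff_disj)
      have "AE \<omega> in M. \<omega> \<in> D \<longrightarrow> (\<forall>\<epsilon>>0. \<forall>\<^sub>F n in sequentially. a n \<omega> \<le> (c + 1 / real (Suc j) + \<epsilon>) * real n)"
      proof (rule T.subadditive_limsup_le[OF Ds _ _ _ _ f(1,2)])
        show "\<theta> 1 \<omega> \<in> D" if "\<omega> \<in> D" for \<omega> using D_fl[OF that] .
        show "a n \<in> borel_measurable M" for n unfolding a_def[abs_def] using meas[of n] by measurable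
        show "a (n + k) \<omega> \<le> a n \<omega> + a k ((\<theta> 1 ^^ n) \<omega>)" if \<omega>: "\<omega> \<in> D" for \<omega> n k
        proof -
          have "exp (a (n + k) \<omega>) = max (R (real n + real k) \<omega>) (exp (- m * real k) * exp (- m * real n))"
            unfolding aD[OF \<omega>] by (simp add: exp_add[symmetric] algebra_simps)
          also have "\<dots> \<le> max (R (real k) (\<theta> (real n) \<omega>)) (exp (- m * real k)) * max (R (real n) \<omega>) (exp (- m * real n))"
          proof (rule max.boundedI)
            have "R (real n + real k) \<omega> \<le> R (real k) (\<theta> (real n) \<omega>) * R (real n) \<omega>" by (rule sub[OF \<omega>]) auto
            also have "\<dots> \<le> max (R (real k) (\<theta> (real n) \<omega>)) (exp (- m * real k)) * max (R (real n) \<omega>) (exp (- m * real n))"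
              using R0[OF \<omega>] R0[OF D_fl[OF \<omega>]] by (intro mult_mono) (auto simp: le_max_iff_disj)
            finally show "R (real n + real k) \<omega> \<le> \<dots>" .
          qed (intro mult_mono, auto simp: le_max_iff_disj)
          also have "\<dots> = exp (a k (\<theta> (real n) \<omega>)) * exp (a n \<omega>)"
            unfolding aD[OF \<omega>] aD[OF D_fl[OF \<omega>]] ..
          also have "\<dots> = exp (a n \<omega> + a k ((\<theta> 1 ^^ n) \<omega>))"
            unfolding iter[OF D_sp[OF \<omega>]] by (simp add: exp_add)
          finally show ?thesis by simp
        qed
        show "AE \<omega> in M. \<omega> \<in> D \<longrightarrow> a 1 \<omega> \<le> f \<omega>"
          using f(3)
        proof eventually_elim
          case (elim \<omega>)
          have "a 1 \<omega> \<le> f \<omega>" if \<omega>: "\<omega> \<in> D"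
          proof -
            have "0 \<le> m" by (simp add: m_def)
            then have "exp (- m * real 1) \<le> exp (f \<omega>)" using f(2)[of \<omega>] by (subst exp_le_cancel_iff) auto
            then have "exp (a 1 \<omega>) \<le> exp (f \<omega>)" unfolding aD[OF \<omega>] using elim \<omega> by auto
            then show "a 1 \<omega> \<le> f \<omega>" by simp
          qed
          then show ?case ..
        qed
        show "AE \<omega> in M. \<omega> \<in> D \<longrightarrow> (\<exists>n\<ge>1. a n \<omega> \<le> (c + 1 / real (Suc j)) * real n)"
          using AE_A AE_H
        proof eventually_elim
          case (elim \<omega>)
          then have \<omega>: "\<omega> \<in> A c" "H \<omega>" "\<omega> \<in> D" by (auto simp: A_def)
          then obtain n where n: "n \<ge> 1" "R (real n) \<omega> \<le> exp ((c + 1 / real (Suc j)) * real n)"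
            unfolding A_iff[OF \<omega>(2)] frequently_sequentially by blast
          have "- m * real n \<le> (c + 1 / real (Suc j)) * real n"
            unfolding m_def by (intro mult_right_mono) auto
          then have "exp (a n \<omega>) \<le> exp ((c + 1 / real (Suc j)) * real n)"
            unfolding aD[OF \<omega>(3)] using n by simp
          with n show ?case by auto
        qed
      qed
      with AE_D show ?thesis
      proof eventually_elim
        case (elim \<omega>)
        show ?case
        proof (intro allI impI)
          fix \<epsilon> :: real assume "\<epsilon> > 0"
          with elim have "\<forall>\<^sub>F n in sequentially. a n \<omega> \<le> (c + 1 / real (Suc j) + \<epsilon>) * real n" by blast
          then show "\<forall>\<^sub>F n in sequentially. R (real n) \<omega> \<le> exp ((c + 1 / real (Suc j) + \<epsilon>) * real n)"
          proof eventually_elim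
            case (elim n)
            have "R (real n) \<omega> \<le> exp (a n \<omega>)" unfolding aD[OF \<open>\<omega> \<in> D\<close>] by simp
            also have "\<dots> \<le> exp ((c + 1 / real (Suc j) + \<epsilon>) * real n)" using elim by simp
            finally show ?case .
          qed
        qed
      qed
    qed
    have "AE \<omega> in M. \<forall>j. \<forall>\<epsilon>>0. \<forall>\<^sub>F n in sequentially. R (real n) \<omega> \<le> exp ((c + 1 / real (Suc j) + \<epsilon>) * real n)"
      unfolding AE_all_countable by (intro allI step)
    then show ?thesis using AE_H
    proof eventually_elim
      case (elim \<omega>)
      show ?case unfolding rate_le_def
      proof (intro allI impI)
        fix c' assume "ereal c < ereal c'"
        then have cc: "c < c'" by simp
        then obtain j where j: "1 / real (Suc j) < (c' - c) / 2" by (metis nat_approx_posE diff_gt_0_iff_gt half_gt_zero)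
        have "\<forall>\<^sub>F n in sequentially. R (real n) \<omega> \<le> exp ((c + 1 / real (Suc j) + (c' - c) / 2) * real n)"
          using elim(1) cc by (auto simp del: of_nat_Suc)
        then show "\<forall>\<^sub>F t in at_top. R t \<omega> \<le> exp (c' * t)"
          by (rule up[OF elim(2)]) (use j in \<open>simp add: field_simps del: of_nat_Suc\<close>)
      qed
    qed
  qed
  define l where "l = Inf (ereal ` {c. prob (A c) = 1})"
  \<comment> \<open>Restricting to rational \<open>c\<close> keeps the exceptional set null; density
    restores all real \<open>c\<close> below.\<close>
  have "AE \<omega> in M. \<forall>c\<in>\<rat>. l < ereal c \<longrightarrow> (\<forall>\<^sub>F t in at_top. R t \<omega> \<le> exp (c * t))"
  proof (subst AE_ball_countable, rule countable_rat, rule ballI)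
    fix c :: real
    show "AE \<omega> in M. l < ereal c \<longrightarrow> (\<forall>\<^sub>F t in at_top. R t \<omega> \<le> exp (c * t))"
    proof (cases "l < ereal c")
      case True
      then obtain d where d: "prob (A d) = 1" "ereal d < ereal c"
        unfolding l_def Inf_less_iff by auto
      show ?thesis using A_upper[OF d(1)] by eventually_elim (use d(2) in \<open>auto simp: rate_le_def\<close>)
    qed auto
  qed
  moreover have "AE \<omega> in M. \<forall>c\<in>\<rat>. ereal c < l \<longrightarrow> (\<forall>\<^sub>F t in at_top. exp (c * t) \<le> R t \<omega>)"
  proof (subst AE_ball_countable, rule countable_rat, rule ballI)
    fix c :: real
    show "AE \<omega> in M. ereal c < l \<longrightarrow> (\<forall>\<^sub>F t in at_top. exp (c * t) \<le> R t \<omega>)"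
    proof (cases "ereal c < l")
      case True
      have "prob (A c) \<noteq> 1"
      proof
        assume "prob (A c) = 1"
        then have "l \<le> ereal c" unfolding l_def by (intro Inf_lower) auto
        with True show False by simp
      qed
      with A_01 have "prob (A c) = 0" by blast
      then have "AE \<omega> in M. \<omega> \<notin> A c" using A_sets by (intro AE_not_in) (auto simp: null_sets_def emeasure_eq_measure)
      with AE_D show ?thesis
      proof eventually_elim
        case (elim \<omega>)
        then obtain c' where c': "c < c'" "\<forall>\<^sub>F t in at_top. \<not> R t \<omega> \<le> exp (c' * t)"
          by (auto simp: A_def not_frequently)
        from c'(2) eventually_ge_at_top[of 0] have "\<forall>\<^sub>F t in at_top. exp (c * t) \<le> R t \<omega>"
        proof eventually_elim
          case (elim t)
          have "exp (c * t) \<le> exp (c' * t)" using elim c' by (auto intro: mult_right_mono)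
          then show ?case using elim by linarith
        qed
        then show ?case ..
      qed
    qed auto
  qed
  ultimately have "AE \<omega> in M. rate_le (\<lambda>t. R t \<omega>) l \<and> rate_ge (\<lambda>t. R t \<omega>) l"
  proof eventually_elim
    case (elim \<omega>)
    have "rate_le (\<lambda>t. R t \<omega>) l" unfolding rate_le_def
    proof (intro allI impI)
      fix c :: real assume "l < ereal c"
      then obtain d where d: "l < ereal d" "d < c" by (metis ereal_dense2 less_ereal.simps(1))
      then obtain r where r: "r \<in> \<rat>" "d < r" "r < c" using Rats_dense_in_real by blast
      have "l < ereal r" using d r by (meson less_ereal.simps(1) less_trans)
      with elim(1) r have "\<forall>\<^sub>F t in at_top. R t \<omega> \<le> exp (r * t)" by blast
      then show "\<forall>\<^sub>F t in at_top. R t \<omega> \<le> exp (c * t)" using eventually_ge_at_top[of 0]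
      proof eventually_elim
        case (elim t)
        have "exp (r * t) \<le> exp (c * t)" using elim r by (auto intro: mult_right_mono)
        then show ?case using elim by linarith
      qed
    qed
    moreover have "rate_ge (\<lambda>t. R t \<omega>) l" unfolding rate_ge_def
    proof (intro allI impI)
      fix c :: real assume "ereal c < l"
      then obtain d where d: "ereal d < l" "c < d" by (metis ereal_dense2 less_ereal.simps(1))
      then obtain r where r: "r \<in> \<rat>" "c < r" "r < d" using Rats_dense_in_real by blast
      have "ereal r < l" using d r by (meson less_ereal.simps(1) less_trans)
      with elim(2) r have "\<forall>\<^sub>F t in at_top. exp (r * t) \<le> R t \<omega>" by blast
      then show "\<forall>\<^sub>F t in at_top. exp (c * t) \<le> R t \<omega>" using eventually_ge_at_top[of 0]
      proof eventually_elim
        case (elim t)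
        have "exp (c * t) \<le> exp (r * t)" using elim r by (auto intro: mult_right_mono)
        then show ?case using elim by linarith
      qed
    qed
    ultimately show ?case by blast
  qed
  then show ?thesis by blast
qed

end

section \<open>Ordered Banach spaces\<close>

lemma Cauchy_at_top_convergent:
  fixes f :: "real \<Rightarrow> 'b::banach"
  assumes "\<And>\<epsilon>. 0 < \<epsilon> \<Longrightarrow> \<exists>N. \<forall>s\<ge>N. norm (f s - f N) \<le> \<epsilon>"
  shows "\<exists>l. (f \<longlongrightarrow> l) at_top"
proof -
  have "\<exists>N. \<forall>s\<ge>N. \<forall>t\<ge>N. dist (f s) (f t) < \<epsilon>" if "0 < \<epsilon>" for \<epsilon>
  proof -
    have "0 < \<epsilon> / 3" using that by simp
    from assms[OF this] obtain N where N: "\<And>s. s \<ge> N \<Longrightarrow> norm (f s - f N) \<le> \<epsilon> / 3" by blast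
    have "dist (f s) (f t) < \<epsilon>" if "s \<ge> N" "t \<ge> N" for s t
    proof -
      have "dist (f s) (f t) \<le> norm (f s - f N) + norm (f t - f N)"
        using dist_triangle2[of "f s" "f t" "f N"] by (simp add: dist_norm)
      also have "\<dots> \<le> \<epsilon> / 3 + \<epsilon> / 3" by (intro add_mono N that)
      also have "\<dots> < \<epsilon>" using \<open>0 < \<epsilon>\<close> by simp
      finally show ?thesis .
    qed
    then show ?thesis by blast
  qed
  note C = this
  have "Cauchy (\<lambda>n. f (real n))"
  proof (rule metric_CauchyI)
    fix \<epsilon> :: real assume "0 < \<epsilon>"
    then obtain N where N: "\<forall>s\<ge>N. \<forall>t\<ge>N. dist (f s) (f t) < \<epsilon>" using C by blast
    obtain n0 :: nat where "N \<le> real n0" using real_arch_simple by blast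
    then have "\<forall>m\<ge>n0. \<forall>n\<ge>n0. dist (f (real m)) (f (real n)) < \<epsilon>" using N by auto
    then show "\<exists>M. \<forall>m\<ge>M. \<forall>n\<ge>M. dist (f (real m)) (f (real n)) < \<epsilon>" by blast
  qed
  then obtain l where l: "(\<lambda>n. f (real n)) \<longlonglongrightarrow> l" using Cauchy_convergent convergent_def by blast
  have "(f \<longlongrightarrow> l) at_top"
  proof (rule tendstoI)
    fix \<epsilon> :: real assume "0 < \<epsilon>"
    then have "0 < \<epsilon> / 2" by simp
    from C[OF this] obtain N where N: "\<forall>s\<ge>N. \<forall>t\<ge>N. dist (f s) (f t) < \<epsilon> / 2" by blast
    have "\<forall>\<^sub>F n in sequentially. dist (f (real n)) l < \<epsilon> / 2" using l \<open>0 < \<epsilon> / 2\<close> by (rule tendstoD)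
    then obtain n0 where n0: "\<forall>n\<ge>n0. dist (f (real n)) l < \<epsilon> / 2" by (auto simp: eventually_sequentially)
    obtain n1 :: nat where "N \<le> real n1" using real_arch_simple by blast
    then have n: "N \<le> real (max n0 n1)" by linarith
    have "dist (f s) l < \<epsilon>" if "s \<ge> N" for s
    proof -
      have "dist (f s) l \<le> dist (f s) (f (real (max n0 n1))) + dist (f (real (max n0 n1))) l" by (rule dist_triangle)
      also have "\<dots> < \<epsilon> / 2 + \<epsilon> / 2" using N n0 n that by (intro add_strict_mono) auto
      finally show ?thesis by simp
    qed
    then show "\<forall>\<^sub>F s in at_top. dist (f s) l < \<epsilon>" by (auto simp: eventually_at_top_linorder)
  qed
  then show ?thesis by blast
qed

lemma norm_diff_normalized_le:
  fixes x y :: "'b::real_normed_vector"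
  assumes "x \<noteq> 0" "y \<noteq> 0"
  shows "norm (x /\<^sub>R norm x - y /\<^sub>R norm y) \<le> 2 * norm (x - y) / norm y"
proof -
  have "x /\<^sub>R norm x - y /\<^sub>R norm y = (x - y) /\<^sub>R norm y + (inverse (norm x) - inverse (norm y)) *\<^sub>R x"
    by (simp add: algebra_simps)
  then have "norm (x /\<^sub>R norm x - y /\<^sub>R norm y)
      \<le> norm ((x - y) /\<^sub>R norm y) + norm ((inverse (norm x) - inverse (norm y)) *\<^sub>R x)"
    by (metis norm_triangle_ineq)
  also have "norm ((x - y) /\<^sub>R norm y) = norm (x - y) / norm y" by (simp add: divide_inverse mult.commute)
  also have "norm ((inverse (norm x) - inverse (norm y)) *\<^sub>R x) = \<bar>norm y - norm x\<bar> / norm y"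
  proof -
    have "inverse (norm x) - inverse (norm y) = (norm y - norm x) / (norm x * norm y)"
      using assms by (simp add: field_simps)
    then show ?thesis using assms by (simp add: abs_mult)
  qed
  also have "\<dots> \<le> norm (x - y) / norm y"
    using norm_triangle_ineq3[of y x] by (intro divide_right_mono) (auto simp: norm_minus_commute)
  finally show ?thesis by (simp add: field_simps)
qed

context ordered_banach_setting begin

abbreviation le_C (infix "\<preceq>" 50) where "u \<preceq> v \<equiv> cone_le C u v"

lemma cone_zero: "0 \<in> C" and cone_add: "x \<in> C \<Longrightarrow> y \<in> C \<Longrightarrow> x + y \<in> C"
  and cone_scale: "0 \<le> c \<Longrightarrow> x \<in> C \<Longrightarrow> c *\<^sub>R x \<in> C"
  using convex_cone by (auto simp: convex_cone_iff)

lemma le_refl: "u \<preceq> u"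
  by (simp add: cone_le_def cone_zero)

lemma le_trans: "u \<preceq> v \<Longrightarrow> v \<preceq> z \<Longrightarrow> u \<preceq> z"
  using cone_add[of "v - u" "z - v"] by (simp add: cone_le_def)

lemma le_add: "u \<preceq> v \<Longrightarrow> x \<preceq> y \<Longrightarrow> u + x \<preceq> v + y"
  using cone_add[of "v - u" "y - x"] by (simp add: cone_le_def algebra_simps)

lemma le_scale: "0 \<le> c \<Longrightarrow> u \<preceq> v \<Longrightarrow> c *\<^sub>R u \<preceq> c *\<^sub>R v"
  using cone_scale[of c "v - u"] by (simp add: cone_le_def algebra_simps)

lemma le_minus: "u \<preceq> v \<Longrightarrow> - v \<preceq> - u"
  by (simp add: cone_le_def algebra_simps)

lemma zero_le_iff: "0 \<preceq> u \<longleftrightarrow> u \<in> C"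
  by (simp add: cone_le_def)

lemma scale_le_scale: "a \<le> b \<Longrightarrow> h \<in> C \<Longrightarrow> a *\<^sub>R h \<preceq> b *\<^sub>R h"
  using cone_scale[of "b - a" h] by (simp add: cone_le_def algebra_simps)

lemma scale_le_scaleD:
  assumes "a *\<^sub>R h \<preceq> b *\<^sub>R h" "h \<in> C" "h \<noteq> 0"
  shows "a \<le> b"
proof (rule ccontr)
  assume "\<not> a \<le> b"
  then have ab: "0 < a - b" by simp
  have "(b - a) *\<^sub>R h \<in> C" using assms by (simp add: cone_le_def algebra_simps)
  then have "inverse (a - b) *\<^sub>R ((b - a) *\<^sub>R h) \<in> C" using ab by (rule_tac cone_scale) simp_all
  also have "inverse (a - b) *\<^sub>R ((b - a) *\<^sub>R h) = - h"
  proof -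
    have "(b - a) *\<^sub>R h = (a - b) *\<^sub>R (- h)" by (simp add: algebra_simps)
    then show ?thesis using ab by simp
  qed
  finally have "- h \<in> C" .
  then have "h \<in> C \<inter> uminus ` C" using assms(2) by (metis IntI add.inverse_inverse image_eqI)
  with pointed_cone assms(3) show False by auto
qed

lemma norm_mono: "u \<in> C \<Longrightarrow> u \<preceq> v \<Longrightarrow> norm u \<le> norm v"
  using monotone_norm by (auto simp: monotone_norm_def zero_le_iff)

lemma le_in_cone: "u \<in> C \<Longrightarrow> u \<preceq> v \<Longrightarrow> v \<in> C"
  using le_trans zero_le_iff by blast

text \<open>Monotonicity of the norm speaks only about the cone, so \<open>x\<close> is moved into
  it by adding \<open>d h\<close>. The moved vector has norm at most \<open>2 d\<close> times that
  of \<open>h\<close> and the shift costs another \<open>d\<close>, hence the factor 3.\<close>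

lemma norm_le_if_between:
  assumes "(- d) *\<^sub>R h \<preceq> x" "x \<preceq> d *\<^sub>R h" "h \<in> C" "0 \<le> d"
  shows "norm x \<le> 3 * d * norm h"
proof -
  have "x + d *\<^sub>R h \<in> C" using assms(1) by (simp add: cone_le_def)
  moreover have "x + d *\<^sub>R h \<preceq> (2 * d) *\<^sub>R h"
    using le_add[OF assms(2) le_refl[of "d *\<^sub>R h"]] by (simp add: scaleR_add_left[symmetric])
  ultimately have "norm (x + d *\<^sub>R h) \<le> 2 * d * norm h" using norm_mono assms(4) by fastforce
  moreover have "norm x \<le> norm (x + d *\<^sub>R h) + norm (d *\<^sub>R h)"
    using norm_triangle_ineq4[of "x + d *\<^sub>R h" "d *\<^sub>R h"] by simp
  ultimately show ?thesis using assms(4) by simp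
qed

section \<open>Decompositions into cone elements with norm control\<close>

definition signed_ball :: "'a set"
  where "signed_ball = {u - v | u v. u \<in> C \<and> v \<in> C \<and> norm u \<le> 1 \<and> norm v \<le> 1}"

text \<open>The Baire half of the open mapping argument. Because the cone is reproducing, the
  dilations of the signed ball cover the space, so the closure of one of them contains a ball.
  Convexity and symmetry bring that ball to the origin.\<close>

lemma signed_ball_closure_ball: "\<exists>r>0. ball 0 r \<subseteq> closure signed_ball"
proof -
  let ?A = "\<lambda>n::nat. (\<lambda>x. real (Suc n) *\<^sub>R x) ` signed_ball"
  have cov: "(\<Union>n. closure (?A n)) = UNIV"
  proof -
    have "x \<in> (\<Union>n. closure (?A n))" for x
    proof -
      obtain u v where uv: "u \<in> C" "v \<in> C" "x = u - v" using reproducing_cone unfolding reproducing_cone_def by blast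
      obtain n :: nat where n: "max (norm u) (norm v) \<le> real n" using real_arch_simple by blast
      have 1: "inverse (real (Suc n)) *\<^sub>R z \<in> C" "norm (inverse (real (Suc n)) *\<^sub>R z) \<le> 1"
        if "z \<in> C" "norm z \<le> real n" for z
        using that by (auto simp: field_simps intro: cone_scale)
      define y where "y = inverse (real (Suc n)) *\<^sub>R u - inverse (real (Suc n)) *\<^sub>R v"
      have "y \<in> signed_ball" unfolding signed_ball_def y_def using 1[of u] 1[of v] n uv(1,2) by fastforce
      then have "real (Suc n) *\<^sub>R y \<in> ?A n" by (rule imageI)
      moreover have "real (Suc n) *\<^sub>R y = x"
        unfolding uv(3) y_def by (simp add: scaleR_diff_right del: of_nat_Suc)
      ultimately have "x \<in> closure (?A n)" using closure_subset[of "?A n"] by auto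
      then show ?thesis by (rule UN_I[OF UNIV_I])
    qed
    then show ?thesis by blast
  qed
  have "\<exists>n. interior (closure (?A n)) \<noteq> {}"
  proof (rule ccontr)
    assume "\<not> ?thesis"
    then have int: "interior (closure (?A n)) = {}" for n by blast
    have "Met_TC.mtopology interior_of (\<Union>n. closure (?A n)) = {}"
    proof (rule Met_TC.metric_Baire_category_alt)
      show "Met_TC.mcomplete TYPE('a)" using complete_UNIV by simp
      fix S assume "S \<in> range (\<lambda>n. closure (?A n))"
      then show "closedin Met_TC.mtopology S \<and> Met_TC.mtopology interior_of S = {}" using int by auto
    qed auto
    then have "interior (\<Union>n. closure (?A n)) = {}" by simp
    then show False unfolding cov by simp
  qed
  then obtain n x where "x \<in> interior (closure (?A n))" by blast
  then obtain r where r: "r > 0" "ball x r \<subseteq> closure (?A n)" by (meson mem_interior)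
  have conv: "convex signed_ball"
  proof (rule convexI)
    fix x y :: 'a and a b :: real
    assume "x \<in> signed_ball" "y \<in> signed_ball" and ab: "0 \<le> a" "0 \<le> b" "a + b = 1"
    then obtain u v u' v' where *: "x = u - v" "y = u' - v'" "u \<in> C" "v \<in> C" "u' \<in> C" "v' \<in> C"
      "norm u \<le> 1" "norm v \<le> 1" "norm u' \<le> 1" "norm v' \<le> 1" unfolding signed_ball_def by blast
    have nb: "norm (a *\<^sub>R p + b *\<^sub>R q) \<le> 1" if "norm p \<le> 1" "norm q \<le> 1" for p q :: 'a
    proof -
      have "norm (a *\<^sub>R p + b *\<^sub>R q) \<le> a * norm p + b * norm q"
        using norm_triangle_ineq[of "a *\<^sub>R p" "b *\<^sub>R q"] ab by simp
      also have "\<dots> \<le> a * 1 + b * 1" using that ab by (intro add_mono mult_left_mono) auto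
      finally show ?thesis using ab by simp
    qed
    have "a *\<^sub>R x + b *\<^sub>R y = (a *\<^sub>R u + b *\<^sub>R u') - (a *\<^sub>R v + b *\<^sub>R v')" unfolding * by (simp add: algebra_simps)
    moreover have "a *\<^sub>R u + b *\<^sub>R u' \<in> C" "a *\<^sub>R v + b *\<^sub>R v' \<in> C" using * ab by (auto intro!: cone_add cone_scale)
    ultimately show "a *\<^sub>R x + b *\<^sub>R y \<in> signed_ball" unfolding signed_ball_def using nb * by blast
  qed
  have sym: "- x \<in> closure signed_ball" if "x \<in> closure signed_ball" for x
  proof -
    have "uminus ` signed_ball = signed_ball" 
    proof
      show *: "uminus ` signed_ball \<subseteq> signed_ball"
      proof
        fix z assume "z \<in> uminus ` signed_ball"
        then obtain u v where "z = - (u - v)" "u \<in> C" "v \<in> C" "norm u \<le> 1" "norm v \<le> 1"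
          unfolding signed_ball_def by blast
        moreover from this have "z = v - u" by simp
        ultimately show "z \<in> signed_ball" unfolding signed_ball_def by blast
      qed
      show "signed_ball \<subseteq> uminus ` signed_ball"
      proof
        fix z assume "z \<in> signed_ball"
        then have "- z \<in> signed_ball" using * by blast
        then have "- (- z) \<in> uminus ` signed_ball" by blast
        then show "z \<in> uminus ` signed_ball" by simp
      qed
    qed
    then have "(*\<^sub>R) (- 1) ` signed_ball = signed_ball" by simp
    then have "(*\<^sub>R) (- 1) ` closure signed_ball = closure signed_ball" by (metis closure_scaleR)
    moreover have "(- 1) *\<^sub>R x \<in> (*\<^sub>R) (- 1) ` closure signed_ball" using that by (rule imageI)
    ultimately show ?thesis by simp
  qed
  have scale: "closure (?A n) = (\<lambda>x. real (Suc n) *\<^sub>R x) ` closure signed_ball"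
    by (rule closure_scaleR[symmetric])
  have "ball 0 (r / real (Suc n)) \<subseteq> closure signed_ball"
  proof
    fix y :: 'a assume y: "y \<in> ball 0 (r / real (Suc n))"
    define z where "z = real (Suc n) *\<^sub>R y"
    have nz: "norm z < r" using y by (simp add: z_def field_simps del: of_nat_Suc)
    have "x + z \<in> closure (?A n)" by (rule subsetD[OF r(2)]) (use nz in \<open>simp add: dist_norm\<close>)
    then obtain p where p: "p \<in> closure signed_ball" "x + z = real (Suc n) *\<^sub>R p"
      unfolding scale by (rule imageE)
    have "x - z \<in> closure (?A n)" by (rule subsetD[OF r(2)]) (use nz in \<open>simp add: dist_norm\<close>)
    then obtain q where q: "q \<in> closure signed_ball" "x - z = real (Suc n) *\<^sub>R q"
      unfolding scale by (rule imageE)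
    \<comment> \<open>After scaling, \<open>x + z\<close> and \<open>- (x - z)\<close> have the
      midpoint \<open>z\<close>, so the unknown centre \<open>x\<close> of the ball cancels.\<close>
    have "(1/2) *\<^sub>R p + (1/2) *\<^sub>R (- q) \<in> closure signed_ball"
      by (rule convexD[OF convex_closure[OF conv] p(1) sym[OF q(1)]]) auto
    also have "(1/2) *\<^sub>R p + (1/2) *\<^sub>R (- q) = y"
    proof -
      have "real (Suc n) *\<^sub>R (p - q) = (x + z) - (x - z)"
        unfolding p(2) q(2) by (rule scaleR_diff_right)
      also have "\<dots> = 2 *\<^sub>R z" by (simp add: scaleR_2)
      also have "\<dots> = real (Suc n) *\<^sub>R (2 *\<^sub>R y)" by (simp add: z_def del: of_nat_Suc)
      finally have "p - q = 2 *\<^sub>R y" by (rule scaleR_left_imp_eq[rotated]) simp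
      then have "(1/2) *\<^sub>R (p - q) = y" by simp
      then show ?thesis by (simp add: scaleR_diff_right)
    qed
    finally show "y \<in> closure signed_ball" .
  qed
  moreover have "r / real (Suc n) > 0" using r by simp
  ultimately show ?thesis by blast
qed

text \<open>The proof is that of the open mapping theorem.\<close>

lemma bounded_decomposition:
  obtains K where "K > 0" "\<And>x. \<exists>u\<in>C. \<exists>v\<in>C. x = u - v \<and> norm u \<le> K * norm x \<and> norm v \<le> K * norm x"
proof -
  obtain r where r: "r > 0" "ball 0 r \<subseteq> closure signed_ball" using signed_ball_closure_ball by blast
  \<comment> \<open>A point at scale \<open>c\<close> is approximated by cone elements of norm at
    most \<open>c\<close> with a remainder at scale \<open>c / 2\<close>, so the approximation can
    be iterated and the norms sum geometrically.\<close>
  have step: "\<exists>u v. u \<in> C \<and> v \<in> C \<and> norm u \<le> c \<and> norm v \<le> c \<and> norm (x - (u - v)) < c * r / 2"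
    if x: "norm x < c * r" and c: "c > 0" for x c
  proof -
    have "norm (x /\<^sub>R c) < r" using x c by (simp add: field_simps)
    then have "x /\<^sub>R c \<in> closure signed_ball" using r by (auto simp: subset_iff)
    then obtain y where y: "y \<in> signed_ball" "dist y (x /\<^sub>R c) < r / 2"
      using r unfolding closure_approachable by (meson half_gt_zero)
    then obtain u v where uv: "y = u - v" "u \<in> C" "v \<in> C" "norm u \<le> 1" "norm v \<le> 1"
      unfolding signed_ball_def by blast
    have "x - (c *\<^sub>R u - c *\<^sub>R v) = c *\<^sub>R (x /\<^sub>R c - y)" using c unfolding uv(1) by (simp add: algebra_simps)
    then have "norm (x - (c *\<^sub>R u - c *\<^sub>R v)) = c * dist y (x /\<^sub>R c)"
      using c by (simp add: dist_norm norm_minus_commute)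
    also have "\<dots> < c * (r / 2)" using y c by (intro mult_strict_left_mono) auto
    finally have "norm (x - (c *\<^sub>R u - c *\<^sub>R v)) < c * r / 2" by simp
    moreover have "c *\<^sub>R u \<in> C" "c *\<^sub>R v \<in> C" using uv c by (auto intro: cone_scale)
    ultimately show ?thesis using uv c by (intro exI[of _ "c *\<^sub>R u"] exI[of _ "c *\<^sub>R v"]) (auto simp: mult_left_le)
  qed
  have unit: "\<exists>u\<in>C. \<exists>v\<in>C. x = u - v \<and> norm u \<le> 2 \<and> norm v \<le> 2" if x: "norm x < r" for x
  proof -
    define c where "c n = (1/2::real) ^ n" for n
    have c0: "c n > 0" for n by (simp add: c_def)
    have "\<forall>n y. \<exists>u v. norm y < c n * r \<longrightarrow>
        (u \<in> C \<and> v \<in> C \<and> norm u \<le> c n \<and> norm v \<le> c n \<and> norm (y - (u - v)) < c n * r / 2)"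
      using step c0 by meson
    then obtain p q where pq: "\<And>n y. norm y < c n * r \<Longrightarrow>
        (p n y \<in> C \<and> q n y \<in> C \<and> norm (p n y) \<le> c n \<and> norm (q n y) \<le> c n \<and> norm (y - (p n y - q n y)) < c n * r / 2)"
      by metis
    define y where "y = rec_nat x (\<lambda>n z. z - (p n z - q n z))"
    have y0: "y 0 = x" and yS: "y (Suc n) = y n - (p n (y n) - q n (y n))" for n by (simp_all add: y_def)
    have yn: "norm (y n) < c n * r" for n
    proof (induction n)
      case (Suc n)
      then show ?case using pq[OF Suc] by (simp add: yS c_def)
    qed (use x in \<open>simp add: y0 c_def\<close>)
    define u v where "u n = p n (y n)" and "v n = q n (y n)" for n
    have uv: "u n \<in> C" "v n \<in> C" "norm (u n) \<le> c n" "norm (v n) \<le> c n" for n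
      using pq[OF yn] by (auto simp: u_def v_def)
    have sc: "summable c" and sumc: "suminf c = 2" unfolding c_def[abs_def]
      by (auto simp: summable_geometric suminf_geometric)
    have su: "summable (\<lambda>n. norm (u n))" "summable (\<lambda>n. norm (v n))"
      using uv by (auto intro!: summable_comparison_test[OF _ sc])
    have sum_y: "(\<Sum>i<n. u i - v i) = x - y n" for n
      by (induction n) (simp_all add: y0 yS u_def v_def)
    have "(\<lambda>n. norm (y n)) \<longlonglongrightarrow> 0"
    proof (rule tendsto_sandwich[of "\<lambda>_. 0"])
      show "\<forall>\<^sub>F n in sequentially. norm (y n) \<le> c n * r" using yn less_imp_le by (intro always_eventually) blast
      show "(\<lambda>n. c n * r) \<longlonglongrightarrow> 0" using tendsto_mult_right[OF summable_LIMSEQ_zero[OF sc], of r] by (simp add: mult.commute)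
    qed auto
    then have "(\<lambda>n. x - y n) \<longlonglongrightarrow> x - 0" by (intro tendsto_diff tendsto_const) (simp add: tendsto_norm_zero_iff)
    then have "(\<lambda>n. u n - v n) sums x" unfolding sums_def sum_y by simp
    moreover have "(\<lambda>n. u n - v n) sums (suminf u - suminf v)"
      by (intro sums_diff summable_sums summable_norm_cancel[OF su(1)] summable_norm_cancel[OF su(2)])
    ultimately have x_eq: "x = suminf u - suminf v" by (rule sums_unique2)
    \<comment> \<open>Closedness of the cone is what keeps the sum of the series inside it.\<close>
    have in_C: "suminf z \<in> C" if "\<And>n. z n \<in> C" "summable (\<lambda>n. norm (z n))" for z
    proof (rule closed_sequentially[OF closed_cone])
      show "(\<lambda>n. \<Sum>i<n. z i) \<longlonglongrightarrow> suminf z" by (rule summable_LIMSEQ[OF summable_norm_cancel[OF that(2)]])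
      show "(\<Sum>i<n. z i) \<in> C" for n by (induction n) (auto intro: cone_zero cone_add that)
    qed
    have bd: "norm (suminf z) \<le> 2" if "\<And>n. norm (z n) \<le> c n" "summable (\<lambda>n. norm (z n))" for z :: "nat \<Rightarrow> 'a"
    proof -
      have "norm (suminf z) \<le> (\<Sum>n. norm (z n))" by (rule summable_norm[OF that(2)])
      also have "\<dots> \<le> suminf c" by (rule suminf_le[OF that(1) that(2) sc])
      finally show ?thesis using sumc by simp
    qed
    show ?thesis
      by (rule bexI[of _ "suminf u"], rule bexI[of _ "suminf v"]) (use x_eq uv su in_C bd in auto)
  qed
  show ?thesis
  proof (rule that[of "4 / r"])
    fix x :: 'a
    show "\<exists>u\<in>C. \<exists>v\<in>C. x = u - v \<and> norm u \<le> 4 / r * norm x \<and> norm v \<le> 4 / r * norm x"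
    proof (cases "x = 0")
      case True
      then show ?thesis using cone_zero by (intro bexI[of _ 0]) auto
    next
      case False
      \<comment> \<open>Division by \<open>a\<close> gives norm \<open>r / 2\<close>, safely below
        \<open>r\<close>; the bound 2 for unit scale then becomes
        \<open>2 a = 4 / r * norm x\<close>.\<close>
      define a where "a = 2 * norm x / r"
      have a: "a > 0" using False r by (simp add: a_def)
      have "norm (x /\<^sub>R a) = r / 2" using False r by (simp add: a_def)
      then have "norm (x /\<^sub>R a) < r" using r by simp
      from unit[OF this] obtain u v where uv: "u \<in> C" "v \<in> C" "x /\<^sub>R a = u - v" "norm u \<le> 2" "norm v \<le> 2" by blast
      have "x = a *\<^sub>R (x /\<^sub>R a)" using a by simp
      then have "x = a *\<^sub>R u - a *\<^sub>R v" unfolding uv(3) by (simp add: scaleR_diff_right)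
      moreover have "a *\<^sub>R u \<in> C" "a *\<^sub>R v \<in> C" using uv a by (auto intro: cone_scale)
      moreover have "norm (a *\<^sub>R u) \<le> 4 / r * norm x" "norm (a *\<^sub>R v) \<le> 4 / r * norm x"
      proof -
        have "a * norm z \<le> 4 / r * norm x" if "norm z \<le> 2" for z :: 'a
        proof -
          have "a * norm z \<le> a * 2" using a that by (intro mult_left_mono) auto
          then show ?thesis by (simp add: a_def)
        qed
        then show "norm (a *\<^sub>R u) \<le> 4 / r * norm x" "norm (a *\<^sub>R v) \<le> 4 / r * norm x" using uv a by auto
      qed
      ultimately show ?thesis by blast
    qed
  qed (use r in simp)
qed

end

section \<open>Focusing skew-product semiflows\<close>

locale focusing_skew_product = linear_skew_product M \<theta> U + ordered_banach_setting C
  for M :: "'w measure" and \<theta> :: "real \<Rightarrow> 'w \<Rightarrow> 'w"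
    and U :: "'w \<Rightarrow> real \<Rightarrow> ('a::{banach, second_countable_topology} \<Rightarrow>\<^sub>L 'a)"
    and C :: "'a set" +
  fixes e :: 'a and ed :: "'a \<Rightarrow>\<^sub>L real" and \<kappa> :: "'w \<Rightarrow> real"
  assumes positive: "\<omega> \<in> space M \<Longrightarrow> 0 \<le> t \<Longrightarrow> cone_le C u v \<Longrightarrow>
      cone_le C (blinfun_apply (U \<omega> t) u) (blinfun_apply (U \<omega> t) v)"
    and e_cone: "e \<in> C" and e_norm: "norm e = 1"
    and U_e: "\<omega> \<in> space M \<Longrightarrow> blinfun_apply (U \<omega> 1) e \<noteq> 0"
    and \<kappa>_measurable [measurable]: "\<kappa> \<in> borel_measurable M"
    and \<kappa>_ge_1: "\<omega> \<in> space M \<Longrightarrow> 1 \<le> \<kappa> \<omega>"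
    and focusing: "\<omega> \<in> space M \<Longrightarrow> u \<in> C \<Longrightarrow> blinfun_apply (U \<omega> 1) u \<noteq> 0 \<Longrightarrow>
      \<exists>\<beta>>0. cone_le C (\<beta> *\<^sub>R e) (blinfun_apply (U \<omega> 1) u) \<and>
             cone_le C (blinfun_apply (U \<omega> 1) u) ((\<kappa> \<omega> * \<beta>) *\<^sub>R e)"
    and ed_dual: "ed \<in> dual_cone C" and ed_e: "blinfun_apply ed e = 1"
begin

abbreviation ap :: "'w \<Rightarrow> real \<Rightarrow> 'a \<Rightarrow> 'a" where "ap \<omega> t u \<equiv> blinfun_apply (U \<omega> t) u"

lemma ap_add: "\<omega> \<in> space M \<Longrightarrow> 0 \<le> s \<Longrightarrow> 0 \<le> t \<Longrightarrow> ap (\<theta> s \<omega>) t (ap \<omega> s u) = ap \<omega> (s + t) u"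
  using cocycle_add[of \<omega> s t] by (metis add.commute blinfun_apply_blinfun_compose)

lemma ap_zero: "\<omega> \<in> space M \<Longrightarrow> ap \<omega> 0 u = u"
  by (simp add: cocycle_zero)

lemma ap_cone: "\<omega> \<in> space M \<Longrightarrow> 0 \<le> t \<Longrightarrow> u \<in> C \<Longrightarrow> ap \<omega> t u \<in> C"
  using positive[of \<omega> t 0 u] by (simp add: zero_le_iff blinfun.zero_right)

lemma ap_scale_le: "\<omega> \<in> space M \<Longrightarrow> 0 \<le> t \<Longrightarrow> m *\<^sub>R h \<preceq> v \<Longrightarrow> m *\<^sub>R ap \<omega> t h \<preceq> ap \<omega> t v"
  using positive[of \<omega> t "m *\<^sub>R h" v] by (simp add: blinfun.scaleR_right)

lemma ap_le_scale: "\<omega> \<in> space M \<Longrightarrow> 0 \<le> t \<Longrightarrow> v \<preceq> m *\<^sub>R h \<Longrightarrow> ap \<omega> t v \<preceq> m *\<^sub>R ap \<omega> t h"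
  using positive[of \<omega> t v "m *\<^sub>R h"] by (simp add: blinfun.scaleR_right)

lemma e_nonzero: "e \<noteq> 0"
  using e_norm by auto

lemma e_le_norm: "0 \<le> \<beta> \<Longrightarrow> \<beta> *\<^sub>R e \<preceq> x \<Longrightarrow> \<beta> \<le> norm x"
  using norm_mono[of "\<beta> *\<^sub>R e" x] by (simp add: cone_scale e_cone e_norm)

lemma dual_cone_mono: "f \<in> dual_cone C \<Longrightarrow> u \<preceq> v \<Longrightarrow> blinfun_apply f u \<le> blinfun_apply f v"
  by (force simp: dual_cone_def cone_le_def blinfun.diff_right)

text \<open>Allowing \<open>\<beta> = 0\<close> covers annihilated vectors, so that later estimates
  need no case distinction.\<close>

lemma focusing_weak:
  assumes "\<omega> \<in> space M" "u \<in> C"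
  obtains \<beta> where "0 \<le> \<beta>" "\<beta> *\<^sub>R e \<preceq> ap \<omega> 1 u" "ap \<omega> 1 u \<preceq> (\<kappa> \<omega> * \<beta>) *\<^sub>R e"
    "ap \<omega> 1 u \<noteq> 0 \<Longrightarrow> 0 < \<beta>"
proof (cases "ap \<omega> 1 u = 0")
  case True
  show ?thesis by (rule that[of 0]) (use True le_refl in auto)
next
  case False
  then show ?thesis using focusing[OF assms] that by (meson less_imp_le)
qed

lemma ap_e_nat: "\<omega> \<in> space M \<Longrightarrow> \<exists>\<beta>>0. \<beta> *\<^sub>R e \<preceq> ap \<omega> (real n) e"
proof (induction n)
  case 0
  then show ?case by (intro exI[of _ 1]) (simp add: ap_zero le_refl)
next
  case (Suc n)
  then obtain \<beta> where \<beta>: "\<beta> > 0" "\<beta> *\<^sub>R e \<preceq> ap \<omega> (real n) e" by blast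
  have sp: "\<theta> (real n) \<omega> \<in> space M" using Suc flow_space by blast
  obtain \<gamma> where \<gamma>: "\<gamma> > 0" "\<gamma> *\<^sub>R e \<preceq> ap (\<theta> (real n) \<omega>) 1 e"
    using focusing[OF sp e_cone U_e[OF sp]] by blast
  have "(\<beta> * \<gamma>) *\<^sub>R e \<preceq> \<beta> *\<^sub>R ap (\<theta> (real n) \<omega>) 1 e"
    using le_scale[of \<beta>, OF _ \<gamma>(2)] \<beta> by simp
  also have "\<beta> *\<^sub>R ap (\<theta> (real n) \<omega>) 1 e \<preceq> ap (\<theta> (real n) \<omega>) 1 (ap \<omega> (real n) e)"
    using ap_scale_le[OF sp _ \<beta>(2)] by simp
  ultimately have "(\<beta> * \<gamma>) *\<^sub>R e \<preceq> ap \<omega> (real (Suc n)) e"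
    using le_trans ap_add[OF Suc.prems, of "real n" 1 e] by (simp add: add.commute)
  then show ?case using \<beta> \<gamma> by (intro exI[of _ "\<beta> * \<gamma>"]) simp
qed

text \<open>If the image of \<open>e\<close> vanished at time \<open>t\<close>, it would vanish at
  every later integer time, where iterated focusing keeps it above a positive multiple of
  \<open>e\<close>.\<close>

lemma ap_e_nonzero:
  assumes \<omega>: "\<omega> \<in> space M" and t: "0 \<le> t"
  shows "ap \<omega> t e \<noteq> 0"
proof
  assume 0: "ap \<omega> t e = 0"
  obtain n :: nat where n: "t \<le> real n" using real_arch_simple by blast
  have "ap \<omega> (real n) e = ap (\<theta> t \<omega>) (real n - t) (ap \<omega> t e)"
    using ap_add[OF \<omega> t, of "real n - t"] n by simp
  then have "ap \<omega> (real n) e = 0" unfolding 0 by (simp add: blinfun.zero_right)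
  then obtain \<beta> where \<beta>: "\<beta> > 0" "\<beta> *\<^sub>R e \<preceq> 0" using ap_e_nat[OF \<omega>, of n] by auto
  then show False using e_le_norm[of \<beta> 0] by simp
qed

text \<open>Focusing is applied to the last unit of time only. The ratio of the two bounds is
  therefore governed by \<open>\<kappa>\<close> at time \<open>t - 1\<close>, whatever happened
  before.\<close>

lemma ap_ge_e:
  assumes \<omega>: "\<omega> \<in> space M" and t: "1 \<le> t" and u: "u \<in> C" "ap \<omega> t u \<noteq> 0"
  shows "\<exists>\<beta>>0. \<beta> *\<^sub>R e \<preceq> ap \<omega> t u \<and> ap \<omega> t u \<preceq> (\<kappa> (\<theta> (t - 1) \<omega>) * \<beta>) *\<^sub>R e"
proof -
  have *: "ap \<omega> t u = ap (\<theta> (t - 1) \<omega>) 1 (ap \<omega> (t - 1) u)" using ap_add[OF \<omega>, of "t - 1" 1] t by simp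
  show ?thesis unfolding * 
    by (rule focusing) (use u t \<omega> in \<open>auto intro: flow_space ap_cone simp: *[symmetric]\<close>)
qed

lemma ap_e_ge_e: "\<omega> \<in> space M \<Longrightarrow> 1 \<le> t \<Longrightarrow> \<exists>\<beta>>0. \<beta> *\<^sub>R e \<preceq> ap \<omega> t e"
  using ap_ge_e[OF _ _ e_cone] ap_e_nonzero by fastforce

section \<open>Contraction of oscillation\<close>

text \<open>One step of the cocycle contracts the oscillation of \<open>v\<close> relative to \<open>h\<close>: writing
  \<open>(M - m) h = (v - m h) + (M h - v)\<close>, focusing bounds the images of both summands below by multiples of \<open>e\<close>
  whose sum is comparable to the image of \<open>h\<close>.\<close>

lemma contraction_step:
  assumes \<omega>: "\<omega> \<in> space M" and h: "h \<in> C" "ap \<omega> 1 h \<noteq> 0"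
    and v: "m *\<^sub>R h \<preceq> v" "v \<preceq> N *\<^sub>R h" and mN: "m \<le> N"
  shows "\<exists>m' N'. m \<le> m' \<and> m' \<le> N' \<and> N' \<le> N \<and> m' *\<^sub>R ap \<omega> 1 h \<preceq> ap \<omega> 1 v \<and> ap \<omega> 1 v \<preceq> N' *\<^sub>R ap \<omega> 1 h
    \<and> N' - m' \<le> (1 - 1 / (\<kappa> \<omega>)\<^sup>2) * (N - m)"
proof -
  let ?T = "ap \<omega> 1"
  have k: "\<kappa> \<omega> \<ge> 1" using \<kappa>_ge_1[OF \<omega>] .
  obtain b where b: "0 \<le> b" "b *\<^sub>R e \<preceq> ?T (v - m *\<^sub>R h)" "?T (v - m *\<^sub>R h) \<preceq> (\<kappa> \<omega> * b) *\<^sub>R e"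
    by (rule focusing_weak[OF \<omega>, of "v - m *\<^sub>R h"]) (use v in \<open>auto simp: cone_le_def\<close>)
  obtain c where c: "0 \<le> c" "c *\<^sub>R e \<preceq> ?T (N *\<^sub>R h - v)" "?T (N *\<^sub>R h - v) \<preceq> (\<kappa> \<omega> * c) *\<^sub>R e"
    by (rule focusing_weak[OF \<omega>, of "N *\<^sub>R h - v"]) (use v in \<open>auto simp: cone_le_def\<close>)
  obtain d where d: "0 < d" "d *\<^sub>R e \<preceq> ?T h" "?T h \<preceq> (\<kappa> \<omega> * d) *\<^sub>R e"
    using focusing[OF \<omega> h] by blast
  \<comment> \<open>\<open>D\<close> bounds the image of \<open>h\<close> by a multiple of
    \<open>e\<close>, which converts lower bounds by multiples of \<open>e\<close> into lower bounds
    by multiples of that image.\<close>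
  define D where "D = \<kappa> \<omega> * d"
  have D: "D > 0" using d k by (simp add: D_def)
  have frac: "(x / D) *\<^sub>R ?T h \<preceq> x *\<^sub>R e" if "0 \<le> x" for x
    using le_scale[of "x / D", OF _ d(3)] that D unfolding D_def[symmetric] by simp
  have "(b / D) *\<^sub>R ?T h \<preceq> ?T (v - m *\<^sub>R h)" using frac[OF b(1)] b(2) le_trans by blast
  from le_add[OF this le_refl[of "m *\<^sub>R ?T h"]]
  have lo: "(m + b / D) *\<^sub>R ?T h \<preceq> ?T v"
    by (simp add: blinfun.diff_right blinfun.scaleR_right scaleR_add_left add.commute)
  have "(c / D) *\<^sub>R ?T h \<preceq> ?T (N *\<^sub>R h - v)" using frac[OF c(1)] c(2) le_trans by blast
  from le_add[OF le_minus[OF this] le_refl[of "N *\<^sub>R ?T h"]]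
  have hi: "?T v \<preceq> (N - c / D) *\<^sub>R ?T h"
    by (simp add: blinfun.diff_right blinfun.scaleR_right scaleR_diff_left)
  have "((N - m) * d) *\<^sub>R e \<preceq> (N - m) *\<^sub>R ?T h"
    using le_scale[of "N - m", OF _ d(2)] mN by simp
  also have "(N - m) *\<^sub>R ?T h = ?T (v - m *\<^sub>R h) + ?T (N *\<^sub>R h - v)"
    by (simp add: blinfun.diff_right blinfun.scaleR_right scaleR_diff_left)
  finally have "((N - m) * d) *\<^sub>R e \<preceq> (\<kappa> \<omega> * b + \<kappa> \<omega> * c) *\<^sub>R e"
    using le_add[OF b(3) c(3)] le_trans unfolding scaleR_add_left by blast
  then have ineq: "(N - m) * d \<le> \<kappa> \<omega> * b + \<kappa> \<omega> * c" using scale_le_scaleD e_cone e_nonzero by blast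
  \<comment> \<open>Focusing is used twice, on \<open>h\<close> and on the two summands. Division by
    \<open>\<kappa> D\<close>, which is \<open>\<kappa>\<close> squared times \<open>d\<close>,
    therefore produces the square in the contraction factor.\<close>
  have "(N - m) / (\<kappa> \<omega>)\<^sup>2 = ((N - m) * d) / (\<kappa> \<omega> * D)"
    using d k by (simp add: D_def power2_eq_square)
  also have "\<dots> \<le> (\<kappa> \<omega> * b + \<kappa> \<omega> * c) / (\<kappa> \<omega> * D)" using ineq D k by (intro divide_right_mono) auto
  also have "\<dots> = b / D + c / D" using k by (simp add: add_divide_distrib)
  finally have osc: "(N - c / D) - (m + b / D) \<le> (1 - 1 / (\<kappa> \<omega>)\<^sup>2) * (N - m)" by (simp add: algebra_simps)
  have "(m + b / D) *\<^sub>R ?T h \<preceq> (N - c / D) *\<^sub>R ?T h" using lo hi le_trans by blast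
  then have "m + b / D \<le> N - c / D" using scale_le_scaleD ap_cone[OF \<omega> _ h(1)] h(2) by simp
  then show ?thesis using lo hi osc b c D
    by (intro exI[of _ "m + b / D"] exI[of _ "N - c / D"]) simp
qed

definition contr :: "'w \<Rightarrow> nat \<Rightarrow> real"
  where "contr \<omega> n = (\<Prod>i<n. 1 - 1 / (\<kappa> (\<theta> (real i) \<omega>))\<^sup>2)"

lemma contr_factor: "\<omega> \<in> space M \<Longrightarrow> 0 \<le> 1 - 1 / (\<kappa> \<omega>)\<^sup>2"
  using \<kappa>_ge_1[of \<omega>] by (simp add: one_le_power)

lemma contr_nonneg: "\<omega> \<in> space M \<Longrightarrow> 0 \<le> contr \<omega> n"
  unfolding contr_def by (intro prod_nonneg contr_factor flow_space)

lemma contraction: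
  assumes \<omega>: "\<omega> \<in> space M" and h: "h \<in> C" "\<And>n. ap \<omega> (real n) h \<noteq> 0"
    and v: "m *\<^sub>R h \<preceq> v" "v \<preceq> N *\<^sub>R h" and mN: "m \<le> N"
  shows "\<exists>m' N'. m \<le> m' \<and> m' \<le> N' \<and> N' \<le> N \<and>
    m' *\<^sub>R ap \<omega> (real n) h \<preceq> ap \<omega> (real n) v \<and> ap \<omega> (real n) v \<preceq> N' *\<^sub>R ap \<omega> (real n) h
    \<and> N' - m' \<le> contr \<omega> n * (N - m)"
proof (induction n)
  case 0
  show ?case using v mN by (intro exI[of _ m] exI[of _ N]) (simp add: ap_zero[OF \<omega>] contr_def)
next
  case (Suc n)
  then obtain m' N' where *: "m \<le> m'" "m' \<le> N'" "N' \<le> N"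
    "m' *\<^sub>R ap \<omega> (real n) h \<preceq> ap \<omega> (real n) v" "ap \<omega> (real n) v \<preceq> N' *\<^sub>R ap \<omega> (real n) h"
    "N' - m' \<le> contr \<omega> n * (N - m)" by blast
  have sp: "\<theta> (real n) \<omega> \<in> space M" using \<omega> by (rule flow_space)
  have step: "ap (\<theta> (real n) \<omega>) 1 (ap \<omega> (real n) x) = ap \<omega> (real (Suc n)) x" for x
    using ap_add[OF \<omega>, of "real n" 1 x] by (simp add: add.commute)
  have "ap (\<theta> (real n) \<omega>) 1 (ap \<omega> (real n) h) \<noteq> 0" unfolding step by (rule h(2))
  from contraction_step[OF sp ap_cone[OF \<omega> _ h(1)] this *(4,5,2)]
  obtain m'' N'' where **: "m' \<le> m''" "m'' \<le> N''" "N'' \<le> N'"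
    "m'' *\<^sub>R ap \<omega> (real (Suc n)) h \<preceq> ap \<omega> (real (Suc n)) v"
    "ap \<omega> (real (Suc n)) v \<preceq> N'' *\<^sub>R ap \<omega> (real (Suc n)) h"
    "N'' - m'' \<le> (1 - 1 / (\<kappa> (\<theta> (real n) \<omega>))\<^sup>2) * (N' - m')"
    unfolding step by auto
  have "N'' - m'' \<le> (1 - 1 / (\<kappa> (\<theta> (real n) \<omega>))\<^sup>2) * (contr \<omega> n * (N - m))"
    using **(6) mult_left_mono[OF *(6) contr_factor[OF sp]] by linarith
  also have "\<dots> = contr \<omega> (Suc n) * (N - m)" by (simp add: contr_def)
  finally show ?case using * ** by (intro exI[of _ m''] exI[of _ N'']) auto
qed

text \<open>One unit of time places every vector of the space between multiples of the image of
  \<open>e\<close>: split it into cone elements of controlled norm, bound their images by multiples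
  of \<open>e\<close> through focusing, and replace \<open>e\<close> by the image of
  \<open>e\<close>, which dominates \<open>d e\<close>. From here on the contraction of oscillation
  reaches all of \<open>X\<close>, with constants linear in the norm.\<close>

lemma initial_bound:
  assumes \<omega>: "\<omega> \<in> space M"
  obtains c where "0 \<le> c" "\<And>u. (- (c * norm u)) *\<^sub>R ap \<omega> 1 e \<preceq> ap \<omega> 1 u"
    "\<And>u. ap \<omega> 1 u \<preceq> (c * norm u) *\<^sub>R ap \<omega> 1 e"
proof -
  obtain K where K: "K > 0" "\<And>x. \<exists>u\<in>C. \<exists>v\<in>C. x = u - v \<and> norm u \<le> K * norm x \<and> norm v \<le> K * norm x"
    using bounded_decomposition by metis
  obtain d where d: "0 < d" "d *\<^sub>R e \<preceq> ap \<omega> 1 e" using focusing[OF \<omega> e_cone U_e[OF \<omega>]] by blast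
  define c where "c = \<kappa> \<omega> * norm (U \<omega> 1) * K / d"
  have k: "\<kappa> \<omega> \<ge> 1" by (rule \<kappa>_ge_1[OF \<omega>])
  have c: "0 \<le> c" using k K d by (simp add: c_def)
  have he: "ap \<omega> 1 e \<in> C" by (rule ap_cone[OF \<omega> _ e_cone]) simp
  have pos: "ap \<omega> 1 p \<preceq> (c * r) *\<^sub>R ap \<omega> 1 e" if p: "p \<in> C" "norm p \<le> K * r" for p r
  proof -
    obtain b where b: "0 \<le> b" "b *\<^sub>R e \<preceq> ap \<omega> 1 p" "ap \<omega> 1 p \<preceq> (\<kappa> \<omega> * b) *\<^sub>R e"
      by (rule focusing_weak[OF \<omega> p(1)])
    have "b \<le> norm (ap \<omega> 1 p)" by (rule e_le_norm[OF b(1,2)])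
    also have "\<dots> \<le> norm (U \<omega> 1) * norm p" by (rule norm_blinfun)
    also have "\<dots> \<le> norm (U \<omega> 1) * (K * r)" using p by (intro mult_left_mono) auto
    finally have "\<kappa> \<omega> * b \<le> \<kappa> \<omega> * (norm (U \<omega> 1) * (K * r))" using k by (intro mult_left_mono) auto
    then have bc: "\<kappa> \<omega> * b / d \<le> c * r" using d by (simp add: c_def field_simps)
    have "(\<kappa> \<omega> * b) *\<^sub>R e \<preceq> (\<kappa> \<omega> * b / d) *\<^sub>R ap \<omega> 1 e"
      using le_scale[of "\<kappa> \<omega> * b / d", OF _ d(2)] d k b by simp
    also have "(\<kappa> \<omega> * b / d) *\<^sub>R ap \<omega> 1 e \<preceq> (c * r) *\<^sub>R ap \<omega> 1 e" by (rule scale_le_scale[OF bc he])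
    ultimately show ?thesis using b(3) le_trans by blast
  qed
  have upper: "ap \<omega> 1 u \<preceq> (c * norm u) *\<^sub>R ap \<omega> 1 e" for u
  proof -
    obtain p q where pq: "p \<in> C" "q \<in> C" "u = p - q" "norm p \<le> K * norm u" using K(2) by blast
    have "u \<preceq> p" using pq by (simp add: cone_le_def)
    then have "ap \<omega> 1 u \<preceq> ap \<omega> 1 p" by (intro positive \<omega>) simp
    then show ?thesis using pos[OF pq(1,4)] le_trans by blast
  qed
  have "(- (c * norm u)) *\<^sub>R ap \<omega> 1 e \<preceq> ap \<omega> 1 u" for u
    using le_minus[OF upper[of "- u"]] by (simp add: blinfun.minus_right)
  from that[OF c this upper] show ?thesis .
qed

text \<open>The first unit of time is spent on the initial bound, so the contraction starts at
  \<open>\<theta> 1 \<omega>\<close>. The initial interval has length \<open>2 c\<close> times the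
  norm of \<open>u\<close>, whence the doubled constant.\<close>

lemma forward_sandwich:
  assumes \<omega>: "\<omega> \<in> space M"
  obtains c where "0 \<le> c" "\<And>n u. \<exists>m N. \<bar>m\<bar> \<le> c * norm u \<and> m \<le> N \<and> N - m \<le> c * norm u * contr (\<theta> 1 \<omega>) n \<and>
    m *\<^sub>R ap \<omega> (real (Suc n)) e \<preceq> ap \<omega> (real (Suc n)) u \<and> ap \<omega> (real (Suc n)) u \<preceq> N *\<^sub>R ap \<omega> (real (Suc n)) e"
proof -
  obtain c where c: "0 \<le> c" "\<And>u. (- (c * norm u)) *\<^sub>R ap \<omega> 1 e \<preceq> ap \<omega> 1 u"
    "\<And>u. ap \<omega> 1 u \<preceq> (c * norm u) *\<^sub>R ap \<omega> 1 e" using initial_bound[OF \<omega>] by blast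
  have sp: "\<theta> 1 \<omega> \<in> space M" using \<omega> by (rule flow_space)
  have step: "ap (\<theta> 1 \<omega>) (real n) (ap \<omega> 1 x) = ap \<omega> (real (Suc n)) x" for n x
    using ap_add[OF \<omega>, of 1 "real n" x] by (simp add: add.commute)
  show ?thesis
  proof (rule that[of "2 * c"])
    fix n and u :: 'a
    have he: "ap \<omega> 1 e \<in> C" by (rule ap_cone[OF \<omega> _ e_cone]) simp
    have nz: "ap (\<theta> 1 \<omega>) (real n) (ap \<omega> 1 e) \<noteq> 0" for n
      unfolding step by (rule ap_e_nonzero[OF \<omega>]) simp
    have cc: "- (c * norm u) \<le> c * norm u" using c(1) by simp
    from contraction[OF sp he nz c(2)[of u] c(3)[of u] cc, of n]
    obtain m N where mN: "- (c * norm u) \<le> m" "m \<le> N" "N \<le> c * norm u"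
      "m *\<^sub>R ap \<omega> (real (Suc n)) e \<preceq> ap \<omega> (real (Suc n)) u" "ap \<omega> (real (Suc n)) u \<preceq> N *\<^sub>R ap \<omega> (real (Suc n)) e"
      "N - m \<le> contr (\<theta> 1 \<omega>) n * (c * norm u - - (c * norm u))"
      unfolding step by blast
    have "\<bar>m\<bar> \<le> 2 * c * norm u" 
    proof -
      have "0 \<le> c * norm u" using c(1) by simp
      then show ?thesis using mN(1-3) by simp
    qed
    with mN show "\<exists>m N. \<bar>m\<bar> \<le> 2 * c * norm u \<and> m \<le> N \<and> N - m \<le> 2 * c * norm u * contr (\<theta> 1 \<omega>) n \<and>
      m *\<^sub>R ap \<omega> (real (Suc n)) e \<preceq> ap \<omega> (real (Suc n)) u \<and> ap \<omega> (real (Suc n)) u \<preceq> N *\<^sub>R ap \<omega> (real (Suc n)) e"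
      by (intro exI[of _ m] exI[of _ N]) (auto simp: algebra_simps)
  qed (use c in simp)
qed

section \<open>Existence of the limits defining the two principal directions\<close>

lemma ed_pos:
  assumes \<omega>: "\<omega> \<in> space M" and t: "1 \<le> t"
  shows "0 < blinfun_apply ed (ap \<omega> t e)"
proof -
  obtain \<beta> where \<beta>: "\<beta> > 0" "\<beta> *\<^sub>R e \<preceq> ap \<omega> t e" using ap_e_ge_e[OF \<omega> t] by blast
  have "\<beta> = blinfun_apply ed (\<beta> *\<^sub>R e)" by (simp add: blinfun.scaleR_right ed_e)
  also have "\<dots> \<le> blinfun_apply ed (ap \<omega> t e)" by (rule dual_cone_mono[OF ed_dual \<beta>(2)])
  finally show ?thesis using \<beta> by simp
qed

text \<open>The two time shifts cancel: the dual direction at \<open>\<omega>\<close> is governed by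
  the future cocycle from \<open>\<omega>\<close> itself, just as \<open>w\<close> is governed by
  the past.\<close>

lemma dual_pullback_eq:
  "\<omega> \<in> space M \<Longrightarrow> dual_pullback_direction \<theta> U f \<omega> s = (f o\<^sub>L U \<omega> s) /\<^sub>R norm (f o\<^sub>L U \<omega> s)"
  by (simp add: dual_pullback_direction_def dual_cocycle_def flow_flow flow_zero Let_def)

text \<open>The sandwich at time \<open>n + 1\<close> persists under further evolution, so every
  later value of the functional at \<open>u\<close> lies in an interval of length at most
  \<open>c * norm u * contr (\<theta> 1 \<omega>) n\<close>. Linearity in \<open>norm u\<close>
  makes this a Cauchy estimate in the dual norm. If the limit vanishes at \<open>u\<close>, the
  interval contains 0, so both its ends are small and \<open>u\<close> decays relative to
  \<open>e\<close>.\<close>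

lemma dual_limit_exists:
  assumes \<omega>: "\<omega> \<in> space M" and lim: "contr (\<theta> 1 \<omega>) \<longlonglongrightarrow> 0"
  shows "\<exists>f c. (dual_pullback_direction \<theta> U ed \<omega> \<longlongrightarrow> f) at_top \<and> f \<in> dual_cone C \<and> blinfun_apply f e > 0 \<and> 0 \<le> c \<and>
    (\<forall>n u. blinfun_apply f u = 0 \<longrightarrow>
      norm (ap \<omega> (real (Suc n)) u) \<le> c * norm u * contr (\<theta> 1 \<omega>) n * norm (ap \<omega> (real (Suc n)) e))"
proof -
  obtain c where c: "0 \<le> c" "\<And>n u. \<exists>m N. \<bar>m\<bar> \<le> c * norm u \<and> m \<le> N \<and> N - m \<le> c * norm u * contr (\<theta> 1 \<omega>) n \<and>
    m *\<^sub>R ap \<omega> (real (Suc n)) e \<preceq> ap \<omega> (real (Suc n)) u \<and> ap \<omega> (real (Suc n)) u \<preceq> N *\<^sub>R ap \<omega> (real (Suc n)) e"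
    using forward_sandwich[OF \<omega>] by blast
  have sp: "\<theta> 1 \<omega> \<in> space M" using \<omega> by (rule flow_space)
  define L where "L s = ed o\<^sub>L U \<omega> s" for s
  \<comment> \<open>Normalising by the value at \<open>e\<close> instead of the norm turns the order
    sandwich directly into numerical bounds; the norm is normalised only after the limit has been
    taken.\<close>
  define g where "g s = L s /\<^sub>R blinfun_apply (L s) e" for s
  have L_app: "blinfun_apply (L s) u = blinfun_apply ed (ap \<omega> s u)" for s u by (simp add: L_def)
  have Le: "blinfun_apply (L s) e > 0" if "1 \<le> s" for s unfolding L_app by (rule ed_pos[OF \<omega> that])
  have g_e: "blinfun_apply (g s) e = 1" if "1 \<le> s" for s
    using Le[OF that] by (simp add: g_def blinfun.scaleR_left)
  have between: "m \<le> blinfun_apply (g s) u \<and> blinfun_apply (g s) u \<le> N"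
    if mN: "m *\<^sub>R ap \<omega> (real (Suc n)) e \<preceq> ap \<omega> (real (Suc n)) u" "ap \<omega> (real (Suc n)) u \<preceq> N *\<^sub>R ap \<omega> (real (Suc n)) e"
      and s: "real (Suc n) \<le> s" for m N n u s
  proof -
    have sp: "\<theta> (real (Suc n)) \<omega> \<in> space M" using \<omega> by (rule flow_space)
    have step: "ap (\<theta> (real (Suc n)) \<omega>) (s - real (Suc n)) (ap \<omega> (real (Suc n)) x) = ap \<omega> s x" for x
      using ap_add[OF \<omega>, of "real (Suc n)" "s - real (Suc n)" x] s by simp
    have "m *\<^sub>R ap \<omega> s e \<preceq> ap \<omega> s u" "ap \<omega> s u \<preceq> N *\<^sub>R ap \<omega> s e"
      using ap_scale_le[OF sp _ mN(1), of "s - real (Suc n)"] ap_le_scale[OF sp _ mN(2), of "s - real (Suc n)"] s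
      unfolding step by auto
    then have "m * blinfun_apply (L s) e \<le> blinfun_apply (L s) u" "blinfun_apply (L s) u \<le> N * blinfun_apply (L s) e"
      unfolding L_app using dual_cone_mono[OF ed_dual] by (fastforce simp: blinfun.scaleR_right)+
    moreover have "0 < blinfun_apply (L s) e" using s by (intro Le) simp
    ultimately show ?thesis by (simp add: g_def blinfun.scaleR_left field_simps)
  qed
  have osc: "norm (g s - g (real (Suc n))) \<le> c * contr (\<theta> 1 \<omega>) n" if s: "real (Suc n) \<le> s" for s n
  proof (rule norm_blinfun_bound)
    show "0 \<le> c * contr (\<theta> 1 \<omega>) n" using c(1) contr_nonneg[OF sp] by simp
    fix u
    obtain m N where mN: "N - m \<le> c * norm u * contr (\<theta> 1 \<omega>) n"
      "m *\<^sub>R ap \<omega> (real (Suc n)) e \<preceq> ap \<omega> (real (Suc n)) u" "ap \<omega> (real (Suc n)) u \<preceq> N *\<^sub>R ap \<omega> (real (Suc n)) e"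
      using c(2) by blast
    show "norm (blinfun_apply (g s - g (real (Suc n))) u) \<le> c * contr (\<theta> 1 \<omega>) n * norm u"
      using between[OF mN(2,3) s] between[OF mN(2,3) order_refl] mN(1)
      by (simp add: blinfun.diff_left abs_le_iff algebra_simps)
  qed
  have lim': "(\<lambda>n. c * contr (\<theta> 1 \<omega>) n) \<longlonglongrightarrow> 0" using tendsto_mult_left[OF lim, of c] by simp
  have "\<exists>f. (g \<longlongrightarrow> f) at_top"
  proof (rule Cauchy_at_top_convergent)
    fix \<epsilon> :: real assume "0 < \<epsilon>"
    then have "\<forall>\<^sub>F n in sequentially. c * contr (\<theta> 1 \<omega>) n < \<epsilon>" using order_tendstoD(2)[OF lim'] by blast
    then obtain n where "c * contr (\<theta> 1 \<omega>) n < \<epsilon>" by (auto simp: eventually_sequentially)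
    then show "\<exists>N. \<forall>s\<ge>N. norm (g s - g N) \<le> \<epsilon>" using osc by (intro exI[of _ "real (Suc n)"]) force
  qed
  then obtain f where f: "(g \<longlongrightarrow> f) at_top" by blast
  have f_app: "((\<lambda>s. blinfun_apply (g s) u) \<longlongrightarrow> blinfun_apply f u) at_top" for u
    using f by (intro tendsto_intros)
  have f_e: "blinfun_apply f e = 1"
  proof (rule tendsto_unique[OF _ f_app])
    show "((\<lambda>s. blinfun_apply (g s) e) \<longlongrightarrow> 1) at_top"
      by (rule tendsto_eventually, rule eventually_mono[OF eventually_ge_at_top[of 1]], rule g_e)
  qed simp
  have f_dual: "f \<in> dual_cone C"
  proof -
    have "0 \<le> blinfun_apply f u" if u: "u \<in> C" for u
    proof (rule tendsto_lowerbound[OF f_app])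
      show "\<forall>\<^sub>F s in at_top. 0 \<le> blinfun_apply (g s) u"
        using eventually_ge_at_top[of 1]
      proof eventually_elim
        case (elim s)
        have "0 \<le> blinfun_apply (L s) u" unfolding L_app
          using ap_cone[OF \<omega> _ u, of s] ed_dual elim by (auto simp: dual_cone_def)
        then show ?case using Le[OF elim] by (simp add: g_def blinfun.scaleR_left)
      qed
    qed simp
    then show ?thesis by (simp add: dual_cone_def)
  qed
  have f_decay: "norm (ap \<omega> (real (Suc n)) u) \<le> (3 * c) * norm u * contr (\<theta> 1 \<omega>) n * norm (ap \<omega> (real (Suc n)) e)"
    if u: "blinfun_apply f u = 0" for n u
  proof -
    obtain m N where mN: "N - m \<le> c * norm u * contr (\<theta> 1 \<omega>) n"
      "m *\<^sub>R ap \<omega> (real (Suc n)) e \<preceq> ap \<omega> (real (Suc n)) u" "ap \<omega> (real (Suc n)) u \<preceq> N *\<^sub>R ap \<omega> (real (Suc n)) e"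
      using c(2) by blast
    have ev: "\<forall>\<^sub>F s in at_top. m \<le> blinfun_apply (g s) u \<and> blinfun_apply (g s) u \<le> N"
      using eventually_ge_at_top[of "real (Suc n)"] by eventually_elim (rule between[OF mN(2,3)])
    \<comment> \<open>The limit value 0 lies between \<open>m\<close> and \<open>N\<close>, so the
      length of the interval bounds both ends in absolute value.\<close>
    have "m \<le> 0"
      unfolding u[symmetric] by (rule tendsto_lowerbound[OF f_app eventually_mono[OF ev]]) auto
    moreover have "0 \<le> N"
      unfolding u[symmetric] by (rule tendsto_upperbound[OF f_app eventually_mono[OF ev]]) auto
    moreover define d where "d = c * norm u * contr (\<theta> 1 \<omega>) n"
    ultimately have d: "- d \<le> m" "N \<le> d" "0 \<le> d" using mN(1) by auto
    have he: "ap \<omega> (real (Suc n)) e \<in> C" by (rule ap_cone[OF \<omega> _ e_cone]) simp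
    have "norm (ap \<omega> (real (Suc n)) u) \<le> 3 * d * norm (ap \<omega> (real (Suc n)) e)"
    proof (rule norm_le_if_between[OF _ _ he d(3)])
      show "(- d) *\<^sub>R ap \<omega> (real (Suc n)) e \<preceq> ap \<omega> (real (Suc n)) u"
        using scale_le_scale[OF d(1) he] mN(2) le_trans by blast
      show "ap \<omega> (real (Suc n)) u \<preceq> d *\<^sub>R ap \<omega> (real (Suc n)) e"
        using scale_le_scale[OF d(2) he] mN(3) le_trans by blast
    qed
    then show ?thesis by (simp add: d_def mult.assoc)
  qed
  have f0: "f \<noteq> 0" using f_e by auto
  define F where "F = f /\<^sub>R norm f"
  have "((\<lambda>s. g s /\<^sub>R norm (g s)) \<longlongrightarrow> F) at_top"
    unfolding F_def using f f0 by (intro tendsto_intros) auto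
  moreover have "\<forall>\<^sub>F s in at_top. g s /\<^sub>R norm (g s) = dual_pullback_direction \<theta> U ed \<omega> s"
    using eventually_ge_at_top[of 1]
  proof eventually_elim
    case (elim s)
    then show ?case using Le[OF elim] unfolding dual_pullback_eq[OF \<omega>] L_def[symmetric] by (simp add: g_def)
  qed
  ultimately have "(dual_pullback_direction \<theta> U ed \<omega> \<longlongrightarrow> F) at_top"
    by (rule Lim_transform_eventually)
  moreover have "F \<in> dual_cone C" using f_dual by (simp add: F_def dual_cone_def blinfun.scaleR_left)
  moreover have "blinfun_apply F e > 0" using f0 by (simp add: F_def blinfun.scaleR_left f_e)
  moreover have "blinfun_apply F u = 0 \<longleftrightarrow> blinfun_apply f u = 0" for u using f0 by (simp add: F_def blinfun.scaleR_left)
  ultimately show ?thesis using f_decay c(1) by (intro exI[of _ F] exI[of _ "3 * c"]) auto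
qed

lemma pullback_eq: "pullback_direction \<theta> U e \<omega> s = ap (\<theta> (- s) \<omega>) s e /\<^sub>R norm (ap (\<theta> (- s) \<omega>) s e)"
  by (simp add: pullback_direction_def Let_def)

text \<open>Starting from \<open>e\<close> at time \<open>- s\<close>, the state at time
  \<open>- n\<close> is comparable to \<open>e\<close> with ratio \<open>\<kappa>\<close> at time
  \<open>- (n + 1)\<close>, however large \<open>s\<close> is. The remaining \<open>n\<close> steps
  contract this ratio towards 1. As \<open>\<kappa>\<close> may be unbounded along the past, only
  those \<open>n\<close> are used at which it is at most \<open>K\<close>, and infinitely many of
  them exist.\<close>

lemma limit_exists:
  assumes \<omega>: "\<omega> \<in> space M" and lim: "(\<lambda>n. contr (\<theta> (- real n) \<omega>) n) \<longlonglongrightarrow> 0"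
    and K: "\<exists>\<^sub>F n in sequentially. \<kappa> (\<theta> (- real (Suc n)) \<omega>) \<le> K"
  shows "\<exists>x. (pullback_direction \<theta> U e \<omega> \<longlongrightarrow> x) at_top"
proof (rule Cauchy_at_top_convergent)
  let ?pb = "pullback_direction \<theta> U e \<omega>"
  obtain n0 where "\<kappa> (\<theta> (- real (Suc n0)) \<omega>) \<le> K" using K frequently_ex by blast
  then have K1: "1 \<le> K" using \<kappa>_ge_1[OF flow_space[OF \<omega>], of "- real (Suc n0)"] by linarith
  have key: "norm (?pb s - ?pb (real n)) \<le> 2 * (K - 1) * contr (\<theta> (- real n) \<omega>) n"
    if n: "\<kappa> (\<theta> (- real (Suc n)) \<omega>) \<le> K" and s: "real (Suc n) \<le> s" for n s
  proof -
    have sp: "\<theta> t \<omega> \<in> space M" for t using \<omega> by (rule flow_space)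
    define v where "v = ap (\<theta> (- s) \<omega>) (s - real n) e"
    have "ap (\<theta> (- s) \<omega>) (s - real n) e \<noteq> 0" by (rule ap_e_nonzero[OF sp]) (use s in simp)
    from ap_ge_e[OF sp _ e_cone this]
    obtain b where b: "b > 0" "b *\<^sub>R e \<preceq> v" "v \<preceq> (\<kappa> (\<theta> (- real (Suc n)) \<omega>) * b) *\<^sub>R e"
      using s by (auto simp: flow_flow[OF \<omega>] v_def algebra_simps)
    \<comment> \<open>Rescaled in this way the state lies between \<open>e\<close> and
      \<open>K e\<close>, so the contraction starts from an oscillation of \<open>K - 1\<close>,
      independent of \<open>s\<close>.\<close>
    define y where "y = v /\<^sub>R b"
    have y: "1 *\<^sub>R e \<preceq> y" "y \<preceq> K *\<^sub>R e"
    proof -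
      show "1 *\<^sub>R e \<preceq> y" using le_scale[of "inverse b", OF _ b(2)] b(1) by (simp add: y_def)
      have "y \<preceq> \<kappa> (\<theta> (- real (Suc n)) \<omega>) *\<^sub>R e"
      proof -
        have "inverse b *\<^sub>R ((\<kappa> (\<theta> (- real (Suc n)) \<omega>) * b) *\<^sub>R e) = \<kappa> (\<theta> (- real (Suc n)) \<omega>) *\<^sub>R e"
          using b(1) by simp
        then show ?thesis using le_scale[of "inverse b", OF _ b(3)] b(1) unfolding y_def by (metis inverse_nonnegative_iff_nonnegative less_imp_le)
      qed
      then show "y \<preceq> K *\<^sub>R e" using scale_le_scale[OF n e_cone] le_trans by blast
    qed
    let ?h = "ap (\<theta> (- real n) \<omega>) (real n) e" and ?x = "ap (\<theta> (- real n) \<omega>) (real n) y"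
    obtain m N where mN: "1 \<le> m" "m \<le> N" "N \<le> K" "m *\<^sub>R ?h \<preceq> ?x" "?x \<preceq> N *\<^sub>R ?h"
      "N - m \<le> contr (\<theta> (- real n) \<omega>) n * (K - 1)"
      using contraction[OF sp[of "- real n"] e_cone ap_e_nonzero[OF sp of_nat_0_le_iff] y K1, of n] by blast
    have h0: "?h \<noteq> 0" by (rule ap_e_nonzero[OF sp]) simp
    have h: "?h \<in> C" by (rule ap_cone[OF sp _ e_cone]) simp
    have xv: "b *\<^sub>R ?x = ap (\<theta> (- s) \<omega>) s e"
    proof -
      have "ap (\<theta> (- s) \<omega>) s e = ap (\<theta> (s - real n) (\<theta> (- s) \<omega>)) (real n) v"
        unfolding v_def using ap_add[OF sp, of "s - real n" "real n" "- s" e] s by simp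
      also have "\<theta> (s - real n) (\<theta> (- s) \<omega>) = \<theta> (- real n) \<omega>" by (simp add: flow_flow[OF \<omega>])
      finally show ?thesis using b(1) by (simp add: y_def blinfun.scaleR_right)
    qed
    have x0: "?x \<noteq> 0"
    proof
      assume "?x = 0"
      then have "ap (\<theta> (- s) \<omega>) s e = 0" using xv by simp
      then show False using ap_e_nonzero[OF sp, of s] s by simp
    qed
    have diff: "norm (?x - m *\<^sub>R ?h) \<le> (N - m) * norm ?h"
    proof -
      have "?x - m *\<^sub>R ?h \<in> C" using mN(4) by (simp add: cone_le_def)
      moreover have "?x - m *\<^sub>R ?h \<preceq> (N - m) *\<^sub>R ?h" using mN(5) by (simp add: cone_le_def algebra_simps)
      ultimately have "norm (?x - m *\<^sub>R ?h) \<le> norm ((N - m) *\<^sub>R ?h)" by (rule norm_mono)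
      then show ?thesis using mN(2) by simp
    qed
    have pb_s: "?pb s = ?x /\<^sub>R norm ?x" unfolding pullback_eq xv[symmetric] using b(1) by simp
    have pb_n: "?pb (real n) = (m *\<^sub>R ?h) /\<^sub>R norm (m *\<^sub>R ?h)" unfolding pullback_eq using mN(1) by simp
    have "norm (?pb s - ?pb (real n)) \<le> 2 * norm (?x - m *\<^sub>R ?h) / norm (m *\<^sub>R ?h)"
      unfolding pb_s pb_n by (rule norm_diff_normalized_le) (use x0 h0 mN(1) in auto)
    also have "\<dots> \<le> 2 * ((N - m) * norm ?h) / norm (m *\<^sub>R ?h)"
      using diff by (intro divide_right_mono mult_left_mono) auto
    also have "\<dots> = 2 * ((N - m) / m)" using h0 mN(1) by simp
    \<comment> \<open>The lower end never falls below its initial value 1, so dividing by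
      \<open>m\<close> does no harm.\<close>
    also have "(N - m) / m \<le> N - m" using mN(1,2) by (simp add: divide_le_eq mult_le_cancel_left1)
    also have "N - m \<le> contr (\<theta> (- real n) \<omega>) n * (K - 1)" by (rule mN(6))
    finally show ?thesis by (simp only: mult_ac)
  qed
  fix \<epsilon> :: real assume \<epsilon>: "0 < \<epsilon>"
  have "(\<lambda>n. 2 * (K - 1) * contr (\<theta> (- real n) \<omega>) n) \<longlonglongrightarrow> 2 * (K - 1) * 0"
    by (rule tendsto_mult_left[OF lim])
  moreover have "2 * (K - 1) * 0 < \<epsilon> / 2" using \<epsilon> by simp
  ultimately have ev: "\<forall>\<^sub>F n in sequentially. 2 * (K - 1) * contr (\<theta> (- real n) \<omega>) n < \<epsilon> / 2"
    by (rule order_tendstoD(2))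
  obtain n where n: "\<kappa> (\<theta> (- real (Suc n)) \<omega>) \<le> K" "2 * (K - 1) * contr (\<theta> (- real n) \<omega>) n < \<epsilon> / 2"
    using frequently_ex[OF frequently_eventually_frequently[OF K ev]] by (elim exE conjE) (rule that)
  show "\<exists>N. \<forall>s\<ge>N. norm (?pb s - ?pb N) \<le> \<epsilon>"
  \<comment> \<open>The estimate is valid from time \<open>n + 1\<close> on only, so both values are
    compared with the one at time \<open>n\<close>.\<close>
  proof (intro exI[of _ "real (Suc n)"] allI impI)
    fix s assume s: "real (Suc n) \<le> s"
    have "norm (?pb s - ?pb (real n)) \<le> \<epsilon> / 2" "norm (?pb (real (Suc n)) - ?pb (real n)) \<le> \<epsilon> / 2"
      using key[OF n(1) s] key[OF n(1) order_refl] n(2) by linarith+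
    then show "norm (?pb s - ?pb (real (Suc n))) \<le> \<epsilon>"
      using norm_triangle_ineq4[of "?pb s - ?pb (real n)" "?pb (real (Suc n)) - ?pb (real n)"] by simp
  qed
qed

end

text \<open>Every time with \<open>k\<close> at most \<open>K\<close> contributes a factor of at
  most \<open>q < 1\<close>, the other factors are at most 1, and at least half of the times are of
  the first kind.\<close>

lemma prod_contraction_decay:
  fixes k :: "nat \<Rightarrow> real"
  assumes k: "\<And>i. 1 \<le> k i" and K: "\<And>n. real (card {i. i < n \<and> K < k i}) \<le> real n / 2"
  shows "\<exists>a>0. \<forall>n. (\<Prod>i<n. 1 - 1 / (k i)\<^sup>2) \<le> exp (- a * real n)"
proof -
  \<comment> \<open>The maximum with 2 keeps \<open>q\<close> strictly positive, so that
    \<open>ln q\<close> is available for the rate \<open>a = - ln q / 2\<close>.\<close>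
  define q where "q = 1 - 1 / (max K 2)\<^sup>2"
  have K2: "(max K 2)\<^sup>2 \<ge> 4" using power_mono[of 2 "max K 2" 2] by simp
  then have "1 / (max K 2)\<^sup>2 \<le> 1 / 4" by (intro divide_left_mono) auto
  moreover have "0 < 1 / (max K 2)\<^sup>2" using K2 by (intro divide_pos_pos) auto
  ultimately have q: "0 < q" "q < 1" by (auto simp: q_def)
  define a where "a = - ln q / 2"
  have a: "a > 0" using q by (simp add: a_def)
  have "(\<Prod>i<n. 1 - 1 / (k i)\<^sup>2) \<le> exp (- a * real n)" for n
  proof -
    have "(\<Prod>i<n. 1 - 1 / (k i)\<^sup>2) \<le> (\<Prod>i<n. if K < k i then 1 else q)"
    proof (rule prod_mono)
      fix i
      have k1: "1 \<le> (k i)\<^sup>2" using k[of i] by (simp add: one_le_power)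
      then have "1 / (k i)\<^sup>2 \<le> 1" by (subst divide_le_eq_1_pos) auto
      moreover have "1 - 1 / (k i)\<^sup>2 \<le> q" if "\<not> K < k i"
      proof -
        have "(k i)\<^sup>2 \<le> (max K 2)\<^sup>2" using that k[of i] by (intro power_mono) auto
        then have "1 / (max K 2)\<^sup>2 \<le> 1 / (k i)\<^sup>2" using k1 by (intro divide_left_mono mult_pos_pos) auto
        then show ?thesis by (simp add: q_def)
      qed
      ultimately show "0 \<le> 1 - 1 / (k i)\<^sup>2 \<and> 1 - 1 / (k i)\<^sup>2 \<le> (if K < k i then 1 else q)" by auto
    qed
    also have "\<dots> = q ^ card {i. i < n \<and> \<not> K < k i}"
      by (simp add: prod.If_cases Int_def)
    also have "\<dots> = exp (ln q * real (card {i. i < n \<and> \<not> K < k i}))"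
      using q by (simp add: exp_of_nat2_mult)
    also have "\<dots> \<le> exp (- a * real n)"
    proof -
      have "card {i. i < n \<and> K < k i} + card {i. i < n \<and> \<not> K < k i} = card ({i. i < n \<and> K < k i} \<union> {i. i < n \<and> \<not> K < k i})"
        by (rule card_Un_disjoint[symmetric]) auto
      also have "{i. i < n \<and> K < k i} \<union> {i. i < n \<and> \<not> K < k i} = {..<n}" by auto
      finally have "real (card {i. i < n \<and> K < k i}) + real (card {i. i < n \<and> \<not> K < k i}) = real n"
        by (simp flip: of_nat_add)
      then have "real n / 2 \<le> real (card {i. i < n \<and> \<not> K < k i})" using K[of n] by linarith
      then have "ln q * real (card {i. i < n \<and> \<not> K < k i}) \<le> ln q * (real n / 2)"
        using q by (intro mult_left_mono_neg) auto
      then show ?thesis by (simp add: a_def)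
    qed
    finally show ?thesis .
  qed
  with a show ?thesis by blast
qed

lemma exp_decay_tendsto_0:
  fixes a :: real
  assumes "0 < a"
  shows "(\<lambda>n::nat. exp (- a * real n)) \<longlonglongrightarrow> 0"
proof -
  have "(\<lambda>n::nat. exp (- a) ^ n) \<longlonglongrightarrow> 0" using assms by (intro LIMSEQ_power_zero) simp
  then show ?thesis by (simp add: exp_of_nat2_mult[symmetric])
qed

lemma tendsto_at_top_shiftD:
  fixes g :: "real \<Rightarrow> 'b::metric_space"
  assumes "((\<lambda>s. g (r + s)) \<longlongrightarrow> l) at_top"
  shows "(g \<longlongrightarrow> l) at_top"
proof (rule tendstoI)
  fix \<epsilon> :: real assume "0 < \<epsilon>"
  from tendstoD[OF assms this] have "\<forall>\<^sub>F s in at_top. dist (g (r + s)) l < \<epsilon>" .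
  from eventually_at_top_shift[OF this, of "- r"] show "\<forall>\<^sub>F s in at_top. dist (g s) l < \<epsilon>" by simp
qed

lemma normalize_scale:
  fixes x :: "'b::real_normed_vector"
  assumes "0 < c"
  shows "(c *\<^sub>R x) /\<^sub>R norm (c *\<^sub>R x) = x /\<^sub>R norm x"
  using assms by simp

section \<open>Measurability of operator norms and of functional-valued maps\<close>

lemma countable_dense_closure:
  obtains S :: "'a::second_countable_topology set" where "countable S" "closure S = UNIV"
proof -
  obtain S :: "'a set" where S: "countable S" "\<And>X. open X \<Longrightarrow> X \<noteq> {} \<Longrightarrow> \<exists>d\<in>S. d \<in> X"
    by (rule countable_dense_setE) blast
  have "x \<in> closure S" for x
    using S(2) by (force simp: closure_iff_nhds_not_empty)
  then show ?thesis using S(1) that by blast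
qed

text \<open>A bound on the operator norm is a closed condition on the tested vector, so testing it
  on a countable dense set suffices and the sublevel sets of the norm are countable
  intersections.\<close>

lemma norm_blinfun_measurable:
  fixes h :: "'w \<Rightarrow> ('a::{real_normed_vector, second_countable_topology} \<Rightarrow>\<^sub>L 'b::real_normed_vector)"
  assumes h: "\<And>u. (\<lambda>\<omega>. norm (blinfun_apply (h \<omega>) u)) \<in> borel_measurable N"
  shows "(\<lambda>\<omega>. norm (h \<omega>)) \<in> borel_measurable N"
proof -
  obtain S :: "'a set" where S: "countable S" and cl: "closure S = UNIV"
    by (rule countable_dense_closure)
  have iff: "norm (h \<omega>) \<le> a \<longleftrightarrow> 0 \<le> a \<and> (\<forall>d\<in>S. norm (blinfun_apply (h \<omega>) d) \<le> a * norm d)" for a \<omega>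
  proof safe
    assume *: "norm (h \<omega>) \<le> a"
    then show "0 \<le> a" using norm_ge_zero order_trans by blast
    fix d
    show "norm (blinfun_apply (h \<omega>) d) \<le> a * norm d"
      using norm_blinfun[of "h \<omega>" d] mult_right_mono[OF * norm_ge_zero[of d]] by linarith
  next
    assume a: "0 \<le> a" and *: "\<forall>d\<in>S. norm (blinfun_apply (h \<omega>) d) \<le> a * norm d"
    have "closed {x. norm (blinfun_apply (h \<omega>) x) \<le> a * norm x}"
      by (intro closed_Collect_le continuous_intros)
    then have "closure S \<subseteq> {x. norm (blinfun_apply (h \<omega>) x) \<le> a * norm x}"
      by (intro closure_minimal) (use * in auto)
    then show "norm (h \<omega>) \<le> a" using a unfolding cl by (intro norm_blinfun_bound) auto
  qed
  show ?thesis
  proof (rule borel_measurableI_le)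
    fix a
    have "{\<omega>\<in>space N. 0 \<le> a \<and> (\<forall>d\<in>S. norm (blinfun_apply (h \<omega>) d) \<le> a * norm d)} \<in> sets N"
      by (intro sets.sets_Collect_conj sets.sets_Collect_const sets.sets_Collect_countable_All'[OF _ S] borel_measurable_le h) auto
    then show "{\<omega>\<in>space N. norm (h \<omega>) \<le> a} \<in> sets N" unfolding iff .
  qed
qed

context focusing_skew_product begin

lemma ap_measurable:
  assumes v [measurable]: "v \<in> borel_measurable N" and \<phi> [measurable]: "\<phi> \<in> N \<rightarrow>\<^sub>M M" and t: "0 \<le> t"
  shows "(\<lambda>\<omega>. ap (\<phi> \<omega>) t (v \<omega>)) \<in> borel_measurable N"
proof -
  have "(\<lambda>\<omega>. (t, \<phi> \<omega>, v \<omega>)) \<in> N \<rightarrow>\<^sub>M restrict_space borel {0..} \<Otimes>\<^sub>M (M \<Otimes>\<^sub>M borel)"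
    using t by (intro measurable_Pair measurable_const v \<phi>) (simp add: space_restrict_space)
  from measurable_compose[OF this cocycle_measurable] show ?thesis by simp
qed

text \<open>Pettis' argument: pointwise measurability makes the distance to each fixed functional
  measurable, and separability of the dual writes every open set as a countable union of
  balls.\<close>

lemma functional_measurable:
  fixes h :: "'v \<Rightarrow> ('a \<Rightarrow>\<^sub>L real)"
  assumes h: "\<And>u. (\<lambda>\<omega>. blinfun_apply (h \<omega>) u) \<in> borel_measurable N"
  shows "h \<in> borel_measurable N"
proof (rule borel_measurableI)
  fix S :: "('a \<Rightarrow>\<^sub>L real) set" assume S: "open S"
  obtain A where A: "countable A" "closure A = (UNIV :: ('a \<Rightarrow>\<^sub>L real) set)"
    using separable_dual unfolding separable_space_def by auto
  let ?I = "{(b, r). b \<in> A \<and> r \<in> \<rat> \<and> ball b r \<subseteq> S}"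
  have I: "countable ?I"
    by (rule countable_subset[of _ "A \<times> \<rat>"]) (auto intro: A countable_rat)
  have S_eq: "S = (\<Union>(b, r)\<in>?I. ball b r)"
  proof
    show "S \<subseteq> (\<Union>(b, r)\<in>?I. ball b r)"
    proof
      fix x assume "x \<in> S"
      then obtain \<epsilon> where \<epsilon>: "\<epsilon> > 0" "ball x \<epsilon> \<subseteq> S" using S open_contains_ball by blast
      have "x \<in> closure A" using A by simp
      then obtain b where b: "b \<in> A" "dist b x < \<epsilon> / 3" using \<epsilon>(1) unfolding closure_approachable
        by (meson divide_pos_pos zero_less_numeral)
      have "\<epsilon> / 3 < \<epsilon> / 2" using \<epsilon> by simp
      \<comment> \<open>The radius exceeds \<open>\<epsilon>/3\<close>, so the ball around
        \<open>b\<close> contains \<open>x\<close>, and it is below \<open>\<epsilon>/2\<close>, so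
        the ball stays inside the one around \<open>x\<close>.\<close>
      then obtain r where r: "r \<in> \<rat>" "\<epsilon> / 3 < r" "r < \<epsilon> / 2" using Rats_dense_in_real by blast
      have "ball b r \<subseteq> ball x \<epsilon>"
      proof
        fix y assume "y \<in> ball b r"
        then have "dist x y < \<epsilon> / 3 + r" using dist_triangle[of x y b] b(2) by (auto simp: dist_commute)
        then show "y \<in> ball x \<epsilon>" using r by simp
      qed
      then have "(b, r) \<in> ?I" using b r \<epsilon> by auto
      moreover have "x \<in> ball b r" using b r by auto
      ultimately show "x \<in> (\<Union>(b, r)\<in>?I. ball b r)" by blast
    qed
  qed auto
  have ball: "h -` ball b r \<inter> space N \<in> sets N" for b r
  proof -
    have "(\<lambda>\<omega>. norm (blinfun_apply (b - h \<omega>) u)) \<in> borel_measurable N" for u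
      unfolding blinfun.diff_left using h by measurable
    then have "(\<lambda>\<omega>. norm (b - h \<omega>)) \<in> borel_measurable N" by (rule norm_blinfun_measurable)
    then have "{\<omega>\<in>space N. norm (b - h \<omega>) < r} \<in> sets N" by measurable
    also have "{\<omega>\<in>space N. norm (b - h \<omega>) < r} = h -` ball b r \<inter> space N" by (auto simp: dist_norm)
    finally show ?thesis .
  qed
  have "h -` S \<inter> space N = (\<Union>(b, r)\<in>?I. h -` ball b r \<inter> space N)" by (subst S_eq) auto
  also have "\<dots> \<in> sets N" using I ball by (intro sets.countable_UN') auto
  finally show "h -` S \<inter> space N \<in> sets N" .
qed

section \<open>Almost sure existence and equivariance of the principal directions\<close>

lemma AE_contr_decay: "AE \<omega> in M. \<exists>a>0. \<forall>n. contr (\<theta> 1 \<omega>) n \<le> exp (- a * real n)"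
proof (rule AE_flow)
  interpret T: mp_transformation M "\<theta> 1" by (rule mp_flow)
  show "AE \<omega> in M. \<exists>a>0. \<forall>n. contr \<omega> n \<le> exp (- a * real n)"
    using T.AE_bounded_half_of_orbit[OF \<kappa>_measurable] AE_space
  proof eventually_elim
    case (elim \<omega>)
    have it: "(\<theta> 1 ^^ i) \<omega> = \<theta> (real i) \<omega>" for i using flow_iter[OF elim(2), where t = 1 and n = i] by simp
    from elim(1) obtain K where "\<And>n. real (card {i. i < n \<and> real K < \<kappa> (\<theta> (real i) \<omega>)}) \<le> real n / 2"
      unfolding it by blast
    from prod_contraction_decay[OF _ this] show ?case
      unfolding contr_def using \<kappa>_ge_1[OF flow_space[OF elim(2)]] by blast
  qed
qed

text \<open>The steps that end at time 0 start at the times \<open>- 1\<close>, \<open>- 2\<close>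
  and so on. Hence the frequency estimate is applied to the inverse flow and to
  \<open>\<kappa> \<circ> \<theta> (- 1)\<close>.\<close>

lemma AE_limit_exists: "AE \<omega> in M. \<exists>x. (pullback_direction \<theta> U e \<omega> \<longlongrightarrow> x) at_top"
proof -
  interpret T: mp_transformation M "\<theta> (- 1)" by (rule mp_flow)
  have m: "(\<lambda>\<omega>. \<kappa> (\<theta> (- 1) \<omega>)) \<in> borel_measurable M" by measurable
  show ?thesis
    using T.AE_bounded_half_of_orbit[OF m] T.AE_bounded_frequently[OF m] AE_space
  proof eventually_elim
    case (elim \<omega>)
    note \<omega> = elim(3)
    have it: "\<theta> (- 1) ((\<theta> (- 1) ^^ i) \<omega>) = \<theta> (- real (Suc i)) \<omega>" for i
      using flow_iter[OF \<omega>, where t = "- 1" and n = i] by (simp add: flow_flow[OF \<omega>] algebra_simps)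
    from elim(1) obtain K where "\<And>n. real (card {i. i < n \<and> real K < \<kappa> (\<theta> (- real (Suc i)) \<omega>)}) \<le> real n / 2"
      unfolding it by blast
    from prod_contraction_decay[OF _ this] obtain a where
      a: "a > 0" "\<And>n. (\<Prod>i<n. 1 - 1 / (\<kappa> (\<theta> (- real (Suc i)) \<omega>))\<^sup>2) \<le> exp (- a * real n)"
      using \<kappa>_ge_1[OF flow_space[OF \<omega>]] by blast
    \<comment> \<open>The cocycle traverses these times in the opposite order, so the product has to
      be reversed.\<close>
    have contr_eq: "contr (\<theta> (- real n) \<omega>) n = (\<Prod>i<n. 1 - 1 / (\<kappa> (\<theta> (- real (Suc i)) \<omega>))\<^sup>2)" for n
    proof -
      have "(\<Prod>i<n. 1 - 1 / (\<kappa> (\<theta> (- real (Suc i)) \<omega>))\<^sup>2) = (\<Prod>i<n. 1 - 1 / (\<kappa> (\<theta> (- real (Suc (n - Suc i))) \<omega>))\<^sup>2)"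
        by (rule prod.nat_diff_reindex[symmetric])
      also have "\<dots> = contr (\<theta> (- real n) \<omega>) n"
        unfolding contr_def
      proof (rule prod.cong)
        fix i assume "i \<in> {..<n}"
        then have "- real (Suc (n - Suc i)) = - real n + real i" by (auto simp: of_nat_diff)
        then show "1 - 1 / (\<kappa> (\<theta> (- real (Suc (n - Suc i))) \<omega>))\<^sup>2 = 1 - 1 / (\<kappa> (\<theta> (real i) (\<theta> (- real n) \<omega>)))\<^sup>2"
          by (simp only: flow_flow[OF \<omega>])
      qed simp
      finally show ?thesis by simp
    qed
    have "(\<lambda>n. contr (\<theta> (- real n) \<omega>) n) \<longlonglongrightarrow> 0"
    proof (rule tendsto_sandwich[OF _ _ tendsto_const exp_decay_tendsto_0[OF a(1)]])
      show "\<forall>\<^sub>F n in sequentially. 0 \<le> contr (\<theta> (- real n) \<omega>) n"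
        by (intro always_eventually allI contr_nonneg flow_space \<omega>)
      show "\<forall>\<^sub>F n in sequentially. contr (\<theta> (- real n) \<omega>) n \<le> exp (- a * real n)"
        unfolding contr_eq by (intro always_eventually allI a)
    qed
    moreover from elim(2) obtain K' :: nat where "\<exists>\<^sub>F n in sequentially. \<kappa> (\<theta> (- real (Suc n)) \<omega>) \<le> real K'"
      unfolding it by blast
    ultimately show ?case by (rule limit_exists[OF \<omega>])
  qed
qed

text \<open>Existence passes backwards in time: composing with the cocycle over
  \<open>[0, r]\<close> turns the limit at \<open>\<theta> r \<omega>\<close> into the one at
  \<open>\<omega>\<close>, since normalisation ignores positive factors. The shift lemma for
  \<open>w\<close> passes existence forwards.\<close>

lemma dual_pullback_shift:
  assumes \<omega>: "\<omega> \<in> space M" and r: "0 \<le> r"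
    and f: "(dual_pullback_direction \<theta> U ed (\<theta> r \<omega>) \<longlongrightarrow> f) at_top" and nz: "f o\<^sub>L U \<omega> r \<noteq> 0"
  shows "(dual_pullback_direction \<theta> U ed \<omega> \<longlongrightarrow> (f o\<^sub>L U \<omega> r) /\<^sub>R norm (f o\<^sub>L U \<omega> r)) at_top"
proof (rule tendsto_at_top_shiftD[where r = r])
  let ?p = "dual_pullback_direction \<theta> U ed"
  have "((\<lambda>s. ?p (\<theta> r \<omega>) s o\<^sub>L U \<omega> r) \<longlongrightarrow> f o\<^sub>L U \<omega> r) at_top"
    by (intro bounded_bilinear.tendsto[OF bounded_bilinear_blinfun_compose] f tendsto_const)
  then have "((\<lambda>s. (?p (\<theta> r \<omega>) s o\<^sub>L U \<omega> r) /\<^sub>R norm (?p (\<theta> r \<omega>) s o\<^sub>L U \<omega> r)) \<longlongrightarrow> (f o\<^sub>L U \<omega> r) /\<^sub>R norm (f o\<^sub>L U \<omega> r)) at_top"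
    using nz by (intro tendsto_scaleR tendsto_inverse tendsto_norm) auto
  moreover have "\<forall>\<^sub>F s in at_top. (?p (\<theta> r \<omega>) s o\<^sub>L U \<omega> r) /\<^sub>R norm (?p (\<theta> r \<omega>) s o\<^sub>L U \<omega> r) = ?p \<omega> (r + s)"
    using eventually_ge_at_top[of 1]
  proof eventually_elim
    case (elim s)
    let ?L = "ed o\<^sub>L U (\<theta> r \<omega>) s"
    have "?L \<noteq> 0"
    proof
      assume "?L = 0"
      then have "blinfun_apply ?L e = 0" by simp
      then show False using ed_pos[OF flow_space[OF \<omega>] elim, of r] by simp
    qed
    then have pos: "0 < inverse (norm ?L)" by simp
    have "?p (\<theta> r \<omega>) s o\<^sub>L U \<omega> r = inverse (norm ?L) *\<^sub>R (?L o\<^sub>L U \<omega> r)"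
      unfolding dual_pullback_eq[OF flow_space[OF \<omega>]] by (rule blinfun_eqI) (simp add: blinfun.scaleR_left)
    moreover have "?L o\<^sub>L U \<omega> r = ed o\<^sub>L U \<omega> (r + s)"
      by (rule blinfun_eqI) (use elim in \<open>simp add: ap_add[OF \<omega> r]\<close>)
    ultimately show ?case using normalize_scale[OF pos, of "?L o\<^sub>L U \<omega> r"] unfolding dual_pullback_eq[OF \<omega>] by simp
  qed
  ultimately show "((\<lambda>s. ?p \<omega> (r + s)) \<longlongrightarrow> (f o\<^sub>L U \<omega> r) /\<^sub>R norm (f o\<^sub>L U \<omega> r)) at_top"
    by (rule Lim_transform_eventually)
qed

lemma pullback_shift:
  assumes \<omega>: "\<omega> \<in> space M" and r: "0 \<le> r"
    and x: "(pullback_direction \<theta> U e \<omega> \<longlongrightarrow> x) at_top" and nz: "ap \<omega> r x \<noteq> 0"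
  shows "(pullback_direction \<theta> U e (\<theta> r \<omega>) \<longlongrightarrow> ap \<omega> r x /\<^sub>R norm (ap \<omega> r x)) at_top"
proof (rule tendsto_at_top_shiftD[where r = r])
  let ?p = "pullback_direction \<theta> U e"
  have "((\<lambda>s. ap \<omega> r (?p \<omega> s) /\<^sub>R norm (ap \<omega> r (?p \<omega> s))) \<longlongrightarrow> ap \<omega> r x /\<^sub>R norm (ap \<omega> r x)) at_top"
    using nz x by (intro tendsto_intros) auto
  moreover have "\<forall>\<^sub>F s in at_top. ap \<omega> r (?p \<omega> s) /\<^sub>R norm (ap \<omega> r (?p \<omega> s)) = ?p (\<theta> r \<omega>) (r + s)"
    using eventually_ge_at_top[of 0]
  proof eventually_elim
    case (elim s)
    let ?y = "ap (\<theta> (- s) \<omega>) s e"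
    have "?y \<noteq> 0" by (rule ap_e_nonzero[OF flow_space[OF \<omega>] elim])
    then have pos: "0 < inverse (norm ?y)" by simp
    have "ap \<omega> r (?p \<omega> s) = inverse (norm ?y) *\<^sub>R ap \<omega> r ?y"
      by (simp add: pullback_eq blinfun.scaleR_right)
    moreover have "ap \<omega> r ?y = ap (\<theta> (- (r + s)) (\<theta> r \<omega>)) (r + s) e"
    proof -
      have "\<theta> s (\<theta> (- s) \<omega>) = \<omega>" by (simp add: flow_flow[OF \<omega>] flow_zero[OF \<omega>])
      moreover have "\<theta> (- (r + s)) (\<theta> r \<omega>) = \<theta> (- s) \<omega>" by (simp add: flow_flow[OF \<omega>])
      ultimately show ?thesis using ap_add[OF flow_space[OF \<omega>] elim r, of "- s" e] by (simp add: add.commute)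
    qed
    ultimately show ?case using normalize_scale[OF pos, of "ap \<omega> r ?y"] unfolding pullback_eq[of "\<theta> r \<omega>"] by simp
  qed
  ultimately show "((\<lambda>s. ?p (\<theta> r \<omega>) (r + s)) \<longlongrightarrow> ap \<omega> r x /\<^sub>R norm (ap \<omega> r x)) at_top"
    by (rule Lim_transform_eventually)
qed

text \<open>Focusing on the unit interval before time 0 places the unnormalised vector between
  \<open>b e\<close> and \<open>\<kappa> b e\<close>. The upper bound limits its norm to
  \<open>\<kappa> b\<close>, so after normalisation at least \<open>e / \<kappa>\<close> remains
  below it, and closedness of the cone preserves this in the limit. This lower bound keeps
  \<open>w\<close> from being annihilated later on.\<close>

lemma pullback_limit:
  assumes \<omega>: "\<omega> \<in> space M" and x: "(pullback_direction \<theta> U e \<omega> \<longlongrightarrow> x) at_top"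
  shows "norm x = 1" and "x \<in> C" and "(1 / \<kappa> (\<theta> (- 1) \<omega>)) *\<^sub>R e \<preceq> x"
proof -
  let ?p = "pullback_direction \<theta> U e \<omega>"
  have p: "norm (?p s) = 1 \<and> ?p s - (1 / \<kappa> (\<theta> (- 1) \<omega>)) *\<^sub>R e \<in> C" if s: "1 \<le> s" for s
  proof -
    let ?y = "ap (\<theta> (- s) \<omega>) s e"
    have sp: "\<theta> t \<omega> \<in> space M" for t using \<omega> by (rule flow_space)
    have nz: "?y \<noteq> 0" by (rule ap_e_nonzero[OF sp]) (use s in simp)
    obtain b where b: "b > 0" "b *\<^sub>R e \<preceq> ?y" "?y \<preceq> (\<kappa> (\<theta> (- 1) \<omega>) * b) *\<^sub>R e"
      using ap_ge_e[OF sp s e_cone nz] by (auto simp: flow_flow[OF \<omega>])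
    have k: "\<kappa> (\<theta> (- 1) \<omega>) \<ge> 1" by (rule \<kappa>_ge_1[OF sp])
    have "norm ?y \<le> norm ((\<kappa> (\<theta> (- 1) \<omega>) * b) *\<^sub>R e)" using b(3) s by (intro norm_mono ap_cone[OF sp _ e_cone]) auto
    then have "norm ?y \<le> \<kappa> (\<theta> (- 1) \<omega>) * b" using k b(1) by (simp add: e_norm)
    then have le: "1 / \<kappa> (\<theta> (- 1) \<omega>) \<le> inverse (norm ?y) * b" using k nz by (simp add: field_simps)
    have "(inverse (norm ?y) * b) *\<^sub>R e \<preceq> inverse (norm ?y) *\<^sub>R ?y" using le_scale[of "inverse (norm ?y)", OF _ b(2)] by simp
    then have "(1 / \<kappa> (\<theta> (- 1) \<omega>)) *\<^sub>R e \<preceq> ?p s" unfolding pullback_eq using scale_le_scale[OF le e_cone] le_trans by blast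
    then show ?thesis using nz by (simp add: cone_le_def pullback_eq)
  qed
  have ev: "\<forall>\<^sub>F s in at_top. norm (?p s) = 1 \<and> ?p s - (1 / \<kappa> (\<theta> (- 1) \<omega>)) *\<^sub>R e \<in> C"
    by (rule eventually_mono[OF eventually_ge_at_top[of 1] p])
  have "((\<lambda>s. norm (?p s)) \<longlongrightarrow> 1) at_top"
    by (rule tendsto_eventually, rule eventually_mono[OF ev]) blast
  from tendsto_unique[OF _ tendsto_norm[OF x] this] show "norm x = 1" by simp
  have "x - (1 / \<kappa> (\<theta> (- 1) \<omega>)) *\<^sub>R e \<in> C"
  proof (rule Lim_in_closed_set[OF closed_cone])
    show "((\<lambda>s. ?p s - (1 / \<kappa> (\<theta> (- 1) \<omega>)) *\<^sub>R e) \<longlongrightarrow> x - (1 / \<kappa> (\<theta> (- 1) \<omega>)) *\<^sub>R e) at_top"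
      by (intro tendsto_intros x)
    show "\<forall>\<^sub>F s in at_top. ?p s - (1 / \<kappa> (\<theta> (- 1) \<omega>)) *\<^sub>R e \<in> C" by (rule eventually_mono[OF ev]) blast
  qed simp
  then show le: "(1 / \<kappa> (\<theta> (- 1) \<omega>)) *\<^sub>R e \<preceq> x" by (simp add: cone_le_def)
  show "x \<in> C"
    by (rule le_in_cone[OF cone_scale[OF _ e_cone] le]) (use \<kappa>_ge_1[OF flow_space[OF \<omega>], of "- 1"] in simp)
qed

text \<open>Along almost every orbit both limits exist at arbitrarily early and late times, and the equivariance of the
  two directions carries them to every point of the orbit.\<close>

lemma principal_directions_exist:
  obtains D where "invariant_set M \<theta> D" "prob D = 1"
    "\<And>\<omega>. \<omega> \<in> D \<Longrightarrow> (pullback_direction \<theta> U e \<omega> \<longlongrightarrow> principal_w \<theta> U e \<omega>) at_top"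
    "\<And>\<omega>. \<omega> \<in> D \<Longrightarrow> (dual_pullback_direction \<theta> U ed \<omega> \<longlongrightarrow> principal_w_dual \<theta> U ed \<omega>) at_top"
    "\<And>\<omega>. \<omega> \<in> D \<Longrightarrow> principal_w_dual \<theta> U ed \<omega> \<in> dual_cone C"
    "\<And>\<omega> u. \<omega> \<in> D \<Longrightarrow> u \<in> C \<Longrightarrow> blinfun_apply (principal_w_dual \<theta> U ed \<omega>) u = 0 \<longleftrightarrow> ap \<omega> 1 u = 0"
proof -
  define Q where "Q \<omega> \<longleftrightarrow> (\<exists>x. (pullback_direction \<theta> U e \<omega> \<longlongrightarrow> x) at_top) \<and>
    (\<exists>f. (dual_pullback_direction \<theta> U ed \<omega> \<longlongrightarrow> f) at_top \<and> f \<in> dual_cone C \<and> blinfun_apply f e > 0)" for \<omega>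
  have "AE \<omega> in M. Q \<omega>"
    using AE_limit_exists AE_contr_decay AE_space
  proof eventually_elim
    case (elim \<omega>)
    then obtain a where a: "a > 0" "\<And>n. contr (\<theta> 1 \<omega>) n \<le> exp (- a * real n)" by blast
    have "contr (\<theta> 1 \<omega>) \<longlonglongrightarrow> 0"
      by (rule tendsto_sandwich[OF _ _ tendsto_const exp_decay_tendsto_0[OF a(1)]])
         (intro always_eventually allI contr_nonneg flow_space elim(3) a(2))+
    from dual_limit_exists[OF elim(3) this] show ?case using elim(1) unfolding Q_def by blast
  qed
  then obtain D where D: "invariant_set M \<theta> D" "prob D = 1"
    "\<And>\<omega> r. \<omega> \<in> D \<Longrightarrow> \<exists>t\<ge>r. Q (\<theta> t \<omega>)" "\<And>\<omega> r. \<omega> \<in> D \<Longrightarrow> \<exists>t\<le>r. Q (\<theta> t \<omega>)"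
    using AE_invariant_set by blast
  show ?thesis
  proof (rule that[OF D(1,2)])
    fix \<omega> assume \<omega>D: "\<omega> \<in> D"
    have \<omega>: "\<omega> \<in> space M" by (rule invariant_set_space[OF D(1) \<omega>D])
    have sp: "\<theta> t \<omega> \<in> space M" for t using \<omega> by (rule flow_space)
    \<comment> \<open>The direction \<open>w\<close> travels forwards, so it is fetched from an
      earlier good time; the dual direction, treated next, comes from a later one.\<close>
    obtain t where t: "t \<le> 0" "Q (\<theta> t \<omega>)" using D(4)[OF \<omega>D] by blast
    then obtain x where x: "(pullback_direction \<theta> U e (\<theta> t \<omega>) \<longlongrightarrow> x) at_top" unfolding Q_def by blast
    have ret: "\<theta> (- t) (\<theta> t \<omega>) = \<omega>" by (simp add: flow_flow[OF \<omega>] flow_zero[OF \<omega>])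
    have "ap (\<theta> t \<omega>) (- t) x \<noteq> 0"
    proof
      assume 0: "ap (\<theta> t \<omega>) (- t) x = 0"
      have "(1 / \<kappa> (\<theta> (- 1) (\<theta> t \<omega>))) *\<^sub>R ap (\<theta> t \<omega>) (- t) e \<preceq> 0"
        using ap_scale_le[OF sp[of t] _ pullback_limit(3)[OF sp x], of "- t"] t(1) unfolding 0 by simp
      moreover have "(1 / \<kappa> (\<theta> (- 1) (\<theta> t \<omega>))) *\<^sub>R ap (\<theta> t \<omega>) (- t) e \<in> C"
        using t(1) \<kappa>_ge_1[OF flow_space[OF sp], of "- 1" t] by (intro cone_scale ap_cone[OF sp _ e_cone]) auto
      ultimately have "norm ((1 / \<kappa> (\<theta> (- 1) (\<theta> t \<omega>))) *\<^sub>R ap (\<theta> t \<omega>) (- t) e) \<le> norm (0::'a)" by (intro norm_mono)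
      then show False using ap_e_nonzero[OF sp, of "- t" t] t(1) \<kappa>_ge_1[OF flow_space[OF sp], of "- 1" t]
        by (simp add: divide_le_0_iff)
    qed
    from pullback_shift[OF sp _ x this] t(1)
    have lim: "(pullback_direction \<theta> U e \<omega> \<longlongrightarrow> ap (\<theta> t \<omega>) (- t) x /\<^sub>R norm (ap (\<theta> t \<omega>) (- t) x)) at_top" 
      unfolding ret by simp
    show "(pullback_direction \<theta> U e \<omega> \<longlongrightarrow> principal_w \<theta> U e \<omega>) at_top"
      unfolding principal_w_def using lim tendsto_Lim[OF _ lim] by simp
    \<comment> \<open>With \<open>2 \<le> r\<close> at least one unit of time remains after the
      first step. Focusing then also bounds the image of \<open>e\<close> from
      \<open>\<theta> 1 \<omega>\<close> from below, which the description of the kernel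
      needs.\<close>
    obtain r where r: "2 \<le> r" "Q (\<theta> r \<omega>)" using D(3)[OF \<omega>D] by blast
    then obtain f where f: "(dual_pullback_direction \<theta> U ed (\<theta> r \<omega>) \<longlongrightarrow> f) at_top" "f \<in> dual_cone C" "blinfun_apply f e > 0"
      unfolding Q_def by blast
    have f_ge: "0 < blinfun_apply f v" if "b > 0" "b *\<^sub>R e \<preceq> v" for b v
    proof -
      have "0 < b * blinfun_apply f e" using that(1) f(3) by simp
      also have "\<dots> = blinfun_apply f (b *\<^sub>R e)" by (simp add: blinfun.scaleR_right)
      also have "\<dots> \<le> blinfun_apply f v" by (rule dual_cone_mono[OF f(2) that(2)])
      finally show ?thesis .
    qed
    obtain b where "b > 0" "b *\<^sub>R e \<preceq> ap \<omega> r e" using ap_e_ge_e[OF \<omega>, of r] r by auto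
    then have "0 < blinfun_apply (f o\<^sub>L U \<omega> r) e" using f_ge by simp
    then have nz: "f o\<^sub>L U \<omega> r \<noteq> 0" by (metis less_irrefl zero_blinfun.rep_eq)
    define W where "W = (f o\<^sub>L U \<omega> r) /\<^sub>R norm (f o\<^sub>L U \<omega> r)"
    have dlim: "(dual_pullback_direction \<theta> U ed \<omega> \<longlongrightarrow> W) at_top"
      unfolding W_def by (rule dual_pullback_shift[OF \<omega> _ f(1) nz]) (use r in simp)
    have W: "principal_w_dual \<theta> U ed \<omega> = W" unfolding principal_w_dual_def by (rule tendsto_Lim[OF _ dlim]) simp
    show "(dual_pullback_direction \<theta> U ed \<omega> \<longlongrightarrow> principal_w_dual \<theta> U ed \<omega>) at_top" unfolding W by (rule dlim)
    have W_app: "blinfun_apply W u = inverse (norm (f o\<^sub>L U \<omega> r)) * blinfun_apply f (ap \<omega> r u)" for u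
      by (simp add: W_def blinfun.scaleR_left)
    show "principal_w_dual \<theta> U ed \<omega> \<in> dual_cone C"
      unfolding W using f(2) ap_cone[OF \<omega>, of r] r by (auto simp: dual_cone_def W_app)
    fix u assume u: "u \<in> C"
    have split: "ap \<omega> r u = ap (\<theta> 1 \<omega>) (r - 1) (ap \<omega> 1 u)" using ap_add[OF \<omega>, of 1 "r - 1" u] r by simp
    show "blinfun_apply (principal_w_dual \<theta> U ed \<omega>) u = 0 \<longleftrightarrow> ap \<omega> 1 u = 0"
    proof
      assume "ap \<omega> 1 u = 0"
      then show "blinfun_apply (principal_w_dual \<theta> U ed \<omega>) u = 0" unfolding W W_app split by (simp add: blinfun.zero_right)
    next
      assume 0: "blinfun_apply (principal_w_dual \<theta> U ed \<omega>) u = 0"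
      show "ap \<omega> 1 u = 0"
      proof (rule ccontr)
        assume "ap \<omega> 1 u \<noteq> 0"
        from focusing[OF \<omega> u this] obtain b where b: "b > 0" "b *\<^sub>R e \<preceq> ap \<omega> 1 u" by blast
        obtain c where c: "c > 0" "c *\<^sub>R e \<preceq> ap (\<theta> 1 \<omega>) (r - 1) e" using ap_e_ge_e[OF sp, of "r - 1" 1] r by auto
        have "b *\<^sub>R ap (\<theta> 1 \<omega>) (r - 1) e \<preceq> ap \<omega> r u" unfolding split using ap_scale_le[OF sp _ b(2), of "r - 1"] r by simp
        moreover have "(b * c) *\<^sub>R e \<preceq> b *\<^sub>R ap (\<theta> 1 \<omega>) (r - 1) e" using le_scale[of b, OF _ c(2)] b(1) by simp
        ultimately have "(b * c) *\<^sub>R e \<preceq> ap \<omega> r u" using le_trans by blast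
        then have "0 < blinfun_apply f (ap \<omega> r u)" using f_ge[of "b * c"] b c by simp
        then show False using 0 nz unfolding W W_app by simp
      qed
    qed
  qed
qed

end

section \<open>The invariant decomposition\<close>

text \<open>\<open>f\<close> and \<open>g\<close> are real-valued integrable majorants of the two
  extended-valued suprema in (A1). Their bounds are stated with \<open>exp\<close>, so that no
  logarithm of a possibly vanishing norm appears.\<close>

locale principal_floquet_setting = focusing_skew_product M \<theta> U C e ed \<kappa>
  for M :: "'w measure" and \<theta> :: "real \<Rightarrow> 'w \<Rightarrow> 'w"
    and U :: "'w \<Rightarrow> real \<Rightarrow> ('a::{banach, second_countable_topology} \<Rightarrow>\<^sub>L 'a)"
    and C :: "'a set" and e :: 'a and ed :: "'a \<Rightarrow>\<^sub>L real" and \<kappa> :: "'w \<Rightarrow> real" +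
  fixes D :: "'w set" and f g :: "'w \<Rightarrow> real"
  assumes D_inv: "invariant_set M \<theta> D" and D_prob: "prob D = 1"
    and w_lim: "\<And>\<omega>. \<omega> \<in> D \<Longrightarrow> (pullback_direction \<theta> U e \<omega> \<longlongrightarrow> principal_w \<theta> U e \<omega>) at_top"
    and wd_lim: "\<And>\<omega>. \<omega> \<in> D \<Longrightarrow> (dual_pullback_direction \<theta> U ed \<omega> \<longlongrightarrow> principal_w_dual \<theta> U ed \<omega>) at_top"
    and wd_dual: "\<And>\<omega>. \<omega> \<in> D \<Longrightarrow> principal_w_dual \<theta> U ed \<omega> \<in> dual_cone C"
    and wd_zero: "\<And>\<omega> u. \<omega> \<in> D \<Longrightarrow> u \<in> C \<Longrightarrow>
      blinfun_apply (principal_w_dual \<theta> U ed \<omega>) u = 0 \<longleftrightarrow> blinfun_apply (U \<omega> 1) u = 0"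
    and f_int: "integrable M f" and f_nonneg: "\<And>\<omega>. 0 \<le> f \<omega>"
    and f_bound: "AE \<omega> in M. \<forall>s\<in>{0..1}. norm (U \<omega> s) \<le> exp (f \<omega>)"
    and g_int: "integrable M g" and g_nonneg: "\<And>\<omega>. 0 \<le> g \<omega>"
    and g_bound: "AE \<omega> in M. \<forall>s\<in>{0..1}. norm (U (\<theta> s \<omega>) (1 - s)) \<le> exp (g \<omega>)"
begin

abbreviation w :: "'w \<Rightarrow> 'a" where "w \<equiv> principal_w \<theta> U e"
abbreviation wd :: "'w \<Rightarrow> ('a \<Rightarrow>\<^sub>L real)" where "wd \<equiv> principal_w_dual \<theta> U ed"
abbreviation E :: "'w \<Rightarrow> 'a set" where "E \<omega> \<equiv> span {w \<omega>}"
abbreviation F :: "'w \<Rightarrow> 'a set" where "F \<omega> \<equiv> {u. blinfun_apply (wd \<omega>) u = 0}"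

definition \<rho> :: "real \<Rightarrow> 'w \<Rightarrow> real" where "\<rho> t \<omega> = norm (ap \<omega> t (w \<omega>))"
definition q :: "'w \<Rightarrow> real" where "q \<omega> = blinfun_apply (wd \<omega>) (w \<omega>)"
definition P :: "'w \<Rightarrow> 'a \<Rightarrow> 'a" where "P \<omega> u = u - (blinfun_apply (wd \<omega>) u / q \<omega>) *\<^sub>R w \<omega>"

lemma D_space: "\<omega> \<in> D \<Longrightarrow> \<omega> \<in> space M"
  by (rule invariant_set_space[OF D_inv])

lemma D_flow: "\<omega> \<in> D \<Longrightarrow> \<theta> t \<omega> \<in> D"
  by (rule invariant_setD[OF D_inv])

lemma D_sets [measurable]: "D \<in> sets M"
  using D_inv by (simp add: invariant_set_def)

lemma AE_D: "AE \<omega> in M. \<omega> \<in> D"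
  using D_prob by (simp add: prob_eq_1)

lemma w_norm: "\<omega> \<in> D \<Longrightarrow> norm (w \<omega>) = 1"
  and w_cone: "\<omega> \<in> D \<Longrightarrow> w \<omega> \<in> C"
  and w_ge: "\<omega> \<in> D \<Longrightarrow> (1 / \<kappa> (\<theta> (- 1) \<omega>)) *\<^sub>R e \<preceq> w \<omega>"
  using pullback_limit D_space w_lim by blast+

lemma ap_e_le_\<rho>:
  assumes \<omega>: "\<omega> \<in> D" and t: "0 \<le> t"
  shows "norm (ap \<omega> t e) \<le> \<kappa> (\<theta> (- 1) \<omega>) * \<rho> t \<omega>"
proof -
  have sp: "\<omega> \<in> space M" by (rule D_space[OF \<omega>])
  have k: "1 \<le> \<kappa> (\<theta> (- 1) \<omega>)" by (rule \<kappa>_ge_1[OF flow_space[OF sp]])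
  have "(1 / \<kappa> (\<theta> (- 1) \<omega>)) *\<^sub>R ap \<omega> t e \<preceq> ap \<omega> t (w \<omega>)"
    by (rule ap_scale_le[OF sp t w_ge[OF \<omega>]])
  then have "norm ((1 / \<kappa> (\<theta> (- 1) \<omega>)) *\<^sub>R ap \<omega> t e) \<le> \<rho> t \<omega>"
    unfolding \<rho>_def using k by (intro norm_mono cone_scale ap_cone[OF sp t e_cone]) auto
  then show ?thesis using k by (simp add: field_simps)
qed

lemma \<rho>_pos: "\<omega> \<in> D \<Longrightarrow> 0 \<le> t \<Longrightarrow> 0 < \<rho> t \<omega>"
proof -
  assume \<omega>: "\<omega> \<in> D" and t: "0 \<le> t"
  have "0 < norm (ap \<omega> t e)" using ap_e_nonzero[OF D_space[OF \<omega>] t] by simp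
  also have "\<dots> \<le> \<kappa> (\<theta> (- 1) \<omega>) * \<rho> t \<omega>" by (rule ap_e_le_\<rho>[OF \<omega> t])
  finally have "\<rho> t \<omega> \<noteq> 0" by auto
  then show "0 < \<rho> t \<omega>" by (simp add: \<rho>_def)
qed

lemma ap_w: "\<omega> \<in> D \<Longrightarrow> 0 \<le> t \<Longrightarrow> ap \<omega> t (w \<omega>) = \<rho> t \<omega> *\<^sub>R w (\<theta> t \<omega>)"
proof -
  assume \<omega>: "\<omega> \<in> D" and t: "0 \<le> t"
  have nz: "ap \<omega> t (w \<omega>) \<noteq> 0" using \<rho>_pos[OF \<omega> t] by (auto simp: \<rho>_def)
  have "w (\<theta> t \<omega>) = ap \<omega> t (w \<omega>) /\<^sub>R norm (ap \<omega> t (w \<omega>))"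
    by (rule tendsto_unique[OF _ w_lim[OF D_flow[OF \<omega>]] pullback_shift[OF D_space[OF \<omega>] t w_lim[OF \<omega>] nz]]) simp
  then show "ap \<omega> t (w \<omega>) = \<rho> t \<omega> *\<^sub>R w (\<theta> t \<omega>)" using nz by (simp add: \<rho>_def)
qed

lemma \<rho>_add: "\<omega> \<in> D \<Longrightarrow> 0 \<le> s \<Longrightarrow> 0 \<le> t \<Longrightarrow> \<rho> (s + t) \<omega> = \<rho> t (\<theta> s \<omega>) * \<rho> s \<omega>"
proof -
  assume \<omega>: "\<omega> \<in> D" and s: "0 \<le> s" and t: "0 \<le> t"
  have "ap \<omega> (s + t) (w \<omega>) = ap (\<theta> s \<omega>) t (ap \<omega> s (w \<omega>))" using ap_add[OF D_space[OF \<omega>] s t] by simp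
  also have "\<dots> = \<rho> s \<omega> *\<^sub>R ap (\<theta> s \<omega>) t (w (\<theta> s \<omega>))" by (simp add: ap_w[OF \<omega> s] blinfun.scaleR_right)
  finally show "\<rho> (s + t) \<omega> = \<rho> t (\<theta> s \<omega>) * \<rho> s \<omega>" using \<rho>_pos[OF \<omega> s] by (simp add: \<rho>_def)
qed

lemma \<rho>_le_norm: "\<omega> \<in> D \<Longrightarrow> \<rho> t \<omega> \<le> norm (U \<omega> t)"
  using norm_blinfun[of "U \<omega> t" "w \<omega>"] by (simp add: \<rho>_def w_norm)

lemma wd_app_nonneg: "\<omega> \<in> D \<Longrightarrow> u \<in> C \<Longrightarrow> 0 \<le> blinfun_apply (wd \<omega>) u"
  using wd_dual by (auto simp: dual_cone_def)

text \<open>The functional vanishes on a cone element only if the time-one map kills that element,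
  and the time-one map does not kill \<open>w\<close>. Positivity of this pairing is what makes the
  two subspaces complementary.\<close>

lemma q_pos: "\<omega> \<in> D \<Longrightarrow> 0 < q \<omega>"
proof -
  assume \<omega>: "\<omega> \<in> D"
  have "ap \<omega> 1 (w \<omega>) \<noteq> 0" using \<rho>_pos[OF \<omega>, of 1] by (auto simp: \<rho>_def)
  then have "q \<omega> \<noteq> 0" using wd_zero[OF \<omega> w_cone[OF \<omega>]] by (simp add: q_def)
  moreover have "0 \<le> q \<omega>" unfolding q_def by (rule wd_app_nonneg[OF \<omega> w_cone[OF \<omega>]])
  ultimately show "0 < q \<omega>" by simp
qed

lemma wd_norm: "\<omega> \<in> D \<Longrightarrow> norm (wd \<omega>) = 1"
proof -
  assume \<omega>: "\<omega> \<in> D"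
  have sp: "\<omega> \<in> space M" by (rule D_space[OF \<omega>])
  have "((\<lambda>s. norm (dual_pullback_direction \<theta> U ed \<omega> s)) \<longlongrightarrow> 1) at_top"
  proof (rule tendsto_eventually, rule eventually_mono[OF eventually_ge_at_top[of 1]])
    fix s :: real assume "1 \<le> s"
    then have "ed o\<^sub>L U \<omega> s \<noteq> 0" using ed_pos[OF sp] by (metis blinfun_apply_blinfun_compose less_irrefl zero_blinfun.rep_eq)
    then show "norm (dual_pullback_direction \<theta> U ed \<omega> s) = 1" by (simp add: dual_pullback_eq[OF sp])
  qed
  from tendsto_unique[OF _ tendsto_norm[OF wd_lim[OF \<omega>]] this] show ?thesis by simp
qed

lemma q_le_1: "\<omega> \<in> D \<Longrightarrow> q \<omega> \<le> 1"
  using norm_blinfun[of "wd \<omega>" "w \<omega>"] by (simp add: q_def wd_norm w_norm)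

text \<open>By the backward equivariance, \<open>wd \<omega>\<close> is the normalised pullback of
  the functional at the later point. In particular the kernels are mapped into each other.\<close>

lemma wd_flow:
  assumes \<omega>: "\<omega> \<in> D" and t: "0 \<le> t"
  shows "blinfun_apply (wd (\<theta> t \<omega>)) (ap \<omega> t u) = norm (wd (\<theta> t \<omega>) o\<^sub>L U \<omega> t) * blinfun_apply (wd \<omega>) u"
proof -
  let ?f = "wd (\<theta> t \<omega>) o\<^sub>L U \<omega> t"
  have "blinfun_apply ?f (w \<omega>) = \<rho> t \<omega> * q (\<theta> t \<omega>)"
    by (simp add: ap_w[OF \<omega> t] blinfun.scaleR_right q_def)
  then have nz: "?f \<noteq> 0" using \<rho>_pos[OF \<omega> t] q_pos[OF D_flow[OF \<omega>, of t]]
    by (metis mult_pos_pos less_irrefl zero_blinfun.rep_eq)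
  have "wd \<omega> = ?f /\<^sub>R norm ?f"
    by (rule tendsto_unique[OF _ wd_lim[OF \<omega>] dual_pullback_shift[OF D_space[OF \<omega>] t wd_lim[OF D_flow[OF \<omega>]] nz]]) simp
  then have "blinfun_apply (wd \<omega>) u = inverse (norm ?f) * blinfun_apply ?f u" by (simp add: blinfun.scaleR_left)
  then show ?thesis using nz by simp
qed

text \<open>The later functional is evaluated at the image of \<open>w\<close> by either
  equivariance. All control of \<open>q\<close> along orbits, and with it temperedness, rests on
  this identity.\<close>

lemma q_flow: "\<omega> \<in> D \<Longrightarrow> 0 \<le> t \<Longrightarrow> \<rho> t \<omega> * q (\<theta> t \<omega>) = norm (wd (\<theta> t \<omega>) o\<^sub>L U \<omega> t) * q \<omega>"
  using wd_flow[of \<omega> t "w \<omega>"] by (simp add: ap_w blinfun.scaleR_right q_def)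

lemma norm_wd_comp_le: "\<omega> \<in> D \<Longrightarrow> norm (wd (\<theta> t \<omega>) o\<^sub>L U \<omega> t) \<le> norm (U \<omega> t)"
  using norm_blinfun_compose[of "wd (\<theta> t \<omega>)" "U \<omega> t"] wd_norm[OF D_flow] by simp

lemma F_flow: "\<omega> \<in> D \<Longrightarrow> 0 \<le> t \<Longrightarrow> u \<in> F \<omega> \<Longrightarrow> ap \<omega> t u \<in> F (\<theta> t \<omega>)"
  by (simp add: wd_flow)

lemma E_flow: "\<omega> \<in> D \<Longrightarrow> 0 \<le> t \<Longrightarrow> blinfun_apply (U \<omega> t) ` E \<omega> = E (\<theta> t \<omega>)"
proof -
  assume \<omega>: "\<omega> \<in> D" and t: "0 \<le> t"
  have "blinfun_apply (U \<omega> t) ` E \<omega> = span (blinfun_apply (U \<omega> t) ` {w \<omega>})"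
    by (rule linear_span_image[symmetric]) (simp add: bounded_linear.linear blinfun.bounded_linear_right)
  also have "\<dots> = span {\<rho> t \<omega> *\<^sub>R w (\<theta> t \<omega>)}" by (simp add: ap_w[OF \<omega> t])
  also have "\<dots> = E (\<theta> t \<omega>)"
  proof (rule span_eq[THEN iffD2], intro conjI)
    show "{\<rho> t \<omega> *\<^sub>R w (\<theta> t \<omega>)} \<subseteq> E (\<theta> t \<omega>)" by (simp add: span_scale span_base)
    have "inverse (\<rho> t \<omega>) *\<^sub>R (\<rho> t \<omega> *\<^sub>R w (\<theta> t \<omega>)) \<in> span {\<rho> t \<omega> *\<^sub>R w (\<theta> t \<omega>)}" by (intro span_scale span_base) simp
    then show "{w (\<theta> t \<omega>)} \<subseteq> span {\<rho> t \<omega> *\<^sub>R w (\<theta> t \<omega>)}" using \<rho>_pos[OF \<omega> t] by simp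
  qed
  finally show ?thesis .
qed

lemma P_in_F: "\<omega> \<in> D \<Longrightarrow> P \<omega> u \<in> F \<omega>"
  using q_pos[of \<omega>] by (simp add: P_def blinfun.diff_right blinfun.scaleR_right q_def)

lemma P_diff_in_E: "u - P \<omega> u \<in> E \<omega>"
  by (simp add: P_def span_scale span_base)

lemma P_of_F: "u \<in> F \<omega> \<Longrightarrow> P \<omega> u = u"
  by (simp add: P_def)

lemma E_inter_F: "\<omega> \<in> D \<Longrightarrow> E \<omega> \<inter> F \<omega> = {0}"
  using q_pos[of \<omega>] by (auto simp: span_singleton blinfun.scaleR_right q_def span_zero blinfun.zero_right)

lemma decomposition: "D' \<subseteq> D \<Longrightarrow> decomposition1 D' E F"
  unfolding decomposition1_def
proof (intro ballI conjI allI)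
  fix \<omega> assume "D' \<subseteq> D" "\<omega> \<in> D'"
  then have \<omega>: "\<omega> \<in> D" by blast
  show "subspace (E \<omega>)" by (rule subspace_span)
  have "w \<omega> \<noteq> 0" using w_norm[OF \<omega>] by auto
  then show "dim (E \<omega>) = 1" by (subst dim_span) (simp add: dim_eq_card_independent)
  show "subspace (F \<omega>)" by (auto simp: subspace_def blinfun.zero_right blinfun.add_right blinfun.scaleR_right)
  show "closed (F \<omega>)" by (intro closed_Collect_eq continuous_intros)
  show "E \<omega> \<inter> F \<omega> = {0}" by (rule E_inter_F[OF \<omega>])
  fix x
  show "\<exists>y\<in>E \<omega>. \<exists>z\<in>F \<omega>. x = y + z"
    by (rule bexI[OF _ P_diff_in_E[of x]], rule bexI[OF _ P_in_F[OF \<omega>, of x]]) simp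
qed

lemma proj_eq_P: "\<omega> \<in> D \<Longrightarrow> proj_onto_along (F \<omega>) (E \<omega>) u = P \<omega> u"
  unfolding proj_onto_along_def
proof (rule the_equality)
  assume \<omega>: "\<omega> \<in> D"
  show "P \<omega> u \<in> F \<omega> \<and> u - P \<omega> u \<in> E \<omega>" using P_in_F[OF \<omega>] P_diff_in_E by blast
  fix v assume v: "v \<in> F \<omega> \<and> u - v \<in> E \<omega>"
  have "P \<omega> u - v \<in> F \<omega>" using P_in_F[OF \<omega>, of u] v by (simp add: blinfun.diff_right)
  moreover have "P \<omega> u - v \<in> E \<omega>" using span_diff[of "u - v" "{w \<omega>}" "u - P \<omega> u"] v P_diff_in_E[of u \<omega>] by simp
  ultimately have "P \<omega> u - v \<in> {0}" using E_inter_F[OF \<omega>] by blast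
  then show "v = P \<omega> u" by simp
qed

lemma P_linear: "bounded_linear (P \<omega>)"
  unfolding P_def by (intro bounded_linear_sub bounded_linear_ident bounded_linear_scaleR_const
      bounded_linear_divide[THEN bounded_linear_compose] blinfun.bounded_linear_right)

lemma P_norm_le: "\<omega> \<in> D \<Longrightarrow> norm (P \<omega> u) \<le> 2 / q \<omega> * norm u"
proof -
  assume \<omega>: "\<omega> \<in> D"
  have "norm (P \<omega> u) \<le> norm u + \<bar>blinfun_apply (wd \<omega>) u\<bar> / q \<omega>"
    using norm_triangle_ineq4[of u "(blinfun_apply (wd \<omega>) u / q \<omega>) *\<^sub>R w \<omega>"] q_pos[OF \<omega>]
    by (simp add: P_def w_norm[OF \<omega>])
  also have "\<bar>blinfun_apply (wd \<omega>) u\<bar> / q \<omega> \<le> norm u / q \<omega>"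
  proof (rule divide_right_mono)
    show "\<bar>blinfun_apply (wd \<omega>) u\<bar> \<le> norm u" using norm_blinfun[of "wd \<omega>" u] by (simp add: wd_norm[OF \<omega>])
  qed (use q_pos[OF \<omega>] in simp)
  finally have 1: "norm (P \<omega> u) \<le> norm u + norm u / q \<omega>" by simp
  have "norm u \<le> norm u / q \<omega>" using q_pos[OF \<omega>] q_le_1[OF \<omega>] by (simp add: le_divide_eq mult_left_le)
  with 1 show ?thesis by simp
qed

text \<open>This is where dimension at least 2 enters. A nonzero fixed vector of the projection
  forces \<open>onorm (P \<omega>)\<close> to be at least 1, so its logarithm is nonnegative and
  only upper bounds remain to be shown.\<close>

lemma F_nontrivial: "\<exists>u. u \<noteq> 0 \<and> u \<in> F \<omega>"
proof -
  obtain u v :: 'a where uv: "u \<noteq> v" "independent {u, v}" using dim_ge_2 by blast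
  then have u0: "u \<noteq> 0" using dependent_zero[of "{u, v}"] by auto
  show ?thesis
  proof (cases "blinfun_apply (wd \<omega>) u = 0")
    case False
    define z where "z = v - (blinfun_apply (wd \<omega>) v / blinfun_apply (wd \<omega>) u) *\<^sub>R u"
    have "z \<noteq> 0"
    proof
      assume "z = 0"
      then have "v \<in> span {u}" by (auto simp: z_def span_singleton)
      moreover have "v \<notin> span ({u, v} - {v})" using uv(2) unfolding dependent_def by blast
      moreover have "{u, v} - {v} = {u}" using uv(1) by auto
      ultimately show False by simp
    qed
    moreover have "z \<in> F \<omega>" using False by (simp add: z_def blinfun.diff_right blinfun.scaleR_right)
    ultimately show ?thesis by blast
  qed (use u0 in auto)
qed

lemma onorm_P_ge_1: "1 \<le> onorm (P \<omega>)"
proof -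
  obtain u where u: "u \<noteq> 0" "u \<in> F \<omega>" using F_nontrivial by blast
  have "norm (P \<omega> u) \<le> onorm (P \<omega>) * norm u" by (rule onorm[OF P_linear])
  then show ?thesis using u by (simp add: P_of_F)
qed

lemma onorm_P_le: "\<omega> \<in> D \<Longrightarrow> onorm (P \<omega>) \<le> 2 / q \<omega>"
  by (rule onorm_bound) (use P_norm_le q_pos in \<open>auto simp: less_imp_le\<close>)

subsection \<open>Measurability\<close>

lemma ap_pullback_measurable: "(\<lambda>\<omega>. ap (\<theta> r \<omega>) t v) \<in> borel_measurable M" if "0 \<le> t" for r t v
  by (rule ap_measurable) (use that in auto)

lemma D_ident_measurable: "(\<lambda>\<omega>. \<omega>) \<in> restrict_space M D \<rightarrow>\<^sub>M M"
  by (rule measurable_restrict_space1) measurable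

lemma w_measurable: "w \<in> borel_measurable (restrict_space M D)"
proof (rule borel_measurable_LIMSEQ_metric)
  fix n :: nat
  have "(\<lambda>\<omega>. ap (\<theta> (- real n) \<omega>) (real n) e) \<in> borel_measurable M" by (rule ap_pullback_measurable) simp
  then have "(\<lambda>\<omega>. pullback_direction \<theta> U e \<omega> (real n)) \<in> borel_measurable M"
    unfolding pullback_eq by measurable
  then show "(\<lambda>\<omega>. pullback_direction \<theta> U e \<omega> (real n)) \<in> borel_measurable (restrict_space M D)"
    by (rule measurable_restrict_space1)
next
  fix \<omega> assume "\<omega> \<in> space (restrict_space M D)"
  then have "\<omega> \<in> D" by (simp add: space_restrict_space)
  from filterlim_compose[OF w_lim[OF this] filterlim_real_sequentially]
  show "(\<lambda>n. pullback_direction \<theta> U e \<omega> (real n)) \<longlonglongrightarrow> w \<omega>" .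
qed

text \<open>The vector is allowed to depend on \<open>\<omega>\<close> because \<open>q\<close>
  pairs two directions that both vary.\<close>

lemma dual_pullback_app_measurable:
  assumes v: "v \<in> borel_measurable M"
  shows "(\<lambda>\<omega>. blinfun_apply (dual_pullback_direction \<theta> U ed \<omega> (real n)) (v \<omega>)) \<in> borel_measurable (restrict_space M D)"
proof -
  let ?L = "\<lambda>\<omega>. ed o\<^sub>L U \<omega> (real n)"
  have L: "(\<lambda>\<omega>. blinfun_apply (?L \<omega>) (x \<omega>)) \<in> borel_measurable M" if "x \<in> borel_measurable M" for x
  proof -
    have "(\<lambda>\<omega>. ap \<omega> (real n) (x \<omega>)) \<in> borel_measurable M" by (rule ap_measurable) (use that in auto)
    then have "(\<lambda>\<omega>. blinfun_apply ed (ap \<omega> (real n) (x \<omega>))) \<in> borel_measurable M"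
      by (rule borel_measurable_continuous_on[rotated]) (intro continuous_intros)
    then show ?thesis by simp
  qed
  have [measurable]: "(\<lambda>\<omega>. norm (?L \<omega>)) \<in> borel_measurable M"
    by (intro norm_blinfun_measurable measurable_compose[OF L borel_measurable_norm]) auto
  have [measurable]: "(\<lambda>\<omega>. blinfun_apply (?L \<omega>) (v \<omega>)) \<in> borel_measurable M" by (rule L[OF v])
  have "(\<lambda>\<omega>. inverse (norm (?L \<omega>)) * blinfun_apply (?L \<omega>) (v \<omega>)) \<in> borel_measurable M" by measurable
  then have "(\<lambda>\<omega>. inverse (norm (?L \<omega>)) * blinfun_apply (?L \<omega>) (v \<omega>)) \<in> borel_measurable (restrict_space M D)"
    by (rule measurable_restrict_space1)
  also have "?this \<longleftrightarrow> ?thesis"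
    by (rule measurable_cong) (simp add: space_restrict_space dual_pullback_eq D_space blinfun.scaleR_left)
  finally show ?thesis .
qed

lemma wd_app_measurable: "(\<lambda>\<omega>. blinfun_apply (wd \<omega>) u) \<in> borel_measurable (restrict_space M D)"
proof (rule borel_measurable_LIMSEQ_metric)
  fix n :: nat
  show "(\<lambda>\<omega>. blinfun_apply (dual_pullback_direction \<theta> U ed \<omega> (real n)) u) \<in> borel_measurable (restrict_space M D)"
    by (rule dual_pullback_app_measurable) simp
next
  fix \<omega> assume "\<omega> \<in> space (restrict_space M D)"
  then have "\<omega> \<in> D" by (simp add: space_restrict_space)
  from filterlim_compose[OF wd_lim[OF this] filterlim_real_sequentially]
  show "(\<lambda>n. blinfun_apply (dual_pullback_direction \<theta> U ed \<omega> (real n)) u) \<longlonglongrightarrow> blinfun_apply (wd \<omega>) u"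
    by (rule blinfun.tendsto[OF _ tendsto_const])
qed

lemma wd_measurable: "wd \<in> borel_measurable (restrict_space M D)"
  by (rule functional_measurable) (rule wd_app_measurable)

lemma \<rho>_measurable: "0 \<le> t \<Longrightarrow> (\<lambda>\<omega>. \<rho> t \<omega>) \<in> borel_measurable (restrict_space M D)"
  unfolding \<rho>_def
  by (intro measurable_compose[OF ap_measurable borel_measurable_norm] w_measurable D_ident_measurable)

lemma q_measurable: "q \<in> borel_measurable (restrict_space M D)"
proof (rule borel_measurable_LIMSEQ_metric)
  fix n :: nat
  have "(\<lambda>\<omega>. ap (\<theta> (- real n) \<omega>) (real n) e) \<in> borel_measurable M" by (rule ap_pullback_measurable) simp
  then have "(\<lambda>\<omega>. pullback_direction \<theta> U e \<omega> (real n)) \<in> borel_measurable M"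
    unfolding pullback_eq by measurable
  then show "(\<lambda>\<omega>. blinfun_apply (dual_pullback_direction \<theta> U ed \<omega> (real n)) (pullback_direction \<theta> U e \<omega> (real n)))
      \<in> borel_measurable (restrict_space M D)"
    by (rule dual_pullback_app_measurable)
next
  fix \<omega> assume "\<omega> \<in> space (restrict_space M D)"
  then have "\<omega> \<in> D" by (simp add: space_restrict_space)
  from blinfun.tendsto[OF filterlim_compose[OF wd_lim[OF this] filterlim_real_sequentially]
      filterlim_compose[OF w_lim[OF this] filterlim_real_sequentially]]
  show "(\<lambda>n. blinfun_apply (dual_pullback_direction \<theta> U ed \<omega> (real n)) (pullback_direction \<theta> U e \<omega> (real n))) \<longlonglongrightarrow> q \<omega>"
    unfolding q_def .
qed

lemma P_measurable: "(\<lambda>\<omega>. P \<omega> u) \<in> borel_measurable (restrict_space M D)"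
  unfolding P_def
  by (intro borel_measurable_diff borel_measurable_scaleR borel_measurable_divide borel_measurable_const
      wd_app_measurable q_measurable w_measurable)

lemma indicator_measurable:
  fixes h :: "'w \<Rightarrow> real"
  assumes "h \<in> borel_measurable (restrict_space M D)"
  shows "(\<lambda>\<omega>. indicator D \<omega> * h \<omega>) \<in> borel_measurable M"
  using assms by (subst (asm) borel_measurable_restrict_space_iff) auto

subsection \<open>The norm on the complementary subspace\<close>

definition R :: "real \<Rightarrow> 'w \<Rightarrow> real" where "R t \<omega> = restricted_norm (U \<omega> t) (F \<omega>)"

lemma R_bdd: "bdd_above ((\<lambda>u. norm (ap \<omega> t u)) ` {u \<in> F \<omega>. norm u \<le> 1})"
proof (rule bdd_aboveI2)
  fix u assume "u \<in> {u \<in> F \<omega>. norm u \<le> 1}"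
  then have "norm (U \<omega> t) * norm u \<le> norm (U \<omega> t)" by (simp add: mult_left_le)
  then show "norm (ap \<omega> t u) \<le> norm (U \<omega> t)" using norm_blinfun[of "U \<omega> t" u] by linarith
qed

lemma R_nonneg: "0 \<le> R t \<omega>"
  unfolding R_def restricted_norm_def
  by (rule cSUP_upper2[OF R_bdd, of 0]) (auto simp: blinfun.zero_right)

lemma norm_ap_le_R: "u \<in> F \<omega> \<Longrightarrow> norm (ap \<omega> t u) \<le> R t \<omega> * norm u"
proof (cases "u = 0")
  case False
  assume u: "u \<in> F \<omega>"
  have "norm (ap \<omega> t (u /\<^sub>R norm u)) \<le> R t \<omega>"
    unfolding R_def restricted_norm_def
    by (rule cSUP_upper[OF _ R_bdd]) (use u False in \<open>simp add: blinfun.scaleR_right\<close>)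
  then show ?thesis using False by (simp add: blinfun.scaleR_right field_simps)
qed (simp add: blinfun.zero_right)

lemma R_le: "0 \<le> c \<Longrightarrow> (\<And>u. u \<in> F \<omega> \<Longrightarrow> norm (ap \<omega> t u) \<le> c * norm u) \<Longrightarrow> R t \<omega> \<le> c"
  unfolding R_def restricted_norm_def
proof (rule cSUP_least)
  show "{u \<in> F \<omega>. norm u \<le> 1} \<noteq> {}" by (auto intro!: exI[of _ 0] simp: blinfun.zero_right)
  fix u assume c: "0 \<le> c" and *: "\<And>u. u \<in> F \<omega> \<Longrightarrow> norm (ap \<omega> t u) \<le> c * norm u" and u: "u \<in> {u \<in> F \<omega>. norm u \<le> 1}"
  have "norm (ap \<omega> t u) \<le> c * norm u" using * u by blast
  also have "\<dots> \<le> c" using u c by (simp add: mult_left_le)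
  finally show "norm (ap \<omega> t u) \<le> c" .
qed

lemma R_le_norm: "R t \<omega> \<le> norm (U \<omega> t)"
  by (rule R_le) (auto intro: norm_blinfun)

lemma R_submult:
  assumes \<omega>: "\<omega> \<in> D" and s: "0 \<le> s" and t: "0 \<le> t"
  shows "R (s + t) \<omega> \<le> R t (\<theta> s \<omega>) * R s \<omega>"
proof (rule R_le)
  show "0 \<le> R t (\<theta> s \<omega>) * R s \<omega>" by (intro mult_nonneg_nonneg R_nonneg)
  fix u assume u: "u \<in> F \<omega>"
  have "norm (ap \<omega> (s + t) u) = norm (ap (\<theta> s \<omega>) t (ap \<omega> s u))" by (simp add: ap_add[OF D_space[OF \<omega>] s t])
  also have "\<dots> \<le> R t (\<theta> s \<omega>) * norm (ap \<omega> s u)" by (rule norm_ap_le_R[OF F_flow[OF \<omega> s u]])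
  also have "\<dots> \<le> R t (\<theta> s \<omega>) * (R s \<omega> * norm u)" by (intro mult_left_mono norm_ap_le_R u R_nonneg)
  finally show "norm (ap \<omega> (s + t) u) \<le> R t (\<theta> s \<omega>) * R s \<omega> * norm u" by (simp add: mult.assoc)
qed

text \<open>The supremum runs over a fibre that moves with \<open>\<omega>\<close>. Projecting a
  fixed countable dense set of \<open>X\<close> by \<open>P \<omega>\<close> gives test vectors that
  suffice in every fibre and depend measurably on \<open>\<omega>\<close>.\<close>

lemma R_measurable:
  assumes t: "0 \<le> t"
  shows "(\<lambda>\<omega>. R t \<omega>) \<in> borel_measurable (restrict_space M D)"
proof -
  obtain S :: "'a set" where S: "countable S" and cl: "closure S = UNIV"
    by (rule countable_dense_closure)
  have iff: "R t \<omega> \<le> a \<longleftrightarrow> 0 \<le> a \<and> (\<forall>d\<in>S. norm (ap \<omega> t (P \<omega> d)) \<le> a * norm (P \<omega> d))" if \<omega>: "\<omega> \<in> D" for a \<omega>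
  proof safe
    assume *: "R t \<omega> \<le> a"
    then show "0 \<le> a" using R_nonneg order_trans by blast
    fix d
    show "norm (ap \<omega> t (P \<omega> d)) \<le> a * norm (P \<omega> d)"
      using norm_ap_le_R[OF P_in_F[OF \<omega>], of t d] mult_right_mono[OF * norm_ge_zero[of "P \<omega> d"]] by linarith
  next
    assume a: "0 \<le> a" and *: "\<forall>d\<in>S. norm (ap \<omega> t (P \<omega> d)) \<le> a * norm (P \<omega> d)"
    have cont: "continuous_on UNIV (P \<omega>)" using linear_continuous_on[OF P_linear] .
    have "closed {x. norm (ap \<omega> t (P \<omega> x)) \<le> a * norm (P \<omega> x)}"
      by (intro closed_Collect_le continuous_intros cont)
    then have "closure S \<subseteq> {x. norm (ap \<omega> t (P \<omega> x)) \<le> a * norm (P \<omega> x)}"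
      by (intro closure_minimal) (use * in auto)
    then have all: "norm (ap \<omega> t (P \<omega> x)) \<le> a * norm (P \<omega> x)" for x unfolding cl by auto
    show "R t \<omega> \<le> a"
    proof (rule R_le[OF a])
      fix u assume "u \<in> F \<omega>"
      from all[of u] show "norm (ap \<omega> t u) \<le> a * norm u" unfolding P_of_F[OF \<open>u \<in> F \<omega>\<close>] .
    qed
  qed
  show ?thesis
  proof (rule borel_measurableI_le)
    fix a
    let ?N = "restrict_space M D"
    have "{\<omega>\<in>space ?N. 0 \<le> a \<and> (\<forall>d\<in>S. norm (ap \<omega> t (P \<omega> d)) \<le> a * norm (P \<omega> d))} \<in> sets ?N"
      by (intro sets.sets_Collect_conj sets.sets_Collect_const sets.sets_Collect_countable_All'[OF _ S]
          borel_measurable_le measurable_compose[OF ap_measurable borel_measurable_norm]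
          measurable_compose[OF P_measurable borel_measurable_norm] borel_measurable_times borel_measurable_const
          P_measurable D_ident_measurable t)
    also have "{\<omega>\<in>space ?N. 0 \<le> a \<and> (\<forall>d\<in>S. norm (ap \<omega> t (P \<omega> d)) \<le> a * norm (P \<omega> d))} = {\<omega>\<in>space ?N. R t \<omega> \<le> a}"
      using iff by (auto simp: space_restrict_space)
    finally show "{\<omega>\<in>space ?N. R t \<omega> \<le> a} \<in> sets ?N" .
  qed
qed

end

lemma rate_le_Limsup:
  assumes "rate_le F l"
  shows "Limsup at_top (\<lambda>t. ereal (1 / t) * eln (F t)) \<le> l"
proof (rule ccontr)
  assume "\<not> ?thesis"
  then obtain c where c: "l < ereal c" "ereal c < Limsup at_top (\<lambda>t. ereal (1 / t) * eln (F t))"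
    by (meson ereal_dense2 not_le)
  have "\<forall>\<^sub>F t in at_top. F t \<le> exp (c * t)" using assms c(1) by (auto simp: rate_le_def)
  then have "\<forall>\<^sub>F t in at_top. ereal (1 / t) * eln (F t) \<le> ereal c"
    using eventually_gt_at_top[of 0]
  proof eventually_elim
    case (elim t)
    show ?case
    proof (cases "F t \<le> 0")
      case False
      then have "ln (F t) \<le> ln (exp (c * t))" using elim by (subst ln_le_cancel_iff) auto
      then have "1 / t * ln (F t) \<le> c" using elim by (simp add: field_simps)
      then show ?thesis using False by (simp add: eln_def)
    qed (use elim in \<open>simp add: eln_def\<close>)
  qed
  then have "Limsup at_top (\<lambda>t. ereal (1 / t) * eln (F t)) \<le> ereal c" by (rule Limsup_bounded)
  with c(2) show False by simp
qed

lemma int_floor_cases_sublinear: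
  fixes H :: "int \<Rightarrow> real"
  assumes top: "\<And>\<delta>. 0 < \<delta> \<Longrightarrow> \<forall>\<^sub>F n in sequentially. H (int n) \<le> \<delta> * real n"
    and bot: "\<And>\<delta>. 0 < \<delta> \<Longrightarrow> \<forall>\<^sub>F n in sequentially. H (- int n) \<le> \<delta> * real n"
    and L: "\<And>t. 0 \<le> L t" "\<And>t. L t \<le> H \<lfloor>t\<rfloor>"
  shows "((\<lambda>t. 1 / t * L t) \<longlongrightarrow> 0) at_top" and "((\<lambda>t. 1 / t * L t) \<longlongrightarrow> 0) at_bot"
proof -
  show "((\<lambda>t. 1 / t * L t) \<longlongrightarrow> 0) at_top"
  proof (rule tendstoI)
    fix \<epsilon> :: real assume \<epsilon>: "0 < \<epsilon>"
    then obtain N where N: "\<And>n. n \<ge> N \<Longrightarrow> H (int n) \<le> \<epsilon> / 2 * real n"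
      using top[of "\<epsilon> / 2"] by (auto simp: eventually_sequentially)
    have "dist (1 / t * L t) 0 < \<epsilon>" if t: "t \<ge> real N + 1" for t
    proof -
      define n where "n = nat \<lfloor>t\<rfloor>"
      have n: "\<lfloor>t\<rfloor> = int n" "n \<ge> N" "real n \<le> t" using t unfolding n_def by linarith+
      have "L t \<le> \<epsilon> / 2 * real n" using L(2)[of t] N[OF n(2)] unfolding n(1) by linarith
      also have "\<dots> \<le> \<epsilon> / 2 * t" using n \<epsilon> by (intro mult_left_mono) auto
      also have "\<dots> < \<epsilon> * t" using t \<epsilon> by simp
      finally show ?thesis using t L(1)[of t] by (simp add: field_simps)
    qed
    then show "\<forall>\<^sub>F t in at_top. dist (1 / t * L t) 0 < \<epsilon>" unfolding eventually_at_top_linorder by blast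
  qed
  show "((\<lambda>t. 1 / t * L t) \<longlongrightarrow> 0) at_bot"
  proof (rule tendstoI)
    fix \<epsilon> :: real assume \<epsilon>: "0 < \<epsilon>"
    then obtain N where N: "\<And>n. n \<ge> N \<Longrightarrow> H (- int n) \<le> \<epsilon> / 4 * real n"
      using bot[of "\<epsilon> / 4"] by (auto simp: eventually_sequentially)
    have "dist (1 / t * L t) 0 < \<epsilon>" if t: "t \<le> - (real N + 1)" for t
    proof -
      define n where "n = nat (- \<lfloor>t\<rfloor>)"
      \<comment> \<open>For negative \<open>t\<close> rounding down moves away from 0, so
        \<open>n\<close> may exceed \<open>- t\<close>. The factor 2 is paid for by the choice
        \<open>\<epsilon>/4\<close>.\<close>
      have n: "\<lfloor>t\<rfloor> = - int n" "n \<ge> N" "real n \<le> 2 * (- t)" using t unfolding n_def by linarith+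
      have "L t \<le> \<epsilon> / 4 * real n" using L(2)[of t] N[OF n(2)] unfolding n(1) by linarith
      also have "\<dots> \<le> \<epsilon> / 4 * (2 * (- t))" using n \<epsilon> by (intro mult_left_mono) auto
      also have "\<dots> < \<epsilon> * (- t)" using t \<epsilon> by simp
      finally show ?thesis using t L(1)[of t] by (simp add: field_simps)
    qed
    then show "\<forall>\<^sub>F t in at_bot. dist (1 / t * L t) 0 < \<epsilon>" unfolding eventually_at_bot_linorder by blast
  qed
qed

section \<open>Growth rates and temperedness\<close>

context principal_floquet_setting begin

definition r :: "'w \<Rightarrow> real" where "r \<omega> = indicator D \<omega> * ln (\<rho> 1 \<omega>)"

lemma r_measurable [measurable]: "r \<in> borel_measurable M"
proof -
  have "(\<lambda>\<omega>. ln (\<rho> 1 \<omega>)) \<in> borel_measurable (restrict_space M D)"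
    by (rule borel_measurable_ln[OF \<rho>_measurable]) simp
  from indicator_measurable[OF this] show ?thesis unfolding r_def[abs_def] .
qed

lemma r_le_f: "AE \<omega> in M. r \<omega> \<le> f \<omega>"
  using f_bound AE_D
proof eventually_elim
  case (elim \<omega>)
  have "norm (U \<omega> 1) \<le> exp (f \<omega>)" using elim(1) by simp
  then have "\<rho> 1 \<omega> \<le> exp (f \<omega>)" using \<rho>_le_norm[OF elim(2), of 1] by linarith
  then have "ln (\<rho> 1 \<omega>) \<le> ln (exp (f \<omega>))" using \<rho>_pos[OF elim(2), of 1] by (subst ln_le_cancel_iff) auto
  then show ?case using elim by (simp add: r_def)
qed

text \<open>(A1) controls only the positive part, through \<open>f\<close>. If the negative part had
  infinite integral the exponent would be \<open>- \<infinity>\<close>, so finiteness of the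
  exponent is exactly the missing integrability.\<close>

lemma principal_exponent_finite:
  assumes "- \<infinity> < principal_exponent M \<theta> U e"
  shows "integrable M r" and "principal_exponent M \<theta> U e = ereal (\<integral>\<omega>. r \<omega> \<partial>M)"
proof -
  let ?h = "\<lambda>\<omega>. eln (norm (ap \<omega> 1 (w \<omega>)))"
  have h: "AE \<omega> in M. ?h \<omega> = ereal (r \<omega>)"
    using AE_D
  proof eventually_elim
    case (elim \<omega>)
    have "0 < norm (ap \<omega> 1 (w \<omega>))" using \<rho>_pos[OF elim, of 1] by (simp add: \<rho>_def)
    then show ?case using elim by (simp add: eln_def r_def \<rho>_def)
  qed
  have pos: "(\<integral>\<^sup>+\<omega>. e2ennreal (?h \<omega>) \<partial>M) = (\<integral>\<^sup>+\<omega>. ennreal (r \<omega>) \<partial>M)"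
    by (rule nn_integral_cong_AE) (use h in eventually_elim, simp)
  have neg: "(\<integral>\<^sup>+\<omega>. e2ennreal (- ?h \<omega>) \<partial>M) = (\<integral>\<^sup>+\<omega>. ennreal (- r \<omega>) \<partial>M)"
    by (rule nn_integral_cong_AE) (use h in eventually_elim, simp)
  have eq: "principal_exponent M \<theta> U e
      = enn2ereal (\<integral>\<^sup>+\<omega>. ennreal (r \<omega>) \<partial>M) - enn2ereal (\<integral>\<^sup>+\<omega>. ennreal (- r \<omega>) \<partial>M)"
    unfolding principal_exponent_def ext_integral_def pos neg ..
  have "(\<integral>\<^sup>+\<omega>. ennreal (r \<omega>) \<partial>M) \<le> (\<integral>\<^sup>+\<omega>. ennreal (f \<omega>) \<partial>M)"
    by (rule nn_integral_mono_AE) (use r_le_f in eventually_elim, simp add: ennreal_leI)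
  also have "\<dots> < \<infinity>" using f_int f_nonneg by (simp add: nn_integral_eq_integral)
  finally have fin1: "(\<integral>\<^sup>+\<omega>. ennreal (r \<omega>) \<partial>M) < \<infinity>" .
  have fin2: "(\<integral>\<^sup>+\<omega>. ennreal (- r \<omega>) \<partial>M) < \<infinity>"
  proof (rule ccontr)
    assume "\<not> ?thesis"
    then have "(\<integral>\<^sup>+\<omega>. ennreal (- r \<omega>) \<partial>M) = \<infinity>" by (simp add: less_top[symmetric])
    moreover have "enn2ereal (\<integral>\<^sup>+\<omega>. ennreal (r \<omega>) \<partial>M) \<noteq> \<infinity>" using fin1 by (simp add: less_top[symmetric])
    ultimately have "principal_exponent M \<theta> U e = - \<infinity>" unfolding eq by (cases "enn2ereal (\<integral>\<^sup>+\<omega>. ennreal (r \<omega>) \<partial>M)") auto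
    with assms show False by simp
  qed
  show "integrable M r" unfolding real_integrable_def using fin1 fin2 by auto
  then have "(\<integral>\<omega>. r \<omega> \<partial>M) = enn2real (\<integral>\<^sup>+\<omega>. ennreal (r \<omega>) \<partial>M) - enn2real (\<integral>\<^sup>+\<omega>. ennreal (- r \<omega>) \<partial>M)"
    by (rule real_lebesgue_integral_def)
  moreover have "enn2ereal x = ereal (enn2real x)" if "x < \<infinity>" for x
    using that by (cases x) auto
  ultimately show "principal_exponent M \<theta> U e = ereal (\<integral>\<omega>. r \<omega> \<partial>M)"
    unfolding eq using fin1 fin2 by simp
qed

lemma orbit_sum_r:
  assumes "\<omega> \<in> D"
  shows "mp_transformation.orbit_sum (\<theta> 1) r n \<omega> = ln (\<rho> (real n) \<omega>)"
proof -
  interpret T: mp_transformation M "\<theta> 1" by (rule mp_flow)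
  show ?thesis using assms
  proof (induction n arbitrary: \<omega>)
    case 0
    then show ?case by (simp add: \<rho>_def ap_zero[OF D_space] w_norm)
  next
    case (Suc n)
    have "\<rho> (real (Suc n)) \<omega> = \<rho> (real n) (\<theta> 1 \<omega>) * \<rho> 1 \<omega>" using \<rho>_add[OF Suc.prems, of 1 "real n"] by simp
    then have "ln (\<rho> (real (Suc n)) \<omega>) = ln (\<rho> (real n) (\<theta> 1 \<omega>)) + ln (\<rho> 1 \<omega>)"
      using \<rho>_pos[OF Suc.prems, of 1] \<rho>_pos[OF D_flow[OF Suc.prems], of "real n" 1] by (simp add: ln_mult)
    then show ?case using Suc.IH[OF D_flow[OF Suc.prems, of 1]] Suc.prems by (simp add: T.orbit_sum_Suc r_def)
  qed
qed

text \<open>Kingman's theorem gives a constant rate. Since \<open>\<rho>\<close> is multiplicative,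
  its logarithm at integer times is a Birkhoff sum of \<open>r\<close>, and comparing averages with
  integrals for \<open>r\<close> and for \<open>- r\<close> identifies the constant.\<close>

lemma \<rho>_rate:
  assumes r: "integrable M r"
  shows "AE \<omega> in M. rate_le (\<lambda>t. \<rho> t \<omega>) (ereal (\<integral>\<omega>. r \<omega> \<partial>M)) \<and> rate_ge (\<lambda>t. \<rho> t \<omega>) (ereal (\<integral>\<omega>. r \<omega> \<partial>M))"
proof -
  interpret T: mp_transformation M "\<theta> 1" by (rule mp_flow)
  have "\<exists>l. AE \<omega> in M. rate_le (\<lambda>t. \<rho> t \<omega>) l \<and> rate_ge (\<lambda>t. \<rho> t \<omega>) l"
  proof (rule subadditive_flow_rate[OF D_inv D_prob])
    show "0 \<le> \<rho> t \<omega>" for t \<omega> by (simp add: \<rho>_def)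
    show "\<rho> (s + t) \<omega> \<le> \<rho> t (\<theta> s \<omega>) * \<rho> s \<omega>" if "\<omega> \<in> D" "0 \<le> s" "0 \<le> t" for s t \<omega> using \<rho>_add[OF that] by simp
    show "(\<lambda>\<omega>. indicator D \<omega> * \<rho> (real n) \<omega>) \<in> borel_measurable M" for n
      by (rule indicator_measurable[OF \<rho>_measurable]) simp
    show "AE \<omega> in M. \<omega> \<in> D \<longrightarrow> (\<forall>s\<in>{0..1}. \<rho> s \<omega> \<le> exp (f \<omega>))"
      using f_bound by eventually_elim (use \<rho>_le_norm order_trans in blast)
    show "AE \<omega> in M. \<omega> \<in> D \<longrightarrow> (\<forall>s\<in>{0..1}. \<rho> (1 - s) (\<theta> s \<omega>) \<le> exp (g \<omega>))"
      using g_bound by eventually_elim (use \<rho>_le_norm D_flow order_trans in blast)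
  qed (use f_int f_nonneg g_int in auto)
  then obtain l where l: "AE \<omega> in M. rate_le (\<lambda>t. \<rho> t \<omega>) l \<and> rate_ge (\<lambda>t. \<rho> t \<omega>) l" by blast
  have "l \<le> ereal (\<integral>\<omega>. r \<omega> \<partial>M)"
  proof (rule ccontr)
    assume "\<not> ?thesis"
    then obtain c where c: "ereal (\<integral>\<omega>. r \<omega> \<partial>M) < ereal c" "ereal c < l" by (meson ereal_dense2 not_le)
    have "AE \<omega> in M. \<forall>\<^sub>F n in sequentially. c * real n \<le> T.orbit_sum r n \<omega>"
      using l AE_D
    proof eventually_elim
      case (elim \<omega>)
      then have "\<forall>\<^sub>F t in at_top. exp (c * t) \<le> \<rho> t \<omega>" using c(2) by (auto simp: rate_ge_def)
      then have "\<forall>\<^sub>F n in sequentially. exp (c * real n) \<le> \<rho> (real n) \<omega>"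
        using filterlim_real_sequentially unfolding filterlim_iff by blast
      then show ?case
        by eventually_elim (use \<rho>_pos[OF elim(2)] in \<open>simp add: orbit_sum_r[OF elim(2)] ln_ge_iff\<close>)
    qed
    from T.ergodic_average_le_integral[OF r this] c(1) show False by simp
  qed
  moreover have "ereal (\<integral>\<omega>. r \<omega> \<partial>M) \<le> l"
  proof (rule ccontr)
    assume "\<not> ?thesis"
    then obtain c where c: "l < ereal c" "ereal c < ereal (\<integral>\<omega>. r \<omega> \<partial>M)" by (meson ereal_dense2 not_le)
    have "AE \<omega> in M. \<forall>\<^sub>F n in sequentially. - c * real n \<le> T.orbit_sum (\<lambda>\<omega>. - r \<omega>) n \<omega>"
      using l AE_D
    proof eventually_elim
      case (elim \<omega>)
      then have "\<forall>\<^sub>F t in at_top. \<rho> t \<omega> \<le> exp (c * t)" using c(1) by (auto simp: rate_le_def)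
      then have "\<forall>\<^sub>F n in sequentially. \<rho> (real n) \<omega> \<le> exp (c * real n)"
        using filterlim_real_sequentially unfolding filterlim_iff by blast
      then show ?case
      proof eventually_elim
        case (elim n)
        have "ln (\<rho> (real n) \<omega>) \<le> ln (exp (c * real n))"
          using \<rho>_pos[OF \<open>\<omega> \<in> D\<close>, of "real n"] elim by (subst ln_le_cancel_iff) auto
        moreover have "T.orbit_sum (\<lambda>\<omega>. - r \<omega>) n \<omega> = - T.orbit_sum r n \<omega>"
          by (simp add: T.orbit_sum_def sum_negf)
        ultimately show ?case using orbit_sum_r[OF \<open>\<omega> \<in> D\<close>, of n] by simp
      qed
    qed
    moreover have "integrable M (\<lambda>\<omega>. - r \<omega>)" using r by simp
    ultimately have "- c \<le> (\<integral>\<omega>. - r \<omega> \<partial>M)" by (intro T.ergodic_average_le_integral)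
    then show False using c(2) by simp
  qed
  ultimately have "l = ereal (\<integral>\<omega>. r \<omega> \<partial>M)" by (rule antisym)
  with l show ?thesis by simp
qed

lemma R_rate: "\<exists>l. AE \<omega> in M. rate_le (\<lambda>t. R t \<omega>) l \<and> rate_ge (\<lambda>t. R t \<omega>) l"
proof (rule subadditive_flow_rate[OF D_inv D_prob])
  show "(\<lambda>\<omega>. indicator D \<omega> * R (real n) \<omega>) \<in> borel_measurable M" for n
    by (rule indicator_measurable[OF R_measurable]) simp
  show "AE \<omega> in M. \<omega> \<in> D \<longrightarrow> (\<forall>s\<in>{0..1}. R s \<omega> \<le> exp (f \<omega>))"
    using f_bound by eventually_elim (use R_le_norm order_trans in blast)
  show "AE \<omega> in M. \<omega> \<in> D \<longrightarrow> (\<forall>s\<in>{0..1}. R (1 - s) (\<theta> s \<omega>) \<le> exp (g \<omega>))"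
    using g_bound by eventually_elim (use R_le_norm order_trans in blast)
qed (use f_int f_nonneg g_int R_nonneg R_submult in auto)

text \<open>The exponential contraction of oscillations at a single typical point already separates the two rates,
  since both are almost surely constant.\<close>

lemma R_rate_less:
  assumes \<rho>: "AE \<omega> in M. rate_le (\<lambda>t. \<rho> t \<omega>) (ereal m)"
    and R: "AE \<omega> in M. rate_ge (\<lambda>t. R t \<omega>) l"
  shows "l < ereal m"
proof (rule ccontr)
  assume "\<not> l < ereal m"
  then have ml: "ereal m \<le> l" by simp
  have "AE \<omega> in M. False"
    using \<rho> R AE_D AE_contr_decay
  proof eventually_elim
    case (elim \<omega>)
    note \<omega> = elim(3)
    have sp: "\<omega> \<in> space M" by (rule D_space[OF \<omega>])
    obtain a where a: "a > 0" "\<And>n. contr (\<theta> 1 \<omega>) n \<le> exp (- a * real n)" using elim(4) by blast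
    have "contr (\<theta> 1 \<omega>) \<longlonglongrightarrow> 0"
      by (rule tendsto_sandwich[OF _ _ tendsto_const exp_decay_tendsto_0[OF a(1)]])
         (intro always_eventually allI contr_nonneg flow_space sp a(2))+
    from dual_limit_exists[OF sp this] obtain h c where
      h: "(dual_pullback_direction \<theta> U ed \<omega> \<longlongrightarrow> h) at_top" and c: "0 \<le> c" and
      decay: "\<And>n u. blinfun_apply h u = 0 \<Longrightarrow>
        norm (ap \<omega> (real (Suc n)) u) \<le> c * norm u * contr (\<theta> 1 \<omega>) n * norm (ap \<omega> (real (Suc n)) e)"
      by blast
    have h_eq: "h = wd \<omega>" by (rule tendsto_unique[OF _ h wd_lim[OF \<omega>]]) simp
    define k where "k = \<kappa> (\<theta> (- 1) \<omega>)"
    have k: "1 \<le> k" unfolding k_def by (rule \<kappa>_ge_1[OF flow_space[OF sp]])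
    have R_le: "R (real (Suc n)) \<omega> \<le> c * exp (- a * real n) * (k * \<rho> (real (Suc n)) \<omega>)" for n
    proof (rule R_le)
      show "0 \<le> c * exp (- a * real n) * (k * \<rho> (real (Suc n)) \<omega>)" using c k by (simp add: \<rho>_def)
      fix u assume "u \<in> F \<omega>"
      then have "norm (ap \<omega> (real (Suc n)) u) \<le> c * norm u * contr (\<theta> 1 \<omega>) n * norm (ap \<omega> (real (Suc n)) e)"
        using decay h_eq by simp
      also have "\<dots> \<le> c * norm u * exp (- a * real n) * (k * \<rho> (real (Suc n)) \<omega>)"
        using c a(2) contr_nonneg[OF flow_space[OF sp], of 1 n] ap_e_le_\<rho>[OF \<omega>, of "real (Suc n)"] unfolding k_def
        by (intro mult_mono mult_left_mono) auto
      finally show "norm (ap \<omega> (real (Suc n)) u) \<le> c * exp (- a * real n) * (k * \<rho> (real (Suc n)) \<omega>) * norm u"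
        by (simp only: mult_ac)
    qed
    have lt: "ereal (m - a / 4) < l" 
    proof -
      have "ereal (m - a / 4) < ereal m" using a(1) by simp
      then show ?thesis using ml by (rule less_le_trans)
    qed
    have "\<forall>\<^sub>F t in at_top. exp ((m - a / 4) * t) \<le> R t \<omega>" using elim(2) lt by (auto simp: rate_ge_def)
    moreover have "\<forall>\<^sub>F t in at_top. \<rho> t \<omega> \<le> exp ((m + a / 4) * t)" using elim(1) a(1) by (auto simp: rate_le_def)
    \<comment> \<open>The quarters bring \<open>R\<close> and \<open>\<rho>\<close> to within
      \<open>exp (a / 2 * t)\<close> of each other, against a decay \<open>exp (- a * t)\<close>.
      The remaining \<open>a / 2\<close> beats the constant, where \<open>exp a\<close> arises
      because \<open>n\<close> contracting steps correspond to the time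
      \<open>n + 1\<close>.\<close>
    moreover have "\<forall>\<^sub>F t in at_top. c * k * exp a + 1 \<le> exp (a / 2 * t)" by (rule eventually_const_le_exp) (use a(1) in simp)
    ultimately have "\<forall>\<^sub>F t in at_top. exp ((m - a / 4) * t) \<le> R t \<omega> \<and> \<rho> t \<omega> \<le> exp ((m + a / 4) * t) \<and> c * k * exp a + 1 \<le> exp (a / 2 * t)"
      by eventually_elim blast
    then obtain N where N: "\<And>t. t \<ge> N \<Longrightarrow> exp ((m - a / 4) * t) \<le> R t \<omega> \<and> \<rho> t \<omega> \<le> exp ((m + a / 4) * t) \<and> c * k * exp a + 1 \<le> exp (a / 2 * t)"
      by (auto simp: eventually_at_top_linorder)
    obtain n :: nat where n: "N \<le> real n" using real_arch_simple by blast
    define t where "t = real (Suc n)"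
    have tN: "t \<ge> N" using n by (simp add: t_def)
    have "exp ((m - a / 4) * t) \<le> c * exp (- a * real n) * (k * \<rho> t \<omega>)"
      using N[OF tN] R_le[of n] unfolding t_def by linarith
    also have "\<dots> \<le> c * exp (- a * real n) * (k * exp ((m + a / 4) * t))"
      using N[OF tN] c k by (intro mult_left_mono) auto
    also have "\<dots> = (c * k * exp a) * exp ((m + a / 4) * t - a * t)"
      by (simp add: t_def exp_add[symmetric] exp_diff algebra_simps exp_minus field_simps)
    also have "\<dots> < exp (a / 2 * t) * exp ((m + a / 4) * t - a * t)"
      using N[OF tN] by (intro mult_strict_right_mono) auto
    also have "\<dots> = exp ((m - a / 4) * t)" by (simp add: exp_add[symmetric] algebra_simps)
    finally show False by simp
  qed
  then show False by simp
qed

section \<open>Transport of rates along orbits and growth of the full cocycle\<close>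

lemma \<rho>_rate_shift:
  assumes \<omega>: "\<omega> \<in> D"
  shows "0 \<le> s \<Longrightarrow> rate_le (\<lambda>t. \<rho> t (\<theta> s \<omega>)) l \<Longrightarrow> rate_le (\<lambda>t. \<rho> t \<omega>) l"
    and "s \<le> 0 \<Longrightarrow> rate_ge (\<lambda>t. \<rho> t (\<theta> s \<omega>)) l \<Longrightarrow> rate_ge (\<lambda>t. \<rho> t \<omega>) l"
proof -
  assume s: "0 \<le> s" and l: "rate_le (\<lambda>t. \<rho> t (\<theta> s \<omega>)) l"
  show "rate_le (\<lambda>t. \<rho> t \<omega>) l"
  proof (rule rate_le_shift[OF l, of _ s "\<rho> s \<omega>"])
    show "\<forall>\<^sub>F t in at_top. \<rho> (s + t) \<omega> \<le> \<rho> s \<omega> * \<rho> t (\<theta> s \<omega>)"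
      using eventually_ge_at_top[of 0] by eventually_elim (simp add: \<rho>_add[OF \<omega> s] mult.commute)
  qed (simp add: \<rho>_def)
next
  assume s: "s \<le> 0" and l: "rate_ge (\<lambda>t. \<rho> t (\<theta> s \<omega>)) l"
  have ret: "\<theta> (- s) (\<theta> s \<omega>) = \<omega>" by (simp add: flow_flow[OF D_space[OF \<omega>]] flow_zero[OF D_space[OF \<omega>]])
  show "rate_ge (\<lambda>t. \<rho> t \<omega>) l"
  proof (rule rate_ge_shift[OF l, of "\<rho> (- s) (\<theta> s \<omega>)" _ s])
    show "\<forall>\<^sub>F t in at_top. \<rho> t (\<theta> s \<omega>) \<le> \<rho> (- s) (\<theta> s \<omega>) * \<rho> (s + t) \<omega>"
      using eventually_ge_at_top[of "- s"]
    proof eventually_elim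
      case (elim t)
      then show ?case using \<rho>_add[OF D_flow[OF \<omega>, of s], of "- s" "s + t"] s unfolding ret by (simp add: mult.commute)
    qed
  qed (simp add: \<rho>_def)
qed

text \<open>Submultiplicativity is one-sided. An upper rate at a later point bounds the one here,
  and a lower rate at an earlier point forces one here; neither implication can be reversed in this
  way.\<close>

lemma R_rate_shift:
  assumes \<omega>: "\<omega> \<in> D"
  shows "0 \<le> s \<Longrightarrow> rate_le (\<lambda>t. R t (\<theta> s \<omega>)) l \<Longrightarrow> rate_le (\<lambda>t. R t \<omega>) l"
    and "s \<le> 0 \<Longrightarrow> rate_ge (\<lambda>t. R t (\<theta> s \<omega>)) l \<Longrightarrow> rate_ge (\<lambda>t. R t \<omega>) l"
proof -
  assume s: "0 \<le> s" and l: "rate_le (\<lambda>t. R t (\<theta> s \<omega>)) l"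
  show "rate_le (\<lambda>t. R t \<omega>) l"
  proof (rule rate_le_shift[OF l, of _ s "R s \<omega>"])
    show "\<forall>\<^sub>F t in at_top. R (s + t) \<omega> \<le> R s \<omega> * R t (\<theta> s \<omega>)"
      using eventually_ge_at_top[of 0] by eventually_elim (use R_submult[OF \<omega> s] in \<open>simp add: mult.commute\<close>)
  qed (simp add: R_nonneg)
next
  assume s: "s \<le> 0" and l: "rate_ge (\<lambda>t. R t (\<theta> s \<omega>)) l"
  have ret: "\<theta> (- s) (\<theta> s \<omega>) = \<omega>" by (simp add: flow_flow[OF D_space[OF \<omega>]] flow_zero[OF D_space[OF \<omega>]])
  show "rate_ge (\<lambda>t. R t \<omega>) l"
  proof (rule rate_ge_shift[OF l, of "R (- s) (\<theta> s \<omega>)" _ s])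
    show "\<forall>\<^sub>F t in at_top. R t (\<theta> s \<omega>) \<le> R (- s) (\<theta> s \<omega>) * R (s + t) \<omega>"
      using eventually_ge_at_top[of "- s"]
    proof eventually_elim
      case (elim t)
      then show ?case using R_submult[OF D_flow[OF \<omega>, of s], of "- s" "s + t"] s unfolding ret by (simp add: mult.commute)
    qed
  qed (simp add: R_nonneg)
qed

lemma R_small:
  assumes \<omega>: "\<omega> \<in> D" and \<rho>: "rate_ge (\<lambda>t. \<rho> t \<omega>) (ereal m)" and R: "rate_le (\<lambda>t. R t \<omega>) l"
    and lm: "l < ereal m" and \<epsilon>: "0 < \<epsilon>"
  shows "\<forall>\<^sub>F t in at_top. R t \<omega> \<le> \<epsilon> * \<rho> t \<omega>"
proof -
  have "rate_le (\<lambda>t. R t \<omega> / \<rho> t \<omega>) (l - ereal m)" by (rule rate_le_divide[OF R \<rho>]) (simp add: R_nonneg)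
  moreover have "l - ereal m < ereal 0" using lm by (cases l) auto
  then obtain c where c: "l - ereal m < ereal c" "ereal c < ereal 0" using ereal_dense2 by blast
  ultimately have "\<forall>\<^sub>F t in at_top. R t \<omega> / \<rho> t \<omega> \<le> exp (c * t)" by (auto simp: rate_le_def)
  moreover have "\<forall>\<^sub>F t in at_top. 1 / \<epsilon> \<le> exp (- c * t)" by (rule eventually_const_le_exp) (use c in simp)
  ultimately show ?thesis using eventually_ge_at_top[of 0]
  proof eventually_elim
    case (elim t)
    have "exp (c * t) \<le> \<epsilon>" using elim(2) \<epsilon> by (simp add: exp_minus field_simps)
    then have "R t \<omega> / \<rho> t \<omega> \<le> \<epsilon>" using elim(1) by linarith
    then show ?case using \<rho>_pos[OF \<omega> elim(3)] by (simp add: field_simps)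
  qed
qed

lemma ap_decomp: "ap \<omega> t u = (blinfun_apply (wd \<omega>) u / q \<omega>) *\<^sub>R ap \<omega> t (w \<omega>) + ap \<omega> t (P \<omega> u)"
  by (simp add: P_def blinfun.diff_right blinfun.scaleR_right)

text \<open>Split \<open>u\<close> along the decomposition: the part in \<open>E\<close> grows
  exactly like \<open>\<rho>\<close>, and the part in \<open>F\<close> is negligible against it. The
  constant 3 is 1 for the first part and 2 from the norm of the projection. For \<open>u\<close>
  outside \<open>F\<close> the coefficient of \<open>w\<close> is nonzero, so the first part
  dominates from below as well.\<close>

lemma norm_U_rate:
  assumes \<omega>: "\<omega> \<in> D" and \<rho>: "rate_le (\<lambda>t. \<rho> t \<omega>) (ereal m)" "rate_ge (\<lambda>t. \<rho> t \<omega>) (ereal m)"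
    and R: "rate_le (\<lambda>t. R t \<omega>) l" and lm: "l < ereal m"
  shows "rate_le (\<lambda>t. norm (U \<omega> t)) (ereal m)" and "rate_ge (\<lambda>t. norm (U \<omega> t)) (ereal m)"
    and "rate_le (\<lambda>t. norm (ap \<omega> t u)) (ereal m)"
    and "u \<notin> F \<omega> \<Longrightarrow> rate_ge (\<lambda>t. norm (ap \<omega> t u)) (ereal m)"
proof -
  have q: "0 < q \<omega>" by (rule q_pos[OF \<omega>])
  have ev: "\<forall>\<^sub>F t in at_top. norm (U \<omega> t) \<le> 3 / q \<omega> * \<rho> t \<omega>"
    using R_small[OF \<omega> \<rho>(2) R lm zero_less_one] eventually_ge_at_top[of 0]
  proof eventually_elim
    case (elim t)
    have \<rho>0: "0 \<le> \<rho> t \<omega>" by (simp add: \<rho>_def)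
    show ?case
    proof (rule norm_blinfun_bound)
      show "0 \<le> 3 / q \<omega> * \<rho> t \<omega>" using q \<rho>0 by simp
      fix u
      have "norm (ap \<omega> t u) \<le> norm ((blinfun_apply (wd \<omega>) u / q \<omega>) *\<^sub>R ap \<omega> t (w \<omega>)) + norm (ap \<omega> t (P \<omega> u))"
        by (subst ap_decomp) (rule norm_triangle_ineq)
      also have "norm ((blinfun_apply (wd \<omega>) u / q \<omega>) *\<^sub>R ap \<omega> t (w \<omega>)) = \<bar>blinfun_apply (wd \<omega>) u\<bar> * (\<rho> t \<omega> / q \<omega>)"
        using q by (simp add: \<rho>_def)
      also have "\<dots> \<le> norm u * (\<rho> t \<omega> / q \<omega>)"
        using norm_blinfun[of "wd \<omega>" u] q \<rho>0 by (intro mult_right_mono) (auto simp: wd_norm[OF \<omega>])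
      also have "norm (ap \<omega> t (P \<omega> u)) \<le> R t \<omega> * norm (P \<omega> u)" by (rule norm_ap_le_R[OF P_in_F[OF \<omega>]])
      also have "\<dots> \<le> \<rho> t \<omega> * (2 / q \<omega> * norm u)"
        using elim(1) by (intro mult_mono P_norm_le[OF \<omega>] \<rho>0) auto
      finally show "norm (ap \<omega> t u) \<le> 3 / q \<omega> * \<rho> t \<omega> * norm u" by (simp add: field_simps)
    qed
  qed
  have \<rho>0: "\<forall>\<^sub>F t in at_top. 0 \<le> \<rho> t \<omega>" by (simp add: \<rho>_def)
  show le: "rate_le (\<lambda>t. norm (U \<omega> t)) (ereal m)"
    by (rule rate_le_shift[OF \<rho>(1) _ \<rho>0, of _ 0 "3 / q \<omega>"]) (use ev in simp)
  show "rate_ge (\<lambda>t. norm (U \<omega> t)) (ereal m)"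
    by (rule rate_ge_shift[OF \<rho>(2), of 1 _ 0]) (simp_all add: \<rho>_le_norm[OF \<omega>])
  show "rate_le (\<lambda>t. norm (ap \<omega> t u)) (ereal m)"
  proof (rule rate_le_shift[OF le, of _ 0 "norm u"])
    show "\<forall>\<^sub>F t in at_top. norm (ap \<omega> (0 + t) u) \<le> norm u * norm (U \<omega> t)"
      by (rule always_eventually) (simp add: norm_blinfun mult.commute[of "norm u"])
  qed simp
  show "rate_ge (\<lambda>t. norm (ap \<omega> t u)) (ereal m)" if u: "u \<notin> F \<omega>"
  proof (rule rate_ge_shift[OF \<rho>(2)])
    define b where "b = \<bar>blinfun_apply (wd \<omega>) u\<bar> / q \<omega>"
    have b: "0 < b" using u q by (simp add: b_def)
    define x where "x = norm (P \<omega> u) + 1"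
    have x: "0 < x" "norm (P \<omega> u) \<le> x" by (simp_all add: x_def add_nonneg_pos)
    \<comment> \<open>With this choice the part in \<open>F\<close> takes away at most half of
      \<open>b * \<rho> t \<omega>\<close>; \<open>x\<close> exceeds the norm of
      \<open>P \<omega> u\<close> by 1 so that it can be divided by.\<close>
    define \<epsilon> where "\<epsilon> = b / 2 / x"
    have \<epsilon>: "0 < \<epsilon>" using b x by (simp add: \<epsilon>_def)
    show "\<forall>\<^sub>F t in at_top. \<rho> t \<omega> \<le> (2 / b) * norm (ap \<omega> (0 + t) u)"
      using R_small[OF \<omega> \<rho>(2) R lm \<epsilon>] eventually_ge_at_top[of 0]
    proof eventually_elim
      case (elim t)
      have \<rho>0: "0 \<le> \<rho> t \<omega>" by (simp add: \<rho>_def)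
      have "b * \<rho> t \<omega> = norm ((blinfun_apply (wd \<omega>) u / q \<omega>) *\<^sub>R ap \<omega> t (w \<omega>))" using q by (simp add: b_def \<rho>_def)
      also have "(blinfun_apply (wd \<omega>) u / q \<omega>) *\<^sub>R ap \<omega> t (w \<omega>) = ap \<omega> t u - ap \<omega> t (P \<omega> u)"
        using ap_decomp[of \<omega> t u] by simp
      also have "norm \<dots> \<le> norm (ap \<omega> t u) + norm (ap \<omega> t (P \<omega> u))" by (rule norm_triangle_ineq4)
      also have "norm (ap \<omega> t (P \<omega> u)) \<le> R t \<omega> * norm (P \<omega> u)" by (rule norm_ap_le_R[OF P_in_F[OF \<omega>]])
      also have "\<dots> \<le> (\<epsilon> * \<rho> t \<omega>) * norm (P \<omega> u)" using elim(1) by (intro mult_right_mono) auto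
      also have "\<dots> = \<rho> t \<omega> * (\<epsilon> * norm (P \<omega> u))" by (simp only: mult_ac)
      also have "\<dots> \<le> \<rho> t \<omega> * (b / 2)"
      proof (rule mult_left_mono[OF _ \<rho>0])
        have "\<epsilon> * norm (P \<omega> u) \<le> \<epsilon> * x" using \<epsilon> x by (intro mult_left_mono) auto
        also have "\<dots> = b / 2" using x by (simp add: \<epsilon>_def)
        finally show "\<epsilon> * norm (P \<omega> u) \<le> b / 2" .
      qed
      finally show ?case using b by (simp add: field_simps)
    qed
  qed simp
qed

text \<open>\<open>q_flow\<close> is applied on the rest \<open>[t, 1]\<close> of the unit interval.
  Upper bounds for the norms over \<open>[0, t]\<close> and \<open>[t, 1]\<close> come from
  \<open>f\<close> and \<open>g\<close>; the only lower bound required is the one for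
  \<open>\<rho> 1 \<omega>\<close>, and \<open>\<bar>r \<omega>\<bar>\<close> supplies it. Thus the
  value at any intermediate time is bounded through the next integer time.\<close>

lemma q_increment:
  assumes \<omega>: "\<omega> \<in> D" and t: "0 \<le> t" "t \<le> 1"
    and f: "norm (U \<omega> t) \<le> exp (f \<omega>)" and g: "norm (U (\<theta> t \<omega>) (1 - t)) \<le> exp (g \<omega>)"
  shows "- ln (q (\<theta> t \<omega>)) \<le> - ln (q (\<theta> 1 \<omega>)) + \<bar>r \<omega>\<bar> + f \<omega> + g \<omega>"
proof -
  have \<omega>t: "\<theta> t \<omega> \<in> D" by (rule D_flow[OF \<omega>])
  have fl: "\<theta> (1 - t) (\<theta> t \<omega>) = \<theta> 1 \<omega>" by (simp add: flow_flow[OF D_space[OF \<omega>]])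
  have "\<rho> 1 \<omega> * q (\<theta> 1 \<omega>) = \<rho> t \<omega> * (\<rho> (1 - t) (\<theta> t \<omega>) * q (\<theta> (1 - t) (\<theta> t \<omega>)))"
    unfolding fl using \<rho>_add[OF \<omega> t(1), of "1 - t"] t by simp
  also have "\<rho> (1 - t) (\<theta> t \<omega>) * q (\<theta> (1 - t) (\<theta> t \<omega>))
      = norm (wd (\<theta> (1 - t) (\<theta> t \<omega>)) o\<^sub>L U (\<theta> t \<omega>) (1 - t)) * q (\<theta> t \<omega>)"
    by (rule q_flow[OF \<omega>t]) (use t in simp)
  also have "\<rho> t \<omega> * \<dots> \<le> exp (f \<omega>) * (exp (g \<omega>) * q (\<theta> t \<omega>))"
  proof (intro mult_mono)
    show "\<rho> t \<omega> \<le> exp (f \<omega>)" using \<rho>_le_norm[OF \<omega>, of t] f by linarith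
    show "norm (wd (\<theta> (1 - t) (\<theta> t \<omega>)) o\<^sub>L U (\<theta> t \<omega>) (1 - t)) \<le> exp (g \<omega>)"
      using norm_wd_comp_le[OF \<omega>t, of "1 - t"] g by linarith
  qed (use q_pos[OF \<omega>t] in auto)
  finally have le: "\<rho> 1 \<omega> * q (\<theta> 1 \<omega>) \<le> exp (f \<omega>) * (exp (g \<omega>) * q (\<theta> t \<omega>))" .
  have pos: "0 < \<rho> 1 \<omega>" "0 < q (\<theta> 1 \<omega>)" "0 < q (\<theta> t \<omega>)"
    using \<rho>_pos[OF \<omega>, of 1] q_pos D_flow[OF \<omega>] by auto
  have "ln (\<rho> 1 \<omega> * q (\<theta> 1 \<omega>)) \<le> ln (exp (f \<omega>) * (exp (g \<omega>) * q (\<theta> t \<omega>)))"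
    using le pos by (subst ln_le_cancel_iff) auto
  then have "ln (\<rho> 1 \<omega>) + ln (q (\<theta> 1 \<omega>)) \<le> f \<omega> + (g \<omega> + ln (q (\<theta> t \<omega>)))"
    using pos by (simp add: ln_mult)
  moreover have "r \<omega> = ln (\<rho> 1 \<omega>)" using \<omega> by (simp add: r_def)
  ultimately show ?thesis by linarith
qed

text \<open>Temperedness: the increments of \<open>- ln q\<close> along the flow have an integrable one-sided bound, so \<open>q\<close> cannot
  decay exponentially, although no integrability of \<open>ln \<kappa>\<close> is available.\<close>

lemma P_tempered:
  assumes r_int: "integrable M r"
  shows "AE \<omega> in M. ((\<lambda>t. 1 / t * ln (onorm (P (\<theta> t \<omega>)))) \<longlongrightarrow> 0) at_top \<and>
    ((\<lambda>t. 1 / t * ln (onorm (P (\<theta> t \<omega>)))) \<longlongrightarrow> 0) at_bot"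
proof -
  interpret T: mp_transformation M "\<theta> 1" by (rule mp_flow)
  interpret T': mp_transformation M "\<theta> (- 1)" by (rule mp_flow)
  have it: "(\<theta> 1 ^^ n) \<omega> = \<theta> (real n) \<omega>" "(\<theta> (- 1) ^^ n) \<omega> = \<theta> (- real n) \<omega>" if "\<omega> \<in> D" for n \<omega>
    using flow_iter[OF D_space[OF that], where t = 1 and n = n] flow_iter[OF D_space[OF that], where t = "- 1" and n = n] by simp_all
  define G where "G \<omega> = indicator D \<omega> * - ln (q \<omega>)" for \<omega>
  define k where "k \<omega> = \<bar>r \<omega>\<bar> + f \<omega> + g \<omega>" for \<omega>
  have k_int: "integrable M k" unfolding k_def[abs_def] using r_int f_int g_int by auto
  have k0: "0 \<le> k \<omega>" for \<omega> using f_nonneg g_nonneg by (simp add: k_def)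
  have G_meas: "G \<in> borel_measurable M"
    unfolding G_def[abs_def] by (intro indicator_measurable borel_measurable_uminus borel_measurable_ln q_measurable)
  have G0: "0 \<le> G \<omega>" for \<omega> using q_pos[of \<omega>] q_le_1[of \<omega>] by (auto simp: G_def indicator_def)
  have GD: "G \<omega> = - ln (q \<omega>)" if "\<omega> \<in> D" for \<omega> using that by (simp add: G_def)
  have inc: "AE \<omega> in M. \<omega> \<in> D \<longrightarrow> G \<omega> \<le> G (\<theta> 1 \<omega>) + k \<omega>"
    using f_bound g_bound AE_D
  proof eventually_elim
    case (elim \<omega>)
    have z: "\<theta> 0 \<omega> = \<omega>" by (rule flow_zero[OF D_space[OF elim(3)]])
    have "norm (U \<omega> 0) \<le> exp (f \<omega>)" "norm (U (\<theta> 0 \<omega>) (1 - 0)) \<le> exp (g \<omega>)"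
      using elim(1,2) by (simp_all only: Ball_def atLeastAtMost_iff) auto
    from q_increment[OF elim(3) _ _ this] show ?case
      using elim(3) D_flow[OF elim(3)] unfolding z by (simp add: GD k_def)
  qed
  have inc': "AE \<omega> in M. \<omega> \<in> D \<longrightarrow> G (\<theta> (- 1) \<omega>) \<le> G \<omega> + k (\<theta> (- 1) \<omega>)"
    using AE_flow[OF inc, of "- 1"] AE_D
  proof eventually_elim
    case (elim \<omega>)
    have "\<theta> 1 (\<theta> (- 1) \<omega>) = \<omega>" by (simp add: flow_flow[OF D_space[OF elim(2)]] flow_zero[OF D_space[OF elim(2)]])
    then show ?case using elim(1) D_flow[OF elim(2), of "- 1"] by simp
  qed
  have k'_int: "integrable M (\<lambda>\<omega>. k (\<theta> (- 1) \<omega>))" by (rule T'.integrable_comp_T[OF k_int])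
  \<comment> \<open>The single one-sided inequality reads differently in the two time directions:
    along \<open>\<theta> 1\<close> it limits how fast \<open>G\<close> can drop, along
    \<open>\<theta> (- 1)\<close> how fast it can grow.\<close>
  have fwd: "AE \<omega> in M. \<omega> \<in> D \<longrightarrow> (\<forall>\<epsilon>>0. \<forall>\<^sub>F n in sequentially. G ((\<theta> 1 ^^ n) \<omega>) \<le> \<epsilon> * real n)"
    by (rule T.AE_sublinear_if_decrement_le[OF G_meas D_sets invariant_set_iff[OF D_inv] G0 k_int k0 inc])
  have bwd: "AE \<omega> in M. \<omega> \<in> D \<longrightarrow> (\<forall>\<epsilon>>0. \<forall>\<^sub>F n in sequentially. G ((\<theta> (- 1) ^^ n) \<omega>) \<le> \<epsilon> * real n)"
    by (rule T'.AE_sublinear_if_increment_le[OF G_meas D_sets D_flow G0 k'_int k0 inc'])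
  have bounds: "AE \<omega> in M. \<forall>n::int. (\<forall>s\<in>{0..1}. norm (U (\<theta> (real_of_int n) \<omega>) s) \<le> exp (f (\<theta> (real_of_int n) \<omega>))) \<and>
      (\<forall>s\<in>{0..1}. norm (U (\<theta> s (\<theta> (real_of_int n) \<omega>)) (1 - s)) \<le> exp (g (\<theta> (real_of_int n) \<omega>)))"
    unfolding AE_all_countable
  proof
    fix n :: int
    show "AE \<omega> in M. (\<forall>s\<in>{0..1}. norm (U (\<theta> (real_of_int n) \<omega>) s) \<le> exp (f (\<theta> (real_of_int n) \<omega>))) \<and>
      (\<forall>s\<in>{0..1}. norm (U (\<theta> s (\<theta> (real_of_int n) \<omega>)) (1 - s)) \<le> exp (g (\<theta> (real_of_int n) \<omega>)))"
      using AE_flow[OF f_bound, of "real_of_int n"] AE_flow[OF g_bound, of "real_of_int n"] by eventually_elim blast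
  qed
  show ?thesis
    using fwd bwd T.AE_sublinear[OF k_int] T'.AE_sublinear[OF k_int] bounds AE_D
  proof eventually_elim
    case (elim \<omega>)
    note \<omega> = elim(6)
    have sp: "\<omega> \<in> space M" by (rule D_space[OF \<omega>])
    \<comment> \<open>A bound for the whole interval from \<open>n\<close> to \<open>n + 1\<close>.
      The increment estimate refers to the right endpoint, whence \<open>G\<close> at
      \<open>n + 1\<close>, and \<open>ln 2\<close> comes from the bound \<open>2 / q\<close> on the
      norm of the projection.\<close>
    define H where "H n = ln 2 + G (\<theta> (real_of_int (n + 1)) \<omega>) + k (\<theta> (real_of_int n) \<omega>)" for n :: int
    define L where "L t = ln (onorm (P (\<theta> t \<omega>)))" for t
    have L0: "0 \<le> L t" for t using onorm_P_ge_1[of "\<theta> t \<omega>"] by (simp add: L_def)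
    have LH: "L t \<le> H \<lfloor>t\<rfloor>" for t
    proof -
      define n where "n = \<lfloor>t\<rfloor>"
      define s where "s = t - real_of_int n"
      have s: "0 \<le> s" "s \<le> 1" unfolding s_def n_def by linarith+
      have nD: "\<theta> (real_of_int n) \<omega> \<in> D" by (rule D_flow[OF \<omega>])
      have fl: "\<theta> s (\<theta> (real_of_int n) \<omega>) = \<theta> t \<omega>" "\<theta> 1 (\<theta> (real_of_int n) \<omega>) = \<theta> (real_of_int (n + 1)) \<omega>"
        by (simp_all add: flow_flow[OF sp] s_def)
      have "- ln (q (\<theta> s (\<theta> (real_of_int n) \<omega>))) \<le> - ln (q (\<theta> 1 (\<theta> (real_of_int n) \<omega>)))
          + \<bar>r (\<theta> (real_of_int n) \<omega>)\<bar> + f (\<theta> (real_of_int n) \<omega>) + g (\<theta> (real_of_int n) \<omega>)"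
        by (rule q_increment[OF nD s]) (use elim(5) s in auto)
      then have 1: "- ln (q (\<theta> t \<omega>)) \<le> G (\<theta> (real_of_int (n + 1)) \<omega>) + k (\<theta> (real_of_int n) \<omega>)"
        unfolding fl by (simp add: GD[OF D_flow[OF \<omega>]] k_def)
      have qt: "0 < q (\<theta> t \<omega>)" by (rule q_pos[OF D_flow[OF \<omega>]])
      have "L t \<le> ln (2 / q (\<theta> t \<omega>))"
        unfolding L_def using onorm_P_le[OF D_flow[OF \<omega>], of t] onorm_P_ge_1[of "\<theta> t \<omega>"] qt
        by (subst ln_le_cancel_iff) auto
      also have "\<dots> = ln 2 - ln (q (\<theta> t \<omega>))" using qt by (simp add: ln_div)
      finally show ?thesis using 1 unfolding H_def n_def by simp
    qed
    have const: "\<forall>\<^sub>F n in sequentially. c \<le> \<delta> * real n" if "0 < \<delta>" for c \<delta> :: real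
    proof -
      have "\<forall>\<^sub>F n in sequentially. c / \<delta> \<le> real n"
        using filterlim_real_sequentially by (simp add: filterlim_at_top)
      then show ?thesis by eventually_elim (use that in \<open>simp add: field_simps\<close>)
    qed
    have top: "\<forall>\<^sub>F n in sequentially. H (int n) \<le> \<delta> * real n" if \<delta>: "0 < \<delta>" for \<delta>
    proof -
      have d: "0 < \<delta> / 4" using \<delta> by simp
      have "\<forall>\<^sub>F n in sequentially. G (\<theta> (real n) \<omega>) \<le> \<delta> / 4 * real n" using elim(1) \<omega> d unfolding it[OF \<omega>] by blast
      then have "\<forall>\<^sub>F n in sequentially. G (\<theta> (real (Suc n)) \<omega>) \<le> \<delta> / 4 * real (Suc n)"
        by (subst eventually_sequentially_Suc)
      moreover have "\<forall>\<^sub>F n in sequentially. \<bar>k (\<theta> (real n) \<omega>)\<bar> \<le> \<delta> / 4 * real n" using elim(3) d unfolding it[OF \<omega>] by blast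
      ultimately show ?thesis using const[OF d, of "ln 2 + \<delta> / 4"]
      proof eventually_elim
        case (elim n)
        have "H (int n) = ln 2 + G (\<theta> (real (Suc n)) \<omega>) + k (\<theta> (real n) \<omega>)" by (simp add: H_def add.commute)
        moreover have "\<delta> / 4 * real (Suc n) = \<delta> / 4 + \<delta> / 4 * real n" by (simp add: field_simps)
        moreover have "\<delta> * real n = \<delta> / 4 * real n + \<delta> / 4 * real n + \<delta> / 4 * real n + \<delta> / 4 * real n" by simp
        moreover have "0 \<le> \<delta> / 4 * real n" using \<delta> by simp
        ultimately show ?case using elim by linarith
      qed
    qed
    have bot: "\<forall>\<^sub>F n in sequentially. H (- int n) \<le> \<delta> * real n" if \<delta>: "0 < \<delta>" for \<delta>
    proof -
      have d: "0 < \<delta> / 4" using \<delta> by simp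
      have ev: "\<forall>\<^sub>F n in sequentially. G (\<theta> (- real n) \<omega>) \<le> \<delta> / 4 * real n" using elim(2) \<omega> d unfolding it[OF \<omega>] by blast
      \<comment> \<open>In the past the right endpoint \<open>- n + 1\<close> is one step closer to
        0, so the estimate at index \<open>n - 1\<close> is reused.\<close>
      have "\<forall>\<^sub>F n in sequentially. G (\<theta> (1 - real n) \<omega>) \<le> \<delta> / 4 * real n"
      proof (subst eventually_sequentially_Suc[symmetric], use ev in eventually_elim)
        case (elim n)
        have "\<delta> / 4 * real n \<le> \<delta> / 4 * real (Suc n)" using \<delta> by simp
        with elim show ?case by simp
      qed
      moreover have "\<forall>\<^sub>F n in sequentially. \<bar>k (\<theta> (- real n) \<omega>)\<bar> \<le> \<delta> / 4 * real n" using elim(4) d unfolding it[OF \<omega>] by blast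
      ultimately show ?thesis using const[OF d, of "ln 2"]
      proof eventually_elim
        case (elim n)
        have "H (- int n) = ln 2 + G (\<theta> (1 - real n) \<omega>) + k (\<theta> (- real n) \<omega>)" by (simp add: H_def)
        moreover have "\<delta> * real n = \<delta> / 4 * real n + \<delta> / 4 * real n + \<delta> / 4 * real n + \<delta> / 4 * real n" by simp
        moreover have "0 \<le> \<delta> / 4 * real n" using \<delta> by simp
        ultimately show ?case using elim by linarith
      qed
    qed
    from int_floor_cases_sublinear[OF top bot L0 LH] show ?case unfolding L_def by blast
  qed
qed

lemma P_family_measurable:
  assumes "D' \<subseteq> D" "D' \<in> sets M"
  shows "strongly_measurable_family M D' (\<lambda>\<omega>. proj_onto_along (F \<omega>) (E \<omega>))"
  unfolding strongly_measurable_family_def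
proof
  fix u
  have "(\<lambda>\<omega>. P \<omega> u) \<in> borel_measurable (restrict_space M D')"
    by (rule measurable_restrict_mono[OF P_measurable assms(1)])
  also have "?this \<longleftrightarrow> (\<lambda>\<omega>. proj_onto_along (F \<omega>) (E \<omega>) u) \<in> borel_measurable (restrict_space M D')"
    by (rule measurable_cong) (use assms(1) in \<open>auto simp: space_restrict_space proj_eq_P\<close>)
  finally show "(\<lambda>\<omega>. proj_onto_along (F \<omega>) (E \<omega>) u) \<in> borel_measurable (restrict_space M D')" .
qed

lemma P_family_tempered:
  assumes D': "D' \<subseteq> D" and r_int: "integrable M r"
  shows "tempered_family M \<theta> D' (\<lambda>\<omega>. proj_onto_along (F \<omega>) (E \<omega>))"
  unfolding tempered_family_def
proof (intro conjI ballI)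
  have eq: "proj_onto_along (F \<omega>) (E \<omega>) = P \<omega>" if "\<omega> \<in> D" for \<omega> by (rule ext) (rule proj_eq_P[OF that])
  show "bounded_linear (proj_onto_along (F \<omega>) (E \<omega>))" if "\<omega> \<in> D'" for \<omega>
    using that D' P_linear by (subst eq) auto
  show "AE \<omega> in M. \<omega> \<in> D' \<longrightarrow>
       ((\<lambda>t. ereal (1 / t) * eln (onorm (proj_onto_along (F (\<theta> t \<omega>)) (E (\<theta> t \<omega>))))) \<longlongrightarrow> 0) at_top \<and>
       ((\<lambda>t. ereal (1 / t) * eln (onorm (proj_onto_along (F (\<theta> t \<omega>)) (E (\<theta> t \<omega>))))) \<longlongrightarrow> 0) at_bot"
    using P_tempered[OF r_int] AE_D
  proof eventually_elim
    case (elim \<omega>)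
    have *: "ereal (1 / t) * eln (onorm (proj_onto_along (F (\<theta> t \<omega>)) (E (\<theta> t \<omega>)))) = ereal (1 / t * ln (onorm (P (\<theta> t \<omega>))))" for t
    proof -
      have "0 < onorm (P (\<theta> t \<omega>))" using onorm_P_ge_1[of "\<theta> t \<omega>"] by linarith
      then show ?thesis unfolding eq[OF D_flow[OF elim(2)]] by (simp add: eln_def)
    qed
    show ?case unfolding * zero_ereal_def using elim(1) by (auto intro: tendsto_ereal)
  qed
qed

section \<open>The exponential separation on a single invariant set\<close>

lemma invariant_decomposition:
  assumes "invariant_set M \<theta> D'" "D' \<subseteq> D"
  shows "invariant_decomposition1 M \<theta> U D' E F"
  unfolding invariant_decomposition1_def
proof (intro conjI ballI allI impI)
  fix \<omega> t assume "\<omega> \<in> D'" and t: "0 \<le> (t::real)"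
  then have \<omega>: "\<omega> \<in> D" using assms(2) by blast
  show "blinfun_apply (U \<omega> t) ` E \<omega> = E (\<theta> t \<omega>)" by (rule E_flow[OF \<omega> t])
  show "blinfun_apply (U \<omega> t) ` F \<omega> \<subseteq> F (\<theta> t \<omega>)"
  proof
    fix y assume "y \<in> blinfun_apply (U \<omega> t) ` F \<omega>"
    then obtain u where u: "u \<in> F \<omega>" "y = ap \<omega> t u" by (rule imageE) blast
    show "y \<in> F (\<theta> t \<omega>)" unfolding u(2) by (rule F_flow[OF \<omega> t u(1)])
  qed
qed (use assms decomposition in auto)

lemma kernel_eq: "\<omega> \<in> D \<Longrightarrow> F \<omega> \<inter> C = {u\<in>C. blinfun_apply (U \<omega> 1) u = 0}"
  using wd_zero by auto

text \<open>Upper bounds for the rates propagate backwards along orbits, lower bounds forwards.\<close>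

lemma rates_on_invariant_set:
  assumes lam: "- \<infinity> < principal_exponent M \<theta> U e"
  obtains D' l m where "invariant_set M \<theta> D'" "prob D' = 1" "D' \<subseteq> D" "l < ereal m"
    "principal_exponent M \<theta> U e = ereal m"
    "\<And>\<omega>. \<omega> \<in> D' \<Longrightarrow> rate_le (\<lambda>t. \<rho> t \<omega>) (ereal m)" "\<And>\<omega>. \<omega> \<in> D' \<Longrightarrow> rate_ge (\<lambda>t. \<rho> t \<omega>) (ereal m)"
    "\<And>\<omega>. \<omega> \<in> D' \<Longrightarrow> rate_le (\<lambda>t. R t \<omega>) l" "\<And>\<omega>. \<omega> \<in> D' \<Longrightarrow> rate_ge (\<lambda>t. R t \<omega>) l"
proof -
  note r_int = principal_exponent_finite[OF lam]
  define m where "m = (\<integral>\<omega>. r \<omega> \<partial>M)"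
  have \<rho>: "AE \<omega> in M. rate_le (\<lambda>t. \<rho> t \<omega>) (ereal m) \<and> rate_ge (\<lambda>t. \<rho> t \<omega>) (ereal m)"
    unfolding m_def by (rule \<rho>_rate[OF r_int(1)])
  obtain l where R: "AE \<omega> in M. rate_le (\<lambda>t. R t \<omega>) l \<and> rate_ge (\<lambda>t. R t \<omega>) l" using R_rate by blast
  have lm: "l < ereal m" by (rule R_rate_less) (use \<rho> R in \<open>auto elim: eventually_mono\<close>)
  let ?Q = "\<lambda>\<omega>. \<omega> \<in> D \<and> rate_le (\<lambda>t. \<rho> t \<omega>) (ereal m) \<and> rate_ge (\<lambda>t. \<rho> t \<omega>) (ereal m) \<and>
    rate_le (\<lambda>t. R t \<omega>) l \<and> rate_ge (\<lambda>t. R t \<omega>) l"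
  have "AE \<omega> in M. ?Q \<omega>" using AE_D \<rho> R by eventually_elim blast
  then obtain D' where D': "invariant_set M \<theta> D'" "prob D' = 1"
    "\<And>\<omega> s. \<omega> \<in> D' \<Longrightarrow> \<exists>t\<ge>s. ?Q (\<theta> t \<omega>)" "\<And>\<omega> s. \<omega> \<in> D' \<Longrightarrow> \<exists>t\<le>s. ?Q (\<theta> t \<omega>)"
    by (rule AE_invariant_set) blast
  have sub: "D' \<subseteq> D"
  proof
    fix \<omega> assume \<omega>: "\<omega> \<in> D'"
    then obtain t where "\<theta> t \<omega> \<in> D" using D'(3) by blast
    then show "\<omega> \<in> D" using invariant_set_iff[OF D_inv invariant_set_space[OF D'(1) \<omega>]] by blast
  qed
  show ?thesis
  proof (rule that[OF D'(1,2) sub lm])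
    show "principal_exponent M \<theta> U e = ereal m" unfolding m_def by (rule r_int(2))
    fix \<omega> assume \<omega>: "\<omega> \<in> D'"
    then have \<omega>D: "\<omega> \<in> D" using sub by blast
    obtain s where s: "s \<ge> 0" "?Q (\<theta> s \<omega>)" using D'(3)[OF \<omega>] by blast
    obtain s' where s': "s' \<le> 0" "?Q (\<theta> s' \<omega>)" using D'(4)[OF \<omega>] by blast
    show "rate_le (\<lambda>t. \<rho> t \<omega>) (ereal m)" using \<rho>_rate_shift(1)[OF \<omega>D s(1)] s(2) by blast
    show "rate_ge (\<lambda>t. \<rho> t \<omega>) (ereal m)" using \<rho>_rate_shift(2)[OF \<omega>D s'(1)] s'(2) by blast
    show "rate_le (\<lambda>t. R t \<omega>) l" using R_rate_shift(1)[OF \<omega>D s(1)] s(2) by blast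
    show "rate_ge (\<lambda>t. R t \<omega>) l" using R_rate_shift(2)[OF \<omega>D s'(1)] s'(2) by blast
  qed
qed

lemma separation:
  assumes lam: "- \<infinity> < principal_exponent M \<theta> U e"
  shows "\<exists>\<Omega>\<^sub>0. invariant_set M \<theta> \<Omega>\<^sub>0 \<and> measure M \<Omega>\<^sub>0 = 1 \<and>
    (\<forall>\<omega>\<in>\<Omega>\<^sub>0. (pullback_direction \<theta> U e \<omega> \<longlongrightarrow> w \<omega>) at_top \<and>
             (dual_pullback_direction \<theta> U ed \<omega> \<longlongrightarrow> wd \<omega>) at_top) \<and>
    w \<in> restrict_space M \<Omega>\<^sub>0 \<rightarrow>\<^sub>M borel \<and>
    wd \<in> restrict_space M \<Omega>\<^sub>0 \<rightarrow>\<^sub>M borel \<and>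
    invariant_decomposition1 M \<theta> U \<Omega>\<^sub>0 E F \<and>
    strongly_measurable_family M \<Omega>\<^sub>0 (\<lambda>\<omega>. proj_onto_along (F \<omega>) (E \<omega>)) \<and>
    tempered_family M \<theta> \<Omega>\<^sub>0 (\<lambda>\<omega>. proj_onto_along (F \<omega>) (E \<omega>)) \<and>
    (\<forall>\<omega>\<in>\<Omega>\<^sub>0. F \<omega> \<inter> C = {u\<in>C. blinfun_apply (U \<omega> 1) u = 0}) \<and>
    (\<forall>\<omega>\<in>\<Omega>\<^sub>0. \<forall>u. u \<notin> F \<omega> \<longrightarrow> blinfun_apply (U \<omega> 1) u \<noteq> 0 \<longrightarrow>
       ((\<lambda>t. ereal (1 / t) * eln (norm (U \<omega> t))) \<longlongrightarrow> principal_exponent M \<theta> U e) at_top \<and>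
       ((\<lambda>t. ereal (1 / t) * eln (norm (blinfun_apply (U \<omega> t) u))) \<longlongrightarrow> principal_exponent M \<theta> U e) at_top) \<and>
    (\<exists>\<sigma> lam2 :: ereal. 0 < \<sigma> \<and> lam2 = principal_exponent M \<theta> U e - \<sigma> \<and>
       (\<forall>\<omega>\<in>\<Omega>\<^sub>0.
          ((\<lambda>t. ereal (1 / t) *
              eln (restricted_norm (U \<omega> t) (F \<omega>) / norm (blinfun_apply (U \<omega> t) (w \<omega>))))
             \<longlongrightarrow> - \<sigma>) at_top \<and>
          ((\<lambda>t. ereal (1 / t) * eln (restricted_norm (U \<omega> t) (F \<omega>))) \<longlongrightarrow> lam2) at_top)) \<and>
    exponential_separation_II M \<theta> U C \<Omega>\<^sub>0 E F w"
proof -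
  obtain D' l m where D': "invariant_set M \<theta> D'" "prob D' = 1" "D' \<subseteq> D" and lm: "l < ereal m"
    and pe: "principal_exponent M \<theta> U e = ereal m"
    and \<rho>: "\<And>\<omega>. \<omega> \<in> D' \<Longrightarrow> rate_le (\<lambda>t. \<rho> t \<omega>) (ereal m)" "\<And>\<omega>. \<omega> \<in> D' \<Longrightarrow> rate_ge (\<lambda>t. \<rho> t \<omega>) (ereal m)"
    and R: "\<And>\<omega>. \<omega> \<in> D' \<Longrightarrow> rate_le (\<lambda>t. R t \<omega>) l" "\<And>\<omega>. \<omega> \<in> D' \<Longrightarrow> rate_ge (\<lambda>t. R t \<omega>) l"
    using rates_on_invariant_set[OF lam] by blast
  have D's: "D' \<in> sets M" using D'(1) by (simp add: invariant_set_def)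
  have r_int: "integrable M r" by (rule principal_exponent_finite(1)[OF lam])
  \<comment> \<open>\<open>m\<close> is finite, so the difference is well defined also for
    \<open>l = - \<infinity>\<close>; then \<open>\<sigma> = \<infinity>\<close> and the second
    exponent is \<open>- \<infinity>\<close>.\<close>
  define \<sigma> where "\<sigma> = ereal m - l"
  have \<sigma>: "0 < \<sigma>" "l = ereal m - \<sigma>" "l - ereal m = - \<sigma>" using lm unfolding \<sigma>_def by (cases l; simp)+
  have lims: "\<forall>\<omega>\<in>D'. (pullback_direction \<theta> U e \<omega> \<longlongrightarrow> w \<omega>) at_top \<and> (dual_pullback_direction \<theta> U ed \<omega> \<longlongrightarrow> wd \<omega>) at_top"
    using w_lim wd_lim D'(3) by blast
  have wm: "w \<in> borel_measurable (restrict_space M D')" and wdm: "wd \<in> borel_measurable (restrict_space M D')"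
    by (rule measurable_restrict_mono[OF w_measurable D'(3)], rule measurable_restrict_mono[OF wd_measurable D'(3)])
  note inv = invariant_decomposition[OF D'(1,3)]
  note sm = P_family_measurable[OF D'(3) D's]
  note te = P_family_tempered[OF D'(3) r_int]
  have ker: "\<forall>\<omega>\<in>D'. F \<omega> \<inter> C = {u\<in>C. blinfun_apply (U \<omega> 1) u = 0}" using kernel_eq D'(3) by blast
  have lim_w: "((\<lambda>t. ereal (1 / t) * eln (norm (blinfun_apply (U \<omega> t) (w \<omega>)))) \<longlongrightarrow> ereal m) at_top" if "\<omega> \<in> D'" for \<omega>
    using rate_limit[OF \<rho>(1,2)[OF that]] unfolding \<rho>_def .
  have item3: "\<forall>\<omega>\<in>D'. \<forall>u. u \<notin> F \<omega> \<longrightarrow> blinfun_apply (U \<omega> 1) u \<noteq> 0 \<longrightarrow>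
       ((\<lambda>t. ereal (1 / t) * eln (norm (U \<omega> t))) \<longlongrightarrow> ereal m) at_top \<and>
       ((\<lambda>t. ereal (1 / t) * eln (norm (blinfun_apply (U \<omega> t) u))) \<longlongrightarrow> ereal m) at_top"
  proof (intro ballI allI impI conjI)
    fix \<omega> u assume \<omega>': "\<omega> \<in> D'" and u: "u \<notin> F \<omega>"
    have \<omega>: "\<omega> \<in> D" using \<omega>' D'(3) by blast
    note nr = norm_U_rate[OF \<omega> \<rho>(1)[OF \<omega>'] \<rho>(2)[OF \<omega>'] R(1)[OF \<omega>'] lm]
    show "((\<lambda>t. ereal (1 / t) * eln (norm (U \<omega> t))) \<longlongrightarrow> ereal m) at_top" by (rule rate_limit[OF nr(1,2)])
    show "((\<lambda>t. ereal (1 / t) * eln (norm (blinfun_apply (U \<omega> t) u))) \<longlongrightarrow> ereal m) at_top" by (rule rate_limit[OF nr(3,4)]) (rule u)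
  qed
  have ratio: "((\<lambda>t. ereal (1 / t) * eln (restricted_norm (U \<omega> t) (F \<omega>) / norm (blinfun_apply (U \<omega> t) (w \<omega>)))) \<longlongrightarrow> - \<sigma>) at_top"
    if \<omega>': "\<omega> \<in> D'" for \<omega>
  proof -
    have \<omega>: "\<omega> \<in> D" using \<omega>' D'(3) by blast
    have "rate_le (\<lambda>t. R t \<omega> / \<rho> t \<omega>) (l - ereal m)"
      by (rule rate_le_divide[OF R(1)[OF \<omega>'] \<rho>(2)[OF \<omega>']]) (simp add: R_nonneg)
    moreover have "rate_ge (\<lambda>t. R t \<omega> / \<rho> t \<omega>) (l - ereal m)"
      by (rule rate_ge_divide[OF R(2)[OF \<omega>'] \<rho>(1)[OF \<omega>']])
         (rule eventually_mono[OF eventually_ge_at_top[of 0] \<rho>_pos[OF \<omega>]])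
    ultimately show ?thesis using rate_limit unfolding \<sigma>(3) R_def \<rho>_def by blast
  qed
  have lim_R: "((\<lambda>t. ereal (1 / t) * eln (restricted_norm (U \<omega> t) (F \<omega>))) \<longlongrightarrow> l) at_top" if "\<omega> \<in> D'" for \<omega>
    using rate_limit[OF R(1,2)[OF that]] unfolding R_def .
  have floquet: "principal_Floquet M \<theta> U C D' E w"
    unfolding principal_Floquet_def
  proof (intro conjI ballI allI impI exI[of _ "ereal m"] D'(1,2) wm lim_w)
    fix \<omega> assume \<omega>': "\<omega> \<in> D'"
    have \<omega>: "\<omega> \<in> D" using \<omega>' D'(3) by blast
    show "w \<omega> \<in> C - {0}" using w_cone[OF \<omega>] w_norm[OF \<omega>] by auto
    show "blinfun_apply (U \<omega> t) ` E \<omega> = E (\<theta> t \<omega>)" if "0 < t" for t using E_flow[OF \<omega>, of t] that by simp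
    show "Limsup at_top (\<lambda>t. ereal (1 / t) * eln (norm (blinfun_apply (U \<omega> t) u))) \<le> ereal m" for u
      by (rule rate_le_Limsup[OF norm_U_rate(3)[OF \<omega> \<rho>(1)[OF \<omega>'] \<rho>(2)[OF \<omega>'] R(1)[OF \<omega>'] lm]])
  qed auto
  have sep: "exponential_separation_II M \<theta> U C D' E F w"
    unfolding exponential_separation_II_def
    by (intro conjI floquet ker inv sm te exI[of _ \<sigma>] \<sigma>(1) ballI ratio)
  show ?thesis unfolding pe
    by (intro exI[of _ D'] conjI D'(1,2) lims wm wdm inv sm te ker item3 sep exI[of _ \<sigma>] exI[of _ l] \<sigma>(1,2) ballI ratio lim_R)
qed

end

text \<open>A supremum with finite integral is finite almost surely, so its real part is an
  integrable majorant. Where \<open>h\<close> is nonpositive the exponential bound is trivial;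
  elsewhere \<open>ln_plus\<close> dominates the logarithm.\<close>

lemma ennreal_sup_integrable_bound:
  fixes h :: "'s \<Rightarrow> 'w \<Rightarrow> real"
  assumes meas: "(\<lambda>\<omega>. SUP s\<in>S. ennreal (ln_plus (h s \<omega>))) \<in> borel_measurable M"
    and fin: "(\<integral>\<^sup>+\<omega>. (SUP s\<in>S. ennreal (ln_plus (h s \<omega>))) \<partial>M) < \<infinity>"
  obtains b :: "'w \<Rightarrow> real" where "integrable M b" "\<And>\<omega>. 0 \<le> b \<omega>"
    "AE \<omega> in M. \<forall>s\<in>S. h s \<omega> \<le> exp (b \<omega>)"
proof -
  let ?B = "\<lambda>\<omega>. SUP s\<in>S. ennreal (ln_plus (h s \<omega>))"
  have AE_fin: "AE \<omega> in M. ?B \<omega> \<noteq> \<infinity>" by (rule nn_integral_PInf_AE[OF meas]) (use fin in auto)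
  have eq: "ennreal (enn2real x) = x" if "x \<noteq> \<infinity>" for x
    using that by (simp add: less_top)
  have int: "integrable M (\<lambda>\<omega>. enn2real (?B \<omega>))"
  proof (rule integrableI_nonneg)
    show "(\<lambda>\<omega>. enn2real (?B \<omega>)) \<in> borel_measurable M" using meas by measurable
    have "(\<integral>\<^sup>+\<omega>. ennreal (enn2real (?B \<omega>)) \<partial>M) = (\<integral>\<^sup>+\<omega>. ?B \<omega> \<partial>M)"
      by (rule nn_integral_cong_AE) (use AE_fin in eventually_elim, rule eq)
    then show "(\<integral>\<^sup>+\<omega>. ennreal (enn2real (?B \<omega>)) \<partial>M) < \<infinity>" using fin by simp
  qed simp
  show ?thesis
  proof (rule that[OF int])
    show "AE \<omega> in M. \<forall>s\<in>S. h s \<omega> \<le> exp (enn2real (?B \<omega>))"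
      using AE_fin
    proof eventually_elim
      case (elim \<omega>)
      show ?case
      proof
        fix s assume s: "s \<in> S"
        have "ennreal (ln_plus (h s \<omega>)) \<le> ?B \<omega>" by (rule SUP_upper[OF s])
        also have "\<dots> = ennreal (enn2real (?B \<omega>))" by (rule eq[OF elim, symmetric])
        finally have le: "ln_plus (h s \<omega>) \<le> enn2real (?B \<omega>)" by (subst (asm) ennreal_le_iff) auto
        show "h s \<omega> \<le> exp (enn2real (?B \<omega>))"
        proof (cases "h s \<omega> \<le> 0")
          case True
          then show ?thesis using exp_ge_zero order_trans by blast
        next
          case False
          then have "ln (h s \<omega>) \<le> enn2real (?B \<omega>)" using le by (simp add: ln_plus_def)
          then have "exp (ln (h s \<omega>)) \<le> exp (enn2real (?B \<omega>))" by simp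
          then show ?thesis using False by simp
        qed
      qed
    qed
  qed simp
qed

theorem theorem4p6:
  fixes M :: "'w measure"
    and \<theta> :: "real \<Rightarrow> 'w \<Rightarrow> 'w"
    and U :: "'w \<Rightarrow> real \<Rightarrow> ('a::{banach, second_countable_topology} \<Rightarrow>\<^sub>L 'a)"
    and C :: "'a set"
    and e :: 'a
    and e_dual :: "'a \<Rightarrow>\<^sub>L real"
  defines "w \<equiv> principal_w \<theta> U e"
    and "w_dual \<equiv> principal_w_dual \<theta> U e_dual"
    and "lam1 \<equiv> principal_exponent M \<theta> U e"
  defines "E\<^sub>1 \<equiv> \<lambda>\<omega>. span {w \<omega>}"
    and "F\<^sub>1 \<equiv> \<lambda>\<omega>. {u. blinfun_apply (w_dual \<omega>) u = 0}"
  defines "P \<equiv> \<lambda>\<omega>. proj_onto_along (F\<^sub>1 \<omega>) (E\<^sub>1 \<omega>)"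
  assumes "ordered_banach_setting C"
    and "linear_skew_product M \<theta> U"
    and "assumption_A1 M \<theta> U"
    and "assumption_A3 M U C e"
    and "e_dual \<in> dual_cone C" and "blinfun_apply e_dual e = 1" and "norm e_dual = 1"
    and "- \<infinity> < lam1"
  shows "\<exists>\<Omega>\<^sub>0. invariant_set M \<theta> \<Omega>\<^sub>0 \<and> measure M \<Omega>\<^sub>0 = 1 \<and>
    (\<forall>\<omega>\<in>\<Omega>\<^sub>0. (pullback_direction \<theta> U e \<omega> \<longlongrightarrow> w \<omega>) at_top \<and>
             (dual_pullback_direction \<theta> U e_dual \<omega> \<longlongrightarrow> w_dual \<omega>) at_top) \<and>
    w \<in> restrict_space M \<Omega>\<^sub>0 \<rightarrow>\<^sub>M borel \<and>
    w_dual \<in> restrict_space M \<Omega>\<^sub>0 \<rightarrow>\<^sub>M borel \<and>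
    invariant_decomposition1 M \<theta> U \<Omega>\<^sub>0 E\<^sub>1 F\<^sub>1 \<and>
    strongly_measurable_family M \<Omega>\<^sub>0 P \<and> tempered_family M \<theta> \<Omega>\<^sub>0 P \<and>
    (\<forall>\<omega>\<in>\<Omega>\<^sub>0. F\<^sub>1 \<omega> \<inter> C = {u\<in>C. blinfun_apply (U \<omega> 1) u = 0}) \<and>
    (\<forall>\<omega>\<in>\<Omega>\<^sub>0. \<forall>u. u \<notin> F\<^sub>1 \<omega> \<longrightarrow> blinfun_apply (U \<omega> 1) u \<noteq> 0 \<longrightarrow>
       ((\<lambda>t. ereal (1 / t) * eln (norm (U \<omega> t))) \<longlongrightarrow> lam1) at_top \<and>
       ((\<lambda>t. ereal (1 / t) * eln (norm (blinfun_apply (U \<omega> t) u))) \<longlongrightarrow> lam1) at_top) \<and>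
    (\<exists>\<sigma> lam2 :: ereal. 0 < \<sigma> \<and> lam2 = lam1 - \<sigma> \<and>
       (\<forall>\<omega>\<in>\<Omega>\<^sub>0.
          ((\<lambda>t. ereal (1 / t) *
              eln (restricted_norm (U \<omega> t) (F\<^sub>1 \<omega>) / norm (blinfun_apply (U \<omega> t) (w \<omega>))))
             \<longlongrightarrow> - \<sigma>) at_top \<and>
          ((\<lambda>t. ereal (1 / t) * eln (restricted_norm (U \<omega> t) (F\<^sub>1 \<omega>))) \<longlongrightarrow> lam2) at_top)) \<and>
    exponential_separation_II M \<theta> U C \<Omega>\<^sub>0 E\<^sub>1 F\<^sub>1 w"
proof -
  note defs = P_def E\<^sub>1_def F\<^sub>1_def w_def w_dual_def lam1_def
  interpret linear_skew_product M \<theta> U by fact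
  interpret ordered_banach_setting C by fact
  note A3 = \<open>assumption_A3 M U C e\<close>[unfolded assumption_A3_def assumption_A2_def]
  note A2 = A3[THEN conjunct1] and e_in_C = A3[THEN conjunct2, THEN conjunct1]
    and norm_e = A3[THEN conjunct2, THEN conjunct2, THEN conjunct1]
    and U_e = A3[THEN conjunct2, THEN conjunct2, THEN conjunct2, THEN conjunct1]
  from A3 obtain \<kappa> :: "'w \<Rightarrow> real" where \<kappa>: "\<kappa> \<in> borel_measurable M" "\<forall>\<omega>\<in>space M. 1 \<le> \<kappa> \<omega>"
    "\<forall>\<omega>\<in>space M. \<forall>u\<in>C. u \<noteq> 0 \<longrightarrow>
          blinfun_apply (U \<omega> 1) u = 0 \<or>
          (blinfun_apply (U \<omega> 1) u \<noteq> 0 \<and>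
           (\<exists>\<beta>>0. cone_le C (\<beta> *\<^sub>R e) (blinfun_apply (U \<omega> 1) u) \<and>
                  cone_le C (blinfun_apply (U \<omega> 1) u) ((\<kappa> \<omega> * \<beta>) *\<^sub>R e)))"
    by (elim conjE exE) (rule that)
  interpret focusing_skew_product M \<theta> U C e e_dual \<kappa>
  proof
    fix \<omega> assume \<omega>: "\<omega> \<in> space M"
    show "1 \<le> \<kappa> \<omega>" using \<kappa>(2) \<omega> by blast
    show "blinfun_apply (U \<omega> 1) e \<noteq> 0" by (rule bspec[OF U_e \<omega>])
    show "cone_le C (blinfun_apply (U \<omega> t) u) (blinfun_apply (U \<omega> t) v)" if "0 \<le> t" "cone_le C u v" for t u v
      using A2 \<omega> that by blast
    fix u assume u: "u \<in> C" "blinfun_apply (U \<omega> 1) u \<noteq> 0"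
    then have "u \<noteq> 0" by (auto simp: blinfun.zero_right)
    with \<kappa>(3) \<omega> u show "\<exists>\<beta>>0. cone_le C (\<beta> *\<^sub>R e) (blinfun_apply (U \<omega> 1) u) \<and>
                  cone_le C (blinfun_apply (U \<omega> 1) u) ((\<kappa> \<omega> * \<beta>) *\<^sub>R e)" by blast
  qed (use e_in_C norm_e \<kappa>(1) \<open>e_dual \<in> dual_cone C\<close> \<open>blinfun_apply e_dual e = 1\<close> in auto)
  note A1 = \<open>assumption_A1 M \<theta> U\<close>[unfolded assumption_A1_def Let_def]
  obtain f where f: "integrable M f" "\<And>\<omega>. 0 \<le> f \<omega>" "AE \<omega> in M. \<forall>s\<in>{0..1}. norm (U \<omega> s) \<le> exp (f \<omega>)"
    using ennreal_sup_integrable_bound[where S = "{0..1}" and h = "\<lambda>s \<omega>. norm (U \<omega> s)" and M = M] A1 by blast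
  obtain g where g: "integrable M g" "\<And>\<omega>. 0 \<le> g \<omega>" "AE \<omega> in M. \<forall>s\<in>{0..1}. norm (U (\<theta> s \<omega>) (1 - s)) \<le> exp (g \<omega>)"
    using ennreal_sup_integrable_bound[where S = "{0..1}" and h = "\<lambda>s \<omega>. norm (U (\<theta> s \<omega>) (1 - s))" and M = M] A1 by blast
  obtain D where D: "invariant_set M \<theta> D" "prob D = 1"
    "\<And>\<omega>. \<omega> \<in> D \<Longrightarrow> (pullback_direction \<theta> U e \<omega> \<longlongrightarrow> principal_w \<theta> U e \<omega>) at_top"
    "\<And>\<omega>. \<omega> \<in> D \<Longrightarrow> (dual_pullback_direction \<theta> U e_dual \<omega> \<longlongrightarrow> principal_w_dual \<theta> U e_dual \<omega>) at_top"
    "\<And>\<omega>. \<omega> \<in> D \<Longrightarrow> principal_w_dual \<theta> U e_dual \<omega> \<in> dual_cone C"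
    "\<And>\<omega> u. \<omega> \<in> D \<Longrightarrow> u \<in> C \<Longrightarrow> blinfun_apply (principal_w_dual \<theta> U e_dual \<omega>) u = 0 \<longleftrightarrow> blinfun_apply (U \<omega> 1) u = 0"
    by (rule principal_directions_exist) (rule that)
  interpret principal_floquet_setting M \<theta> U C e e_dual \<kappa> D f g
    by unfold_locales (fact D f g)+
  show ?thesis
    unfolding defs
    by (rule separation) (use \<open>- \<infinity> < lam1\<close> in \<open>simp add: lam1_def\<close>)
qed

end
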